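(* Let $X_1,\dots,X_n\in\mathbb{R}^p$ be independent mean-zero random vectors, in the setting and notation given in the context. Then $$\delta_{n,0}\ \le\ 4\Phi_{AC,0}\,\varepsilon_n+\frac{2C_0\log(ep)\,M_n(\varepsilon_n)}{\varepsilon_n^2}+\frac{\log^{1/3}(ep)\,\bar L_{n,0}}{n^{1/3}L_n^{4/3}(2e^{5\mathfrak{C}}C_0)^{1/3}},$$ where $$\varepsilon_n=\frac{\left(2e^{2\mathfrak{C}}C_0\log^2(ep)L_n\right)^{1/3}}{n^{1/6}}.$$
   Context: Setting. $\|\cdot\|$ is the $l_\infty$-norm on $\mathbb{R}^p$ and $x(j)$ is the $j$-th coordinate of $x$. $X_1,\dots,X_n$ are independent mean-zero random vectors in $\mathbb{R}^p$ with covariance matrices $\Sigma_i=\mathbb{E}[X_iX_i^\top]$; $Y_1,\dots,Y_n$ are independent Gaussian vectors, independent of the $X_i$'s, with $Y_i\sim N_p(0,\Sigma_i)$. For $0\le k\le n$, $U_{n,k}:=n^{-1/2}(X_1+\dots+X_k+Y_{k+1}+\dots+Y_n)$, and $$\delta_{n,0}:=\sup_{r\ge0}\max_{1\le k\le n}|\mathbb{P}(\|U_{n,k}\|\le r)-\mathbb{P}(\|U_{n,0}\|\le r)|.$$ Pseudo-moments. $\zeta_i(A):=\mathbb{P}(X_i\in A)-\mathbb{P}(Y_i\in A)$ is a signed measure and $|\zeta_i|$ is its total variation measure. Let $\mu_i$ be the median of $\|Y_i\|$ and $\sigma_i^2:=\max_{1\le j\le p}\mathrm{Var}(Y_i(j))$.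 Define $$L_n:=\frac1n\sum_{i=1}^n\max_{1\le j\le p}\int|x(j)|^3|\zeta_i|(dx),\qquad \bar L_{n,0}:=\frac1n\sum_{i=1}^n(\mu_i+\sigma_i)\max_{1\le j\le p}\int|x(j)|^3|\zeta_i|(dx),$$ $$M_n(\phi):=\frac1n\sum_{i=1}^n\int\|x\|^2\mathbf{1}\{\|x\|\ge n^{1/2}\phi/\log(ep)\}|\zeta_i|(dx),\quad \phi>0.$$ It is assumed that $0<L_n<\infty$. Anti-concentration constant. Let $\mu$ be the median of $\|U_{n,0}\|$, and $\sigma_{\max}^2,\sigma_{\min}^2$ the maximum and minimum over $1\le j\le p$ of $\mathrm{Var}(U_{n,0}(j))$, with $\sigma_{\min}>0$. Put $$\Phi_{AC,0}:=\Theta_0\frac{(\mu+\sigma_{\max})\sigma_{\max}^2+(1+\sigma_{\max})^2\sigma_{\max}^{2}}{\sigma_{\min}^4},$$ where $\Theta_0$ is a fixed universal constant such that, for this form of $\Phi_{AC,0}$ (with the corresponding $\mu,\sigma_{\max},\sigma_{\min}$), every centered sample continuous Gaussian process $Y$ on a compact metric space with positive minimal variance satisfies $\sup_{r\ge0}\mathbb{P}(r-\varepsilon\le\|Y\|\le r+\varepsilon)\le\Phi_{AC,0}\varepsilon$ for all $\varepsilon\ge0$. Smoothing constants. $C_0,\mathfrak{C}>0$ are fixed universal constants with the following property: for every $p\ge1$, $r\ge0$, $\varepsilon>0$ there are a three times continuously differentiable $\varphi:\mathbb{R}^p\to[0,1]$ and nonnegative measurable functions $D_j,D_{jk},D_{jkl}$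 ($1\le j,k,l\le p$) on $\mathbb{R}^p$ such that (1) $\mathbf{1}\{\|x\|\le r\}\le\varphi(x)\le\mathbf{1}\{\|x\|\le r+\varepsilon\}$; (2) $|\partial_j\varphi|\le D_j$, $|\partial_{jk}\varphi|\le D_{jk}$, $|\partial_{jkl}\varphi|\le D_{jkl}$ pointwise, and for all $x$, $\sum_jD_j(x)\le C_0\varepsilon^{-1}$, $\sum_{j,k}D_{jk}(x)\le C_0\log(ep)\varepsilon^{-2}$, $\sum_{j,k,l}D_{jkl}(x)\le C_0\log^2(ep)\varepsilon^{-3}$; (3) for all $x,w$ and each $D\in\{D_j,D_{jk},D_{jkl}\}$, $e^{-\mathfrak{C}\log(ep)\|w\|/\varepsilon}D(x)\le D(x+w)\le e^{\mathfrak{C}\log(ep)\|w\|/\varepsilon}D(x)$. *)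

theory Defs
  imports "HOL-Probability.Probability"
begin

text \<open>
  The constants \<open>C\<^sub>0\<close> and \<open>\<CC>\<close> below are universal: their defining property quantifies over
  all dimensions \<open>p\<close>.  Hence \<open>\<real>\<^sup>p\<close> is not a type \<open>real ^ 'p\<close> but the set of extensional functions
  \<open>{1..p} \<rightarrow>\<^sub>E UNIV\<close>, with its product Borel structure.
\<close>

abbreviation Rp :: "nat \<Rightarrow> (nat \<Rightarrow> real) measure" where
  "Rp p \<equiv> \<Pi>\<^sub>M j\<in>{1..p}. borel"

definition vnorm :: "nat \<Rightarrow> (nat \<Rightarrow> real) \<Rightarrow> real" where
  "vnorm p x = Max ((\<lambda>j. \<bar>x j\<bar>) ` {1..p})"

definition vadd :: "nat \<Rightarrow> (nat \<Rightarrow> real) \<Rightarrow> (nat \<Rightarrow> real) \<Rightarrow> nat \<Rightarrow> real" where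
  "vadd p x w = (\<lambda>j\<in>{1..p}. x j + w j)"

definition logep :: "nat \<Rightarrow> real" where
  "logep p = ln (exp 1 * real p)"


subsection \<open>Smoothing constants\<close>

definition pdiff :: "nat \<Rightarrow> ((nat \<Rightarrow> real) \<Rightarrow> real) \<Rightarrow> (nat \<Rightarrow> real) \<Rightarrow> real" where
  "pdiff j f x = deriv (\<lambda>t. f (x(j := t))) (x j)"

text \<open>\<open>m\<close> times continuously differentiable: all iterated partial derivatives up to order \<open>m\<close>
  exist and are continuous on \<open>\<real>\<^sup>p\<close>.\<close>

fun Ck :: "nat \<Rightarrow> nat \<Rightarrow> ((nat \<Rightarrow> real) \<Rightarrow> real) \<Rightarrow> bool" where
  "Ck p 0 f \<longleftrightarrow> continuous_map (powertop_real {1..p}) euclideanreal f"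
| "Ck p (Suc m) f \<longleftrightarrow>
     continuous_map (powertop_real {1..p}) euclideanreal f \<and>
     (\<forall>j\<in>{1..p}.
        (\<forall>x\<in>space (Rp p). (\<lambda>t. f (x(j := t))) differentiable (at (x j))) \<and>
        Ck p m (pdiff j f))"

definition log_stable :: "nat \<Rightarrow> real \<Rightarrow> real \<Rightarrow> ((nat \<Rightarrow> real) \<Rightarrow> real) \<Rightarrow> bool" where
  "log_stable p CC \<epsilon> D \<longleftrightarrow>
     (\<forall>x\<in>space (Rp p). \<forall>w\<in>space (Rp p).
        exp (- (CC * logep p * vnorm p w / \<epsilon>)) * D x \<le> D (vadd p x w) \<and>
        D (vadd p x w) \<le> exp (CC * logep p * vnorm p w / \<epsilon>) * D x)"

definition admissible_bound :: "nat \<Rightarrow> real \<Rightarrow> real \<Rightarrow> ((nat \<Rightarrow> real) \<Rightarrow> real) \<Rightarrow> bool" where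
  "admissible_bound p CC \<epsilon> D \<longleftrightarrow>
     D \<in> borel_measurable (Rp p) \<and> (\<forall>x\<in>space (Rp p). 0 \<le> D x) \<and> log_stable p CC \<epsilon> D"

definition smoothing_constants :: "real \<Rightarrow> real \<Rightarrow> bool" where
  "smoothing_constants C0 CC \<longleftrightarrow> C0 > 0 \<and> CC > 0 \<and>
     (\<forall>p\<ge>1. \<forall>r\<ge>0. \<forall>\<epsilon>>0.
       \<exists>(\<phi> :: (nat \<Rightarrow> real) \<Rightarrow> real)
         (D1 :: nat \<Rightarrow> (nat \<Rightarrow> real) \<Rightarrow> real)
         (D2 :: nat \<Rightarrow> nat \<Rightarrow> (nat \<Rightarrow> real) \<Rightarrow> real)
         (D3 :: nat \<Rightarrow> nat \<Rightarrow> nat \<Rightarrow> (nat \<Rightarrow> real) \<Rightarrow> real).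
         Ck p 3 \<phi> \<and>
         (\<forall>x\<in>space (Rp p). 0 \<le> \<phi> x \<and> \<phi> x \<le> 1) \<and>
         (\<forall>x\<in>space (Rp p).
            of_bool (vnorm p x \<le> r) \<le> \<phi> x \<and> \<phi> x \<le> of_bool (vnorm p x \<le> r + \<epsilon>)) \<and>
         (\<forall>j\<in>{1..p}. admissible_bound p CC \<epsilon> (D1 j)) \<and>
         (\<forall>j\<in>{1..p}. \<forall>k\<in>{1..p}. admissible_bound p CC \<epsilon> (D2 j k)) \<and>
         (\<forall>j\<in>{1..p}. \<forall>k\<in>{1..p}. \<forall>l\<in>{1..p}. admissible_bound p CC \<epsilon> (D3 j k l)) \<and>
         (\<forall>x\<in>space (Rp p).
            (\<forall>j\<in>{1..p}. \<bar>pdiff j \<phi> x\<bar> \<le> D1 j x) \<and>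
            (\<forall>j\<in>{1..p}. \<forall>k\<in>{1..p}. \<bar>pdiff j (pdiff k \<phi>) x\<bar> \<le> D2 j k x) \<and>
            (\<forall>j\<in>{1..p}. \<forall>k\<in>{1..p}. \<forall>l\<in>{1..p}.
               \<bar>pdiff j (pdiff k (pdiff l \<phi>)) x\<bar> \<le> D3 j k l x) \<and>
            (\<Sum>j\<in>{1..p}. D1 j x) \<le> C0 / \<epsilon> \<and>
            (\<Sum>j\<in>{1..p}. \<Sum>k\<in>{1..p}. D2 j k x) \<le> C0 * logep p / \<epsilon>^2 \<and>
            (\<Sum>j\<in>{1..p}. \<Sum>k\<in>{1..p}. \<Sum>l\<in>{1..p}. D3 j k l x) \<le> C0 * (logep p)^2 / \<epsilon>^3))"


subsection \<open>Gaussian laws, medians\<close>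

text \<open>The law \<open>N(0, v)\<close>; degenerate for \<open>v = 0\<close>.\<close>

definition centered_normal :: "real \<Rightarrow> real measure" where
  "centered_normal v =
     (if v = 0 then return borel 0
      else density lborel (\<lambda>x. ennreal (normal_density 0 (sqrt v) x)))"

definition gaussian_vector ::
    "nat \<Rightarrow> 'w measure \<Rightarrow> ('w \<Rightarrow> nat \<Rightarrow> real) \<Rightarrow> (nat \<Rightarrow> nat \<Rightarrow> real) \<Rightarrow> bool" where
  "gaussian_vector p M Y \<Sigma> \<longleftrightarrow>
     Y \<in> M \<rightarrow>\<^sub>M Rp p \<and>
     (\<forall>a. distr M borel (\<lambda>\<omega>. \<Sum>j\<in>{1..p}. a j * Y \<omega> j) =
          centered_normal (\<Sum>j\<in>{1..p}. \<Sum>k\<in>{1..p}. a j * a k * \<Sigma> j k))"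

text \<open>As a relation; the medians to which it is applied below (of sup-norms of Gaussian
  vectors and of continuous Gaussian processes) are unique.\<close>

definition is_median :: "'w measure \<Rightarrow> ('w \<Rightarrow> real) \<Rightarrow> real \<Rightarrow> bool" where
  "is_median M Z m \<longleftrightarrow>
     measure M {\<omega>\<in>space M. Z \<omega> \<le> m} \<ge> 1/2 \<and> measure M {\<omega>\<in>space M. Z \<omega> \<ge> m} \<ge> 1/2"


subsection \<open>Anti-concentration constant\<close>

definition Phi_AC :: "real \<Rightarrow> real \<Rightarrow> real \<Rightarrow> real \<Rightarrow> real" where
  "Phi_AC \<Theta> \<mu> \<sigma>max \<sigma>min =
     \<Theta> * (((\<mu> + \<sigma>max) * \<sigma>max^2 + (1 + \<sigma>max)^2 * \<sigma>max^2) / \<sigma>min^4)"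

definition centered_gaussian_process ::
    "'w measure \<Rightarrow> 't set \<Rightarrow> ('t \<Rightarrow> 'w \<Rightarrow> real) \<Rightarrow> bool" where
  "centered_gaussian_process N T Y \<longleftrightarrow>
     (\<forall>t\<in>T. Y t \<in> borel_measurable N) \<and>
     (\<forall>F a. finite F \<and> F \<subseteq> T \<longrightarrow>
        (\<exists>v\<ge>0. distr N borel (\<lambda>\<omega>. \<Sum>t\<in>F. a t * Y t \<omega>) = centered_normal v))"

text \<open>
  HOL cannot quantify over types inside a formula, so the processes below have index set in
  \<open>real\<close> and sample space in \<open>real \<Rightarrow> real\<close>.  No generality is lost: a compact metric space has at
  most the cardinality of the continuum, hence is isometric to some metric (not necessarily the
  usual one) on a subset of \<open>real\<close>, and every sample continuous process on it can be realised,
  with the same law, on the space of its paths.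
\<close>

definition AC_constant :: "real \<Rightarrow> bool" where
  "AC_constant \<Theta> \<longleftrightarrow>
     (\<forall>(T :: real metric) (N :: (real \<Rightarrow> real) measure) (Y :: real \<Rightarrow> (real \<Rightarrow> real) \<Rightarrow> real)
        \<mu> \<sigma>max \<sigma>min.
        mspace T \<noteq> {} \<and> compact_space (mtopology_of T) \<and>
        prob_space N \<and> centered_gaussian_process N (mspace T) Y \<and>
        (\<forall>\<omega>\<in>space N. continuous_map (mtopology_of T) euclideanreal (\<lambda>t. Y t \<omega>)) \<and>
        is_median N (\<lambda>\<omega>. SUP t\<in>mspace T. \<bar>Y t \<omega>\<bar>) \<mu> \<and>
        \<sigma>max = sqrt (SUP t\<in>mspace T. prob_space.variance N (Y t)) \<and>
        \<sigma>min = sqrt (INF t\<in>mspace T. prob_space.variance N (Y t)) \<and>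
        \<sigma>min > 0
        \<longrightarrow>
        (\<forall>\<epsilon>\<ge>0.
           (SUP r\<in>{0..}. measure N {\<omega>\<in>space N.
                r - \<epsilon> \<le> (SUP t\<in>mspace T. \<bar>Y t \<omega>\<bar>) \<and> (SUP t\<in>mspace T. \<bar>Y t \<omega>\<bar>) \<le> r + \<epsilon>})
           \<le> Phi_AC \<Theta> \<mu> \<sigma>max \<sigma>min * \<epsilon>))"


subsection \<open>Pseudo-moments\<close>

text \<open>
  \<open>L\<^sub>n\<close>, \<open>Lbar\<close> and \<open>M\<^sub>n\<close> are extended nonnegative reals, so that \<open>0 < L\<^sub>n < \<infinity>\<close> has its literal
  meaning.  If \<open>L\<^sub>n < \<infinity>\<close> then \<open>Lbar\<close> is finite too, and \<open>M\<^sub>n\<close> is finite by the existence of second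
  moments; thus \<open>enn2real\<close> loses nothing on them.
\<close>

text \<open>Total variation measure of a signed measure \<open>\<zeta>\<close> on the measurable space \<open>S\<close>.\<close>

definition tv_measure :: "'a measure \<Rightarrow> ('a set \<Rightarrow> real) \<Rightarrow> 'a measure" where
  "tv_measure S \<zeta> = measure_of (space S) (sets S)
     (\<lambda>A. SUP \<C>\<in>{\<C>. finite \<C> \<and> \<C> \<subseteq> sets S \<and> disjoint \<C> \<and> \<Union>\<C> = A}.
            (\<Sum>B\<in>\<C>. ennreal \<bar>\<zeta> B\<bar>))"

definition zeta :: "nat \<Rightarrow> 'w measure \<Rightarrow> ('w \<Rightarrow> nat \<Rightarrow> real) \<Rightarrow> ('w \<Rightarrow> nat \<Rightarrow> real)
    \<Rightarrow> (nat \<Rightarrow> real) set \<Rightarrow> real" where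
  "zeta p M X Y A = measure (distr M (Rp p) X) A - measure (distr M (Rp p) Y) A"

abbreviation abs_zeta :: "nat \<Rightarrow> 'w measure \<Rightarrow> ('w \<Rightarrow> nat \<Rightarrow> real) \<Rightarrow> ('w \<Rightarrow> nat \<Rightarrow> real)
    \<Rightarrow> (nat \<Rightarrow> real) measure" where
  "abs_zeta p M X Y \<equiv> tv_measure (Rp p) (zeta p M X Y)"

definition max_third :: "nat \<Rightarrow> 'w measure \<Rightarrow> ('w \<Rightarrow> nat \<Rightarrow> real) \<Rightarrow> ('w \<Rightarrow> nat \<Rightarrow> real) \<Rightarrow> ennreal"
  where
  "max_third p M X Y =
     Max ((\<lambda>j. \<integral>\<^sup>+x. ennreal (\<bar>x j\<bar>^3) \<partial>abs_zeta p M X Y) ` {1..p})"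

definition Ln :: "nat \<Rightarrow> nat \<Rightarrow> 'w measure \<Rightarrow> (nat \<Rightarrow> 'w \<Rightarrow> nat \<Rightarrow> real)
    \<Rightarrow> (nat \<Rightarrow> 'w \<Rightarrow> nat \<Rightarrow> real) \<Rightarrow> ennreal" where
  "Ln p n M X Y = (\<Sum>i\<in>{1..n}. max_third p M (X i) (Y i)) / of_nat n"

definition sigma_i :: "nat \<Rightarrow> 'w measure \<Rightarrow> ('w \<Rightarrow> nat \<Rightarrow> real) \<Rightarrow> real" where
  "sigma_i p M Y = sqrt (Max ((\<lambda>j. prob_space.variance M (\<lambda>\<omega>. Y \<omega> j)) ` {1..p}))"

definition Lbar :: "nat \<Rightarrow> nat \<Rightarrow> 'w measure \<Rightarrow> (nat \<Rightarrow> 'w \<Rightarrow> nat \<Rightarrow> real)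
    \<Rightarrow> (nat \<Rightarrow> 'w \<Rightarrow> nat \<Rightarrow> real) \<Rightarrow> (nat \<Rightarrow> real) \<Rightarrow> ennreal" where
  "Lbar p n M X Y \<mu>i =
     (\<Sum>i\<in>{1..n}. ennreal (\<mu>i i + sigma_i p M (Y i)) * max_third p M (X i) (Y i)) / of_nat n"

definition Mn :: "nat \<Rightarrow> nat \<Rightarrow> 'w measure \<Rightarrow> (nat \<Rightarrow> 'w \<Rightarrow> nat \<Rightarrow> real)
    \<Rightarrow> (nat \<Rightarrow> 'w \<Rightarrow> nat \<Rightarrow> real) \<Rightarrow> real \<Rightarrow> ennreal" where
  "Mn p n M X Y \<phi> =
     (\<Sum>i\<in>{1..n}. \<integral>\<^sup>+x. ennreal ((vnorm p x)^2) *
          indicator {x. vnorm p x \<ge> sqrt (real n) * \<phi> / logep p} x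
        \<partial>abs_zeta p M (X i) (Y i)) / of_nat n"


subsection \<open>Lindeberg interpolation\<close>

definition U :: "nat \<Rightarrow> nat \<Rightarrow> (nat \<Rightarrow> 'w \<Rightarrow> nat \<Rightarrow> real) \<Rightarrow> (nat \<Rightarrow> 'w \<Rightarrow> nat \<Rightarrow> real)
    \<Rightarrow> nat \<Rightarrow> 'w \<Rightarrow> nat \<Rightarrow> real" where
  "U p n X Y k \<omega> =
     (\<lambda>j\<in>{1..p}. ((\<Sum>i\<in>{1..k}. X i \<omega> j) + (\<Sum>i\<in>{k+1..n}. Y i \<omega> j)) / sqrt (real n))"

definition delta0 :: "nat \<Rightarrow> nat \<Rightarrow> 'w measure \<Rightarrow> (nat \<Rightarrow> 'w \<Rightarrow> nat \<Rightarrow> real)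
    \<Rightarrow> (nat \<Rightarrow> 'w \<Rightarrow> nat \<Rightarrow> real) \<Rightarrow> real" where
  "delta0 p n M X Y =
     (SUP r\<in>{0..}. Max ((\<lambda>k.
        \<bar>measure M {\<omega>\<in>space M. vnorm p (U p n X Y k \<omega>) \<le> r} -
         measure M {\<omega>\<in>space M. vnorm p (U p n X Y 0 \<omega>) \<le> r}\<bar>) ` {1..n}))"

definition eps_n :: "nat \<Rightarrow> nat \<Rightarrow> real \<Rightarrow> real \<Rightarrow> real \<Rightarrow> real" where
  "eps_n p n C0 CC L =
     (2 * exp (2 * CC) * C0 * (logep p)^2 * L) powr (1/3) / real n powr (1/6)"

end

theory Submission
  imports Defs
begin

text \<open>
  The idea is a Lindeberg exchange whose error is measured in total variation and whose third-order
  term is localized, so that the quantity to be bounded reappears with a small factor.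

  Replace the indicator of \<open>\<parallel>x\<parallel> \<le> r\<close> by a smooth \<open>\<phi>\<close>; by Gaussian anti-concentration of \<open>U\<^sub>0\<close> this costs
  at most \<open>\<Phi> \<epsilon>\<close>.  Then \<open>E \<phi>(U\<^sub>k) - E \<phi>(U\<^sub>0)\<close> telescopes, and \<open>U\<^sub>i\<close> differs from \<open>U\<^sub>i\<^sub>-\<^sub>1\<close> only by \<open>X\<^sub>i\<close> in
  place of \<open>Y\<^sub>i\<close>, added to an independent vector \<open>W\<^sub>i\<close>.  Since \<open>X\<^sub>i\<close> and \<open>Y\<^sub>i\<close> have the same mean and
  covariance, only the second-order Taylor remainder of \<open>\<phi>\<close> at \<open>W\<^sub>i\<close> is integrated against \<open>\<zeta>\<^sub>i\<close>, so its
  absolute value is integrated against \<open>\<bar>\<zeta>\<^sub>i\<bar>\<close> (\<open>swap_bound\<close>).  For \<open>\<parallel>x\<parallel> \<ge> \<surd>n \<epsilon> / log (e p)\<close> the remainder is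
  bounded through second derivatives, which gives \<open>M\<^sub>n\<close>.  For smaller \<open>x\<close> it is bounded through third
  derivatives; these vanish unless \<open>r \<le> \<parallel>x\<parallel> \<le> r + \<epsilon>\<close>, so that a factor \<open>P(r - \<epsilon> \<le> \<parallel>W\<^sub>i\<parallel> \<le> r + 2\<epsilon>)\<close>
  survives (\<open>taylor_rem_small\<close>).

  That factor is the point (\<open>prob_annulus_le\<close>).  Adding back \<open>Y\<^sub>i\<close> turns \<open>W\<^sub>i\<close> into \<open>U\<^sub>i\<^sub>-\<^sub>1\<close>, whose annulus
  probabilities are within \<open>2 \<delta>\<close> of those of the Gaussian \<open>U\<^sub>0\<close>; this works whenever \<open>\<parallel>Y\<^sub>i\<parallel>\<close> is small with
  probability at least one half, and otherwise the median of \<open>\<parallel>Y\<^sub>i\<parallel>\<close> is large, which is paid for by the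
  term with \<open>\<mu>\<^sub>i\<close>.  The choice of \<open>\<epsilon>\<close> makes the coefficient of this recursion at most \<open>1/12\<close>
  (\<open>recursion_coefficients\<close>), so \<open>\<delta> \<le> \<Phi> \<epsilon> + (4 \<delta> + 6 \<Phi> \<epsilon>) / 12 + \<dots>\<close>, and \<open>\<delta>\<close> can be absorbed on the left.
\<close>

section \<open>Total variation of a difference of finite measures\<close>

lemma sum_of_finite_measures:
  fixes P Q :: "'a measure"
  assumes P: "finite_measure P" "sets P = sets S" and Q: "finite_measure Q" "sets Q = sets S"
  obtains \<nu> where "finite_measure \<nu>" "sets \<nu> = sets S"
    "\<And>A. A \<in> sets S \<Longrightarrow> emeasure \<nu> A = emeasure P A + emeasure Q A"
proof -
  define \<nu> where "\<nu> = measure_of (space S) (sets S) (\<lambda>A. emeasure P A + emeasure Q A)"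
  have sets: "sets \<nu> = sets S" by (simp add: \<nu>_def)
  have sp: "space \<nu> = space S" using sets by (rule sets_eq_imp_space_eq)
  have spP: "space P = space S" using P(2) by (rule sets_eq_imp_space_eq)
  have em: "emeasure \<nu> A = emeasure P A + emeasure Q A" if "A \<in> sets S" for A
    unfolding \<nu>_def
  proof (rule emeasure_measure_of_sigma)
    show "sigma_algebra (space S) (sets S)" by (rule sets.sigma_algebra_axioms)
    show "positive (sets S) (\<lambda>A. emeasure P A + emeasure Q A)" by (simp add: positive_def)
    show "countably_additive (sets S) (\<lambda>A. emeasure P A + emeasure Q A)"
    proof (rule countably_additiveI)
      fix A :: "nat \<Rightarrow> 'a set" assume A: "range A \<subseteq> sets S" "disjoint_family A"
      have "(\<Sum>i. emeasure P (A i) + emeasure Q (A i))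
          = (\<Sum>i. emeasure P (A i)) + (\<Sum>i. emeasure Q (A i))"
        by (intro suminf_add[symmetric] summableI)
      also have "\<dots> = emeasure P (\<Union>i. A i) + emeasure Q (\<Union>i. A i)"
        using A P(2) Q(2) by (simp add: suminf_emeasure)
      finally show "(\<Sum>i. emeasure P (A i) + emeasure Q (A i))
          = emeasure P (\<Union>i. A i) + emeasure Q (\<Union>i. A i)" .
    qed
  qed (use that in auto)
  have "finite_measure \<nu>"
    using finite_measure.emeasure_finite[OF P(1), of "space S"]
      finite_measure.emeasure_finite[OF Q(1), of "space S"]
    by (intro finite_measureI) (simp add: sp em)
  with sets em that show ?thesis by blast
qed

lemma real_density_of_dominated:
  fixes P :: "'a measure"
  assumes "finite_measure \<nu>" "sets P = sets \<nu>" "finite_measure P"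
    and le: "\<And>A. A \<in> sets \<nu> \<Longrightarrow> emeasure P A \<le> emeasure \<nu> A"
  obtains f :: "'a \<Rightarrow> real" where "f \<in> borel_measurable \<nu>" "\<And>x. 0 \<le> f x"
    "P = density \<nu> (\<lambda>x. ennreal (f x))" "integrable \<nu> f"
proof -
  interpret \<nu>: finite_measure \<nu> by fact
  interpret P: finite_measure P by fact
  have ac: "absolutely_continuous \<nu> P"
  proof -
    have "A \<in> null_sets P" if "A \<in> null_sets \<nu>" for A
      using that le[of A] assms(2) by (auto simp: null_sets_def)
    then show ?thesis by (auto simp: absolutely_continuous_def)
  qed
  obtain D where D: "D \<in> borel_measurable \<nu>" "AE x in \<nu>. RN_deriv \<nu> P x = ennreal (D x)"
      "\<And>x. 0 \<le> D x"
    using \<nu>.real_RN_deriv[OF assms(3) ac assms(2)] by metis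
  have "density \<nu> (RN_deriv \<nu> P) = P" by (rule \<nu>.density_RN_deriv[OF ac assms(2)])
  also have "density \<nu> (RN_deriv \<nu> P) = density \<nu> (\<lambda>x. ennreal (D x))"
    by (rule density_cong) (use D in auto)
  finally have P: "P = density \<nu> (\<lambda>x. ennreal (D x))" by simp
  have "(\<integral>\<^sup>+x. ennreal (D x) \<partial>\<nu>) = emeasure (density \<nu> (\<lambda>x. ennreal (D x))) (space \<nu>)"
    using D by (subst emeasure_density) (auto intro!: nn_integral_cong)
  also have "\<dots> < \<infinity>" using P P.emeasure_finite[of "space \<nu>"] by (simp add: top.not_eq_extremum)
  finally have "integrable \<nu> D" using D by (intro integrableI_nonneg) auto
  with D P that show ?thesis by blast
qed

lemma measure_real_density:
  fixes f :: "'a \<Rightarrow> real"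
  assumes [measurable]: "f \<in> borel_measurable \<nu>" "B \<in> sets \<nu>" and "\<And>x. 0 \<le> f x"
  shows "measure (density \<nu> (\<lambda>x. ennreal (f x))) B = (\<integral>x\<in>B. f x \<partial>\<nu>)"
proof -
  have "measure (density \<nu> (\<lambda>x. ennreal (f x))) B
      = enn2real (\<integral>\<^sup>+x. ennreal (indicator B x * f x) \<partial>\<nu>)"
    unfolding measure_def
    by (subst emeasure_density) (auto intro!: arg_cong[where f=enn2real] nn_integral_cong simp: indicator_def)
  also have "\<dots> = (\<integral>x. indicator B x * f x \<partial>\<nu>)"
    using assms(3) by (intro integral_eq_nn_integral[symmetric]) (auto simp: AE_I2)
  finally show ?thesis by (simp add: set_lebesgue_integral_def)
qed

text \<open>With respect to the dominating measure \<open>P + Q\<close> both laws have densities \<open>f\<close> and \<open>g\<close>; the supremum over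
  partitions is attained by splitting along the sign of \<open>f - g\<close>, so it is the measure with
  density \<open>\<bar>f - g\<bar>\<close>.  In particular it is countably additive, which is what gives
  \<^const>\<open>tv_measure\<close> a meaning.\<close>

lemma tv_measure_diff_density:
  fixes P Q S :: "'a measure"
  assumes P: "finite_measure P" "sets P = sets S" and Q: "finite_measure Q" "sets Q = sets S"
  obtains \<nu> f g where "finite_measure \<nu>" "sets \<nu> = sets S"
    "f \<in> borel_measurable \<nu>" "\<And>x. 0 \<le> f x" "P = density \<nu> (\<lambda>x. ennreal (f x))"
    "g \<in> borel_measurable \<nu>" "\<And>x. 0 \<le> g x" "Q = density \<nu> (\<lambda>x. ennreal (g x))"
    "tv_measure S (\<lambda>A. measure P A - measure Q A) = density \<nu> (\<lambda>x. ennreal \<bar>f x - g x\<bar>)"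
proof -
  interpret P: finite_measure P by fact
  interpret Q: finite_measure Q by fact
  obtain \<nu> where \<nu>: "finite_measure \<nu>" "sets \<nu> = sets S"
    "\<And>A. A \<in> sets S \<Longrightarrow> emeasure \<nu> A = emeasure P A + emeasure Q A"
    using sum_of_finite_measures[OF P Q] by blast
  obtain f where f: "f \<in> borel_measurable \<nu>" "\<And>x. 0 \<le> f x"
      "P = density \<nu> (\<lambda>x. ennreal (f x))" "integrable \<nu> f"
    using real_density_of_dominated[OF \<nu>(1), of P] P \<nu> by (metis le_iff_add)
  obtain g where g: "g \<in> borel_measurable \<nu>" "\<And>x. 0 \<le> g x"
      "Q = density \<nu> (\<lambda>x. ennreal (g x))" "integrable \<nu> g"
    using real_density_of_dominated[OF \<nu>(1), of Q] Q \<nu> by (metis add.commute le_iff_add)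
  define h where "h x = \<bar>f x - g x\<bar>" for x
  have h[measurable]: "h \<in> borel_measurable \<nu>" using f g by (simp add: h_def[abs_def])
  have hi: "integrable \<nu> h" unfolding h_def[abs_def] using f g by auto
  note [measurable] = f(1) g(1)
  have mP: "measure P B = (\<integral>x\<in>B. f x \<partial>\<nu>)" if "B \<in> sets S" for B
    using f that \<nu>(2) by (subst f(3)) (simp add: measure_real_density)
  have mQ: "measure Q B = (\<integral>x\<in>B. g x \<partial>\<nu>)" if "B \<in> sets S" for B
    using g that \<nu>(2) by (subst g(3)) (simp add: measure_real_density)
  have si: "set_integrable \<nu> B k" if "B \<in> sets S" "integrable \<nu> k" for B and k :: "'a \<Rightarrow> real"
    using that \<nu>(2) unfolding set_integrable_def
    by (intro integrable_mult_indicator) auto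
  have diff: "measure P B - measure Q B = (\<integral>x\<in>B. (f x - g x) \<partial>\<nu>)" if "B \<in> sets S" for B
    using that by (simp add: mP mQ set_integral_diff si f(4) g(4))
  have mh: "emeasure (density \<nu> (\<lambda>x. ennreal (h x))) B = ennreal (\<integral>x\<in>B. h x \<partial>\<nu>)"
    if "B \<in> sets S" for B
  proof -
    have "emeasure (density \<nu> (\<lambda>x. ennreal (h x))) B
        = (\<integral>\<^sup>+x. ennreal (indicator B x * h x) \<partial>\<nu>)"
      using that \<nu>(2)
      by (subst emeasure_density) (auto intro!: nn_integral_cong simp: indicator_def)
    also have "\<dots> = ennreal (\<integral>x. indicator B x * h x \<partial>\<nu>)"
      using si[OF that hi] by (intro nn_integral_eq_integral) (auto simp: set_integrable_def h_def)
    finally show ?thesis by (simp add: set_lebesgue_integral_def)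
  qed
  define F where "F A = (SUP \<C>\<in>{\<C>. finite \<C> \<and> \<C> \<subseteq> sets S \<and> disjoint \<C> \<and> \<Union>\<C> = A}.
            (\<Sum>B\<in>\<C>. ennreal \<bar>measure P B - measure Q B\<bar>))" for A
  have F: "F A = emeasure (density \<nu> (\<lambda>x. ennreal (h x))) A" if A: "A \<in> sets S" for A
  proof (rule antisym)
    show "F A \<le> emeasure (density \<nu> (\<lambda>x. ennreal (h x))) A"
      unfolding F_def
    proof (rule SUP_least, clarify)
      fix \<C> :: "'a set set" assume C: "finite \<C>" "\<C> \<subseteq> sets S" "disjoint \<C>" "A = \<Union>\<C>"
      have "(\<Sum>B\<in>\<C>. ennreal \<bar>measure P B - measure Q B\<bar>)
          \<le> (\<Sum>B\<in>\<C>. emeasure (density \<nu> (\<lambda>x. ennreal (h x))) B)"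
      proof (rule sum_mono)
        fix B assume "B \<in> \<C>"
        then have B: "B \<in> sets S" using C by auto
        have "\<bar>\<integral>x. indicator B x * (f x - g x) \<partial>\<nu>\<bar>
            \<le> (\<integral>x. \<bar>indicator B x * (f x - g x)\<bar> \<partial>\<nu>)" by (rule integral_abs_bound)
        also have "\<dots> = (\<integral>x. indicator B x * h x \<partial>\<nu>)"
          by (intro Bochner_Integration.integral_cong) (auto simp: h_def abs_mult)
        finally show "ennreal \<bar>measure P B - measure Q B\<bar>
            \<le> emeasure (density \<nu> (\<lambda>x. ennreal (h x))) B"
          using B by (simp add: diff mh set_lebesgue_integral_def ennreal_leI)
      qed
      also have "\<dots> = emeasure (density \<nu> (\<lambda>x. ennreal (h x))) (\<Union>\<C>)"
        using C \<nu>(2)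
          sum_emeasure[of "\<lambda>B. B" \<C> "density \<nu> (\<lambda>x. ennreal (h x))"]
        by (auto simp: disjoint_def disjoint_family_on_def)
      finally show "(\<Sum>B\<in>\<C>. ennreal \<bar>measure P B - measure Q B\<bar>)
        \<le> emeasure (density \<nu> (\<lambda>x. ennreal (h x))) (\<Union>\<C>)" .
    qed
  next
    define A1 where "A1 = A \<inter> {x\<in>space \<nu>. g x \<le> f x}"
    define A2 where "A2 = A \<inter> {x\<in>space \<nu>. f x < g x}"
    have A12: "A1 \<in> sets S" "A2 \<in> sets S" "A1 \<inter> A2 = {}" "A1 \<union> A2 = A"
      unfolding A1_def A2_def \<nu>(2)[symmetric] using A \<nu>(2) sets.sets_into_space[of A \<nu>]
      by (auto intro!: sets.Int)
    have 1: "\<bar>measure P A1 - measure Q A1\<bar> = (\<integral>x\<in>A1. h x \<partial>\<nu>)"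
    proof -
      have "(\<integral>x\<in>A1. (f x - g x) \<partial>\<nu>) = (\<integral>x\<in>A1. h x \<partial>\<nu>)"
        unfolding set_lebesgue_integral_def
        by (intro Bochner_Integration.integral_cong) (auto simp: h_def A1_def indicator_def)
      moreover have "0 \<le> (\<integral>x\<in>A1. h x \<partial>\<nu>)" 
        unfolding set_lebesgue_integral_def by (intro integral_nonneg_AE) (auto simp: h_def)
      ultimately show ?thesis using A12 by (simp add: diff)
    qed
    have 2: "\<bar>measure P A2 - measure Q A2\<bar> = (\<integral>x\<in>A2. h x \<partial>\<nu>)"
    proof -
      have "(\<integral>x\<in>A2. (f x - g x) \<partial>\<nu>) = (\<integral>x\<in>A2. - h x \<partial>\<nu>)"
        unfolding set_lebesgue_integral_def
        by (intro Bochner_Integration.integral_cong) (auto simp: h_def A2_def indicator_def)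
      moreover have "0 \<le> (\<integral>x\<in>A2. h x \<partial>\<nu>)"
        unfolding set_lebesgue_integral_def by (intro integral_nonneg_AE) (auto simp: h_def)
      ultimately show ?thesis using A12 by (simp add: diff set_lebesgue_integral_def)
    qed
    let ?\<mu> = "emeasure (density \<nu> (\<lambda>x. ennreal (h x)))"
    have "?\<mu> A = ?\<mu> A1 + ?\<mu> A2"
      using A12 \<nu>(2) by (subst plus_emeasure) auto
    also have "\<dots> = ennreal \<bar>measure P A1 - measure Q A1\<bar> + ennreal \<bar>measure P A2 - measure Q A2\<bar>"
      using A12 by (simp add: 1 2 mh)
    also have "\<dots> = (\<Sum>B\<in>{A1, A2}. ennreal \<bar>measure P B - measure Q B\<bar>)"
    proof (cases "A1 = A2")
      case True
      then have "A1 = {}" "A2 = {}" using A12 by auto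
      then show ?thesis by simp
    qed simp
    also have "\<dots> \<le> F A"
      unfolding F_def by (rule SUP_upper) (use A12 in \<open>auto simp: disjoint_def\<close>)
    finally show "?\<mu> A \<le> F A" .
  qed
  have "tv_measure S (\<lambda>A. measure P A - measure Q A) = measure_of (space S) (sets S) F"
    unfolding tv_measure_def F_def by simp
  also have "\<dots> = measure_of (space S) (sets S) (emeasure (density \<nu> (\<lambda>x. ennreal (h x))))"
    by (rule measure_of_eq) (auto simp: F sets.sigma_sets_eq dest: sets.sets_into_space)
  also have "\<dots> = density \<nu> (\<lambda>x. ennreal (h x))"
    using measure_of_of_measure[of "density \<nu> (\<lambda>x. ennreal (h x))"] \<nu>(2) sets_eq_imp_space_eq[OF \<nu>(2)]
    by simp
  finally have "tv_measure S (\<lambda>A. measure P A - measure Q A)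
      = density \<nu> (\<lambda>x. ennreal \<bar>f x - g x\<bar>)" by (simp add: h_def)
  then show ?thesis using that \<nu> f g by blast
qed

lemma sets_tv_measure_diff:
  fixes P Q S :: "'a measure"
  assumes "finite_measure P" "sets P = sets S" "finite_measure Q" "sets Q = sets S"
  shows "sets (tv_measure S (\<lambda>A. measure P A - measure Q A)) = sets S"
  by (rule tv_measure_diff_density[OF assms]) simp

text \<open>Both integrals are integrals over \<open>\<nu>\<close>, so the difference has the density \<open>f - g\<close>.\<close>

lemma integral_diff_le_tv_measure:
  fixes P Q S :: "'a measure" and k :: "'a \<Rightarrow> real"
  assumes PQ: "finite_measure P" "sets P = sets S" "finite_measure Q" "sets Q = sets S"
    and k: "integrable P k" "integrable Q k"
  shows "ennreal \<bar>(\<integral>x. k x \<partial>P) - (\<integral>x. k x \<partial>Q)\<bar>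
    \<le> (\<integral>\<^sup>+x. ennreal \<bar>k x\<bar> \<partial>tv_measure S (\<lambda>A. measure P A - measure Q A))"
proof (rule tv_measure_diff_density[OF PQ])
  fix \<nu> f g assume \<nu>: "finite_measure \<nu>" "sets \<nu> = sets S"
    and f: "f \<in> borel_measurable \<nu>" "\<And>x. 0 \<le> f x" "P = density \<nu> (\<lambda>x. ennreal (f x))"
    and g: "g \<in> borel_measurable \<nu>" "\<And>x. 0 \<le> g x" "Q = density \<nu> (\<lambda>x. ennreal (g x))"
    and tv: "tv_measure S (\<lambda>A. measure P A - measure Q A) = density \<nu> (\<lambda>x. ennreal \<bar>f x - g x\<bar>)"
  note [measurable] = f(1) g(1)
  have [measurable]: "k \<in> borel_measurable \<nu>" using k(1) f(3) by auto
  have fi: "integrable \<nu> (\<lambda>x. f x * k x)"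
    using k(1) f by (subst (asm) f(3)) (simp add: integrable_real_density)
  have gi: "integrable \<nu> (\<lambda>x. g x * k x)"
    using k(2) g by (subst (asm) g(3)) (simp add: integrable_real_density)
  have "(\<integral>x. k x \<partial>P) - (\<integral>x. k x \<partial>Q) = (\<integral>x. f x * k x \<partial>\<nu>) - (\<integral>x. g x * k x \<partial>\<nu>)"
    using f(2) g(2) by (subst f(3), subst g(3)) (simp add: integral_real_density)
  also have "\<dots> = (\<integral>x. f x * k x - g x * k x \<partial>\<nu>)" using fi gi by simp
  finally have "ennreal \<bar>(\<integral>x. k x \<partial>P) - (\<integral>x. k x \<partial>Q)\<bar>
      \<le> ennreal (\<integral>x. \<bar>f x * k x - g x * k x\<bar> \<partial>\<nu>)"
    by (simp add: ennreal_leI)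
  also have "\<dots> = (\<integral>\<^sup>+x. ennreal \<bar>f x * k x - g x * k x\<bar> \<partial>\<nu>)"
    using fi gi by (subst nn_integral_eq_integral) auto
  also have "\<dots> = (\<integral>\<^sup>+x. ennreal \<bar>f x - g x\<bar> * ennreal \<bar>k x\<bar> \<partial>\<nu>)"
    by (intro nn_integral_cong) (simp add: ennreal_mult[symmetric] abs_mult[symmetric] algebra_simps)
  also have "\<dots> = (\<integral>\<^sup>+x. ennreal \<bar>k x\<bar> \<partial>tv_measure S (\<lambda>A. measure P A - measure Q A))"
    unfolding tv by (subst nn_integral_density) auto
  finally show ?thesis .
qed

lemma nn_integral_tv_measure_le:
  fixes P Q S :: "'a measure"
  assumes PQ: "finite_measure P" "sets P = sets S" "finite_measure Q" "sets Q = sets S"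
    and k: "k \<in> borel_measurable S"
  shows "(\<integral>\<^sup>+x. k x \<partial>tv_measure S (\<lambda>A. measure P A - measure Q A))
    \<le> (\<integral>\<^sup>+x. k x \<partial>P) + (\<integral>\<^sup>+x. k x \<partial>Q)"
proof (rule tv_measure_diff_density[OF PQ])
  fix \<nu> f g assume \<nu>: "finite_measure \<nu>" "sets \<nu> = sets S"
    and f: "f \<in> borel_measurable \<nu>" "\<And>x. 0 \<le> f x" "P = density \<nu> (\<lambda>x. ennreal (f x))"
    and g: "g \<in> borel_measurable \<nu>" "\<And>x. 0 \<le> g x" "Q = density \<nu> (\<lambda>x. ennreal (g x))"
    and tv: "tv_measure S (\<lambda>A. measure P A - measure Q A) = density \<nu> (\<lambda>x. ennreal \<bar>f x - g x\<bar>)"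
  have [measurable]: "k \<in> borel_measurable \<nu>" using k \<nu>(2) by (simp cong: measurable_cong_sets)
  note [measurable] = f(1) g(1)
  have "(\<integral>\<^sup>+x. k x \<partial>density \<nu> (\<lambda>x. ennreal \<bar>f x - g x\<bar>)) = (\<integral>\<^sup>+x. ennreal \<bar>f x - g x\<bar> * k x \<partial>\<nu>)"
    by (subst nn_integral_density) auto
  also have "\<dots> \<le> (\<integral>\<^sup>+x. ennreal (f x) * k x + ennreal (g x) * k x \<partial>\<nu>)"
  proof (rule nn_integral_mono)
    fix x
    have "ennreal \<bar>f x - g x\<bar> \<le> ennreal (f x + g x)"
      using f(2)[of x] g(2)[of x] by (intro ennreal_leI) auto
    also have "\<dots> = ennreal (f x) + ennreal (g x)" using f(2) g(2) by simp
    finally show "ennreal \<bar>f x - g x\<bar> * k x \<le> ennreal (f x) * k x + ennreal (g x) * k x"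
      by (simp add: distrib_right[symmetric] mult_right_mono)
  qed
  also have "\<dots> = (\<integral>\<^sup>+x. k x \<partial>P) + (\<integral>\<^sup>+x. k x \<partial>Q)"
    by (subst f(3), subst g(3)) (simp add: nn_integral_density nn_integral_add)
  finally show ?thesis by (simp add: tv)
qed


section \<open>Calculus on finite products of the real line\<close>

(* Index sets are written {1..p}; rewriting 1 to Suc 0 would hide them from the lemmas below. *)
declare One_nat_def [simp del]

lemma space_Rp: "space (Rp p) = extensional {1..p}"
  by (auto simp: space_PiM PiE_def)

lemma restrict_in_Rp: "restrict x {1..p} \<in> space (Rp p)"
  by (simp add: space_Rp)

lemma upd_in_Rp: "x \<in> space (Rp p) \<Longrightarrow> j \<in> {1..p} \<Longrightarrow> x(j := t) \<in> space (Rp p)"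
  by (auto simp: space_Rp extensional_def)

lemma vadd_in_Rp: "vadd p x w \<in> space (Rp p)"
  by (simp add: vadd_def restrict_in_Rp)

lemma vnorm_le_iff: "p \<ge> 1 \<Longrightarrow> vnorm p x \<le> c \<longleftrightarrow> (\<forall>i\<in>{1..p}. \<bar>x i\<bar> \<le> c)"
  by (auto simp: vnorm_def)

lemma vnorm_less_iff: "p \<ge> 1 \<Longrightarrow> vnorm p x < c \<longleftrightarrow> (\<forall>i\<in>{1..p}. \<bar>x i\<bar> < c)"
  by (auto simp: vnorm_def)

lemma abs_le_vnorm: "i \<in> {1..p} \<Longrightarrow> \<bar>x i\<bar> \<le> vnorm p x"
  by (auto simp: vnorm_def)

lemma vnorm_nonneg: "p \<ge> 1 \<Longrightarrow> 0 \<le> vnorm p x"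
  using abs_le_vnorm[of 1 p x] by (auto intro: order_trans[OF abs_ge_zero])

lemma vnorm_triangle_le:
  assumes "p \<ge> 1" "\<And>i. i \<in> {1..p} \<Longrightarrow> \<bar>x i\<bar> \<le> \<bar>y i\<bar> + c"
  shows "vnorm p x \<le> vnorm p y + c"
  unfolding vnorm_le_iff[OF assms(1)]
proof
  fix i assume i: "i \<in> {1..p}"
  show "\<bar>x i\<bar> \<le> vnorm p y + c" using assms(2)[OF i] abs_le_vnorm[OF i, of y] by linarith
qed

lemma vnorm_scale:
  assumes "p \<ge> 1"
  shows "vnorm p (\<lambda>j\<in>{1..p}. c * x j) = \<bar>c\<bar> * vnorm p x"
proof (rule antisym)
  show "vnorm p (\<lambda>j\<in>{1..p}. c * x j) \<le> \<bar>c\<bar> * vnorm p x"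
    using assms by (auto simp: vnorm_le_iff abs_mult intro!: mult_left_mono abs_le_vnorm)
  obtain i where i: "i \<in> {1..p}" "vnorm p x = \<bar>x i\<bar>"
    using Max_in[of "(\<lambda>j. \<bar>x j\<bar>) ` {1..p}"] assms unfolding vnorm_def by fastforce
  then show "\<bar>c\<bar> * vnorm p x \<le> vnorm p (\<lambda>j\<in>{1..p}. c * x j)"
    using abs_le_vnorm[OF i(1), of "\<lambda>j\<in>{1..p}. c * x j"] by (simp add: abs_mult)
qed

lemma measurable_vnorm:
  assumes "p \<ge> 1" "\<And>i. i \<in> {1..p} \<Longrightarrow> (\<lambda>\<omega>. f \<omega> i) \<in> borel_measurable N"
  shows "(\<lambda>\<omega>. vnorm p (f \<omega>)) \<in> borel_measurable N"
  unfolding vnorm_def using assms(2) by (intro borel_measurable_Max) auto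

lemma measurable_Rp_component: "f \<in> N \<rightarrow>\<^sub>M Rp p \<Longrightarrow> i \<in> {1..p} \<Longrightarrow> (\<lambda>\<omega>. f \<omega> i) \<in> borel_measurable N"
  by (rule measurable_compose[where N="Rp p"]) auto

lemma measurable_vnorm_Rp: "p \<ge> 1 \<Longrightarrow> vnorm p \<in> borel_measurable (Rp p)"
  by (rule measurable_vnorm) (auto intro: measurable_Rp_component)

text \<open>Composing with the restriction to \<open>{1..p}\<close> extends \<open>f\<close> to a continuous function on all of \<open>nat \<Rightarrow> real\<close>,
  where the Borel sets of the product topology are those of the product measurable space.\<close>

lemma continuous_map_Rp_borel_measurable:
  fixes f :: "(nat \<Rightarrow> real) \<Rightarrow> real"
  assumes "continuous_map (powertop_real {1..p}) euclideanreal f"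
  shows "f \<in> borel_measurable (Rp p)"
proof -
  have "continuous_map (powertop_real UNIV) (powertop_real {1..p}) (\<lambda>x. restrict x {1..p})"
    by (auto simp: continuous_map_componentwise intro: continuous_map_product_projection)
  then have "continuous_map (powertop_real UNIV) euclideanreal (f \<circ> (\<lambda>x. restrict x {1..p}))"
    using assms continuous_map_compose by blast
  then have "continuous_on UNIV (f \<circ> (\<lambda>x. restrict x {1..p}))"
    by (simp add: euclidean_product_topology)
  then have "f \<circ> (\<lambda>x. restrict x {1..p}) \<in> borel_measurable borel"
    by (rule borel_measurable_continuous_onI)
  then have m: "f \<circ> (\<lambda>x. restrict x {1..p}) \<in> borel_measurable (Pi\<^sub>M UNIV (\<lambda>_. borel))"
    by (simp add: measurable_cong_sets[OF sets_PiM_equal_borel refl])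
  have "(\<lambda>x. x) \<in> Rp p \<rightarrow>\<^sub>M (Pi\<^sub>M UNIV (\<lambda>_. borel :: real measure))"
  proof (rule measurable_PiM_single')
    fix i :: nat
    show "(\<lambda>x. x i) \<in> borel_measurable (Rp p)"
    proof (cases "i \<in> {1..p}")
      case False
      then have "(\<lambda>x. x i) \<in> borel_measurable (Rp p) \<longleftrightarrow> (\<lambda>x. undefined :: real) \<in> borel_measurable (Rp p)"
        by (intro measurable_cong) (auto simp: space_Rp extensional_def)
      then show ?thesis by simp
    qed simp
  qed auto
  from measurable_compose[OF this m]
  have "(\<lambda>x. f (restrict x {1..p})) \<in> borel_measurable (Rp p)" by simp
  also have "?this \<longleftrightarrow> f \<in> borel_measurable (Rp p)"
    by (intro measurable_cong) (auto simp: space_Rp extensional_restrict)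
  finally show ?thesis .
qed

lemma Ck_continuous: "Ck p m f \<Longrightarrow> continuous_map (powertop_real {1..p}) euclideanreal f"
  by (cases m) auto

lemma Ck_borel_measurable: "Ck p m f \<Longrightarrow> f \<in> borel_measurable (Rp p)"
  by (rule continuous_map_Rp_borel_measurable) (rule Ck_continuous)

lemma Ck_pdiff: "Ck p (Suc m) f \<Longrightarrow> j \<in> {1..p} \<Longrightarrow> Ck p m (pdiff j f)"
  by simp

lemma Ck_has_pdiff:
  assumes "Ck p (Suc m) f" "j \<in> {1..p}" "x \<in> space (Rp p)"
  shows "((\<lambda>t. f (x(j := t))) has_real_derivative pdiff j f (x(j := u))) (at u)"
proof -
  have "x(j := u) \<in> space (Rp p)" using assms by (intro upd_in_Rp)
  then have "(\<lambda>t. f ((x(j := u))(j := t))) differentiable (at ((x(j := u)) j))"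
    using assms(1,2) unfolding Ck.simps by blast
  then show ?thesis
    by (simp add: pdiff_def DERIV_deriv_iff_real_differentiable)
qed


definition along :: "nat \<Rightarrow> (nat \<Rightarrow> real) \<Rightarrow> (nat \<Rightarrow> real) \<Rightarrow> real \<Rightarrow> nat \<Rightarrow> real" where
  "along p w h t = (\<lambda>j\<in>{1..p}. w j + t * h j)"

lemma mean_value_unordered:
  fixes g :: "real \<Rightarrow> real"
  assumes "\<And>u. (g has_real_derivative g' u) (at u)"
  shows "\<exists>u. \<bar>u - t\<bar> \<le> \<bar>s - t\<bar> \<and> g s - g t = (s - t) * g' u"
proof (cases "t < s")
  case True
  then obtain z where "t < z" "z < s" "g s - g t = (s - t) * g' z" using MVT2[of t s g g'] assms by auto
  then show ?thesis by (intro exI[of _ z]) auto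
next
  case False
  show ?thesis
  proof (cases "s < t")
    case True
    then obtain z where "s < z" "z < t" "g t - g s = (t - s) * g' z" using MVT2[of s t g g'] assms by auto
    then show ?thesis by (intro exI[of _ z]) (auto simp: algebra_simps)
  next
    case False
    with \<open>\<not> t < s\<close> show ?thesis by (intro exI[of _ t]) auto
  qed
qed

text \<open>Continuity of the partial derivatives yields the chain rule along straight lines: moving the
  coordinates one at a time, each increment is a partial derivative at a nearby point by the
  mean value theorem.\<close>

lemma along_has_derivative:
  assumes f: "Ck p (Suc m) f"
  shows "((\<lambda>t. f (along p w h t)) has_real_derivative
           (\<Sum>j\<in>{1..p}. h j * pdiff j f (along p w h t))) (at t)"
proof -
  \<comment> \<open>The point with the coordinates below \<open>k\<close> already moved to time \<open>s\<close>, the later ones still at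
    time \<open>t\<close>, and coordinate \<open>k\<close> in between.\<close>
  define q where "q k s u = (\<lambda>j\<in>{1..p}. w j + (if j < k then s else if j = k then u else t) * h j)"
    for k s u
  have qu: "q k s u = (q k s t)(k := w k + u * h k)" if "k \<in> {1..p}" for k s u
    using that by (auto simp: q_def restrict_def fun_eq_iff)
  have q_der: "((\<lambda>u. f (q k s u)) has_real_derivative h k * pdiff k f (q k s u)) (at u)"
    if k: "k \<in> {1..p}" for k s u
  proof -
    have "((\<lambda>v. f ((q k s t)(k := v))) has_real_derivative
        pdiff k f ((q k s t)(k := w k + u * h k))) (at (w k + u * h k))"
      by (rule Ck_has_pdiff[OF f k]) (simp add: q_def restrict_in_Rp)
    moreover have "((\<lambda>u. w k + u * h k) has_real_derivative h k) (at u)"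
      by (auto intro!: derivative_eq_intros)
    ultimately have "((\<lambda>u. f ((q k s t)(k := w k + u * h k))) has_real_derivative
        pdiff k f ((q k s t)(k := w k + u * h k)) * h k) (at u)"
      by (rule DERIV_chain2)
    then show ?thesis by (simp only: qu[OF k, symmetric] mult.commute)
  qed
  have "\<forall>k s. \<exists>u. k \<in> {1..p} \<longrightarrow> \<bar>u - t\<bar> \<le> \<bar>s - t\<bar> \<and>
      f (q k s s) - f (q k s t) = (s - t) * (h k * pdiff k f (q k s u))"
    using mean_value_unordered[OF q_der] by blast
  then obtain v where v: "\<And>k s. k \<in> {1..p} \<Longrightarrow> \<bar>v k s - t\<bar> \<le> \<bar>s - t\<bar>"
      "\<And>k s. k \<in> {1..p} \<Longrightarrow> f (q k s s) - f (q k s t) = (s - t) * (h k * pdiff k f (q k s (v k s)))"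
    by metis
  have tele: "f (along p w h s) - f (along p w h t)
      = (\<Sum>k\<in>{1..p}. f (q k s s) - f (q k s t))" for s
  proof -
    have "(\<Sum>k\<in>{1..p'}. f (q k s s) - f (q k s t)) = f (q p' s s) - f (along p w h t)" for p'
    proof (induction p')
      case 0
      have "q 0 s s = along p w h t" by (auto simp: q_def along_def restrict_def fun_eq_iff)
      then show ?case by simp
    next
      case (Suc k)
      have "q (Suc k) s t = q k s s" by (auto simp: q_def restrict_def fun_eq_iff)
      with Suc show ?case by simp
    qed
    moreover have "q p s s = along p w h s" by (auto simp: q_def along_def restrict_def fun_eq_iff)
    ultimately show ?thesis by simp
  qed
  have lim: "((\<lambda>s. pdiff k f (q k s (v k s))) \<longlongrightarrow> pdiff k f (along p w h t)) (at t)"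
    if k: "k \<in> {1..p}" for k
  proof -
    have vt: "((\<lambda>s. v k s) \<longlongrightarrow> t) (at t)"
    proof (rule Lim_transform_bound[where g="\<lambda>s. s - t", THEN LIM_zero_cancel])
      show "\<forall>\<^sub>F s in at t. norm (v k s - t) \<le> norm (s - t)" using v(1)[OF k] by simp
      show "((\<lambda>s. s - t) \<longlongrightarrow> 0) (at t)" by (rule LIM_zero) (rule tendsto_ident_at)
    qed
    have "limitin (powertop_real {1..p}) (\<lambda>s. q k s (v k s)) (along p w h t) (at t)"
      unfolding limitin_componentwise
    proof (intro conjI ballI)
      show "along p w h t \<in> extensional {1..p}" by (simp add: along_def)
      show "\<forall>\<^sub>F s in at t. q k s (v k s) \<in> topspace (powertop_real {1..p})"
        by (simp add: q_def)
      fix i assume i: "i \<in> {1..p}"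
      have "((\<lambda>s. w i + (if i < k then s else if i = k then v k s else t) * h i) \<longlongrightarrow> w i + t * h i) (at t)"
        using vt by (cases "i < k"; cases "i = k") (auto intro!: tendsto_intros)
      with i show "limitin euclideanreal (\<lambda>s. q k s (v k s) i) (along p w h t i) (at t)"
        by (simp add: q_def along_def)
    qed
    moreover have "continuous_map (powertop_real {1..p}) euclideanreal (pdiff k f)"
      using Ck_continuous[OF Ck_pdiff[OF f k]] .
    ultimately have "limitin euclideanreal (pdiff k f \<circ> (\<lambda>s. q k s (v k s))) (pdiff k f (along p w h t)) (at t)"
      by (rule continuous_map_limit[rotated])
    then show ?thesis by (simp add: o_def)
  qed
  have "((\<lambda>s. \<Sum>k\<in>{1..p}. h k * pdiff k f (q k s (v k s))) \<longlongrightarrow>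
      (\<Sum>k\<in>{1..p}. h k * pdiff k f (along p w h t))) (at t)"
    by (intro tendsto_intros lim)
  moreover have "\<forall>\<^sub>F s in at t. (f (along p w h s) - f (along p w h t)) / (s - t)
      = (\<Sum>k\<in>{1..p}. h k * pdiff k f (q k s (v k s)))"
  proof (rule eventually_at_filter[THEN iffD2, OF always_eventually], clarify)
    fix s assume "s \<noteq> t"
    have "f (along p w h s) - f (along p w h t)
        = (\<Sum>k\<in>{1..p}. (s - t) * (h k * pdiff k f (q k s (v k s))))"
      unfolding tele by (intro sum.cong refl v(2))
    also have "\<dots> = (s - t) * (\<Sum>k\<in>{1..p}. h k * pdiff k f (q k s (v k s)))"
      by (rule sum_distrib_left[symmetric])
    finally show "(f (along p w h s) - f (along p w h t)) / (s - t)
        = (\<Sum>k\<in>{1..p}. h k * pdiff k f (q k s (v k s)))"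
      using \<open>s \<noteq> t\<close> by simp
  qed
  ultimately show ?thesis
    unfolding has_field_derivative_iff by (subst tendsto_cong) 
qed


definition dir1 :: "nat \<Rightarrow> (nat \<Rightarrow> real) \<Rightarrow> ((nat \<Rightarrow> real) \<Rightarrow> real) \<Rightarrow> (nat \<Rightarrow> real) \<Rightarrow> real" where
  "dir1 p h f x = (\<Sum>j\<in>{1..p}. h j * pdiff j f x)"

definition dir2 :: "nat \<Rightarrow> (nat \<Rightarrow> real) \<Rightarrow> ((nat \<Rightarrow> real) \<Rightarrow> real) \<Rightarrow> (nat \<Rightarrow> real) \<Rightarrow> real" where
  "dir2 p h f x = (\<Sum>j\<in>{1..p}. \<Sum>k\<in>{1..p}. h j * h k * pdiff j (pdiff k f) x)"

definition dir3 :: "nat \<Rightarrow> (nat \<Rightarrow> real) \<Rightarrow> ((nat \<Rightarrow> real) \<Rightarrow> real) \<Rightarrow> (nat \<Rightarrow> real) \<Rightarrow> real" where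
  "dir3 p h f x =
     (\<Sum>j\<in>{1..p}. \<Sum>k\<in>{1..p}. \<Sum>l\<in>{1..p}. h j * h k * h l * pdiff j (pdiff k (pdiff l f)) x)"

lemma along_deriv_dir1:
  "Ck p (Suc m) f \<Longrightarrow>
    ((\<lambda>t. f (along p w h t)) has_real_derivative dir1 p h f (along p w h t)) (at t)"
  unfolding dir1_def by (rule along_has_derivative)

lemma along_deriv_dir2:
  assumes "Ck p (Suc (Suc m)) f"
  shows "((\<lambda>t. dir1 p h f (along p w h t)) has_real_derivative dir2 p h f (along p w h t)) (at t)"
proof -
  have "((\<lambda>t. \<Sum>k\<in>{1..p}. h k * pdiff k f (along p w h t)) has_real_derivative
      (\<Sum>k\<in>{1..p}. h k * (\<Sum>j\<in>{1..p}. h j * pdiff j (pdiff k f) (along p w h t)))) (at t)"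
    by (intro DERIV_sum DERIV_cmult along_has_derivative[where m=m] Ck_pdiff[OF assms])
  also have "(\<Sum>k\<in>{1..p}. h k * (\<Sum>j\<in>{1..p}. h j * pdiff j (pdiff k f) (along p w h t)))
      = dir2 p h f (along p w h t)"
    unfolding dir2_def sum_distrib_left
    by (subst sum.swap) (simp add: mult.assoc mult.left_commute)
  finally show ?thesis by (simp only: dir1_def)
qed

lemma along_deriv_dir3:
  assumes "Ck p (Suc (Suc (Suc m))) f"
  shows "((\<lambda>t. dir2 p h f (along p w h t)) has_real_derivative dir3 p h f (along p w h t)) (at t)"
proof -
  let ?x = "along p w h t"
  have "((\<lambda>t. \<Sum>k\<in>{1..p}. \<Sum>l\<in>{1..p}. h k * h l * pdiff k (pdiff l f) (along p w h t)) has_real_derivative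
      (\<Sum>k\<in>{1..p}. \<Sum>l\<in>{1..p}. h k * h l * (\<Sum>j\<in>{1..p}. h j * pdiff j (pdiff k (pdiff l f)) ?x))) (at t)"
    by (intro DERIV_sum DERIV_cmult along_has_derivative[where m=m] Ck_pdiff)
      (use assms in auto)
  also have "(\<Sum>k\<in>{1..p}. \<Sum>l\<in>{1..p}. h k * h l * (\<Sum>j\<in>{1..p}. h j * pdiff j (pdiff k (pdiff l f)) ?x))
      = (\<Sum>k\<in>{1..p}. \<Sum>j\<in>{1..p}. \<Sum>l\<in>{1..p}. h j * h k * h l * pdiff j (pdiff k (pdiff l f)) ?x)"
    unfolding sum_distrib_left
    by (rule sum.cong[OF refl], subst sum.swap) (simp add: ac_simps)
  also have "\<dots> = dir3 p h f ?x"
    unfolding dir3_def by (rule sum.swap)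
  finally show ?thesis by (simp only: dir2_def)
qed

lemma along_0: "w \<in> space (Rp p) \<Longrightarrow> along p w h 0 = w"
  by (auto simp: along_def space_Rp extensional_restrict restrict_def extensional_def fun_eq_iff)

lemma along_1: "along p w h 1 = vadd p w h"
  by (simp add: along_def vadd_def)

text \<open>The remainder is only quadratically small in \<open>h\<close> when third derivatives are not used; the two
  lemmas below give both forms.\<close>

definition taylor_rem :: "nat \<Rightarrow> ((nat \<Rightarrow> real) \<Rightarrow> real) \<Rightarrow> (nat \<Rightarrow> real) \<Rightarrow> (nat \<Rightarrow> real) \<Rightarrow> real" where
  "taylor_rem p f w h = f (vadd p w h) - f w - dir1 p h f w - dir2 p h f w / 2"

lemma taylor_rem_order2:
  assumes "Ck p 2 f" "w \<in> space (Rp p)"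
  shows "\<exists>t. 0 < t \<and> t < 1 \<and> taylor_rem p f w h = (dir2 p h f (along p w h t) - dir2 p h f w) / 2"
proof -
  have f: "Ck p (Suc (Suc 0)) f" using assms(1) by (simp add: numeral_2_eq_2)
  define d where "d m t = (if m = 0 then f (along p w h t) else
      if m = 1 then dir1 p h f (along p w h t) else dir2 p h f (along p w h t))" for m :: nat and t
  have "\<exists>t. 0 < t \<and> t < 1 \<and>
      f (along p w h 1) = (\<Sum>m<2. (d m 0 / fact m) * 1 ^ m) + (d 2 t / fact 2) * 1 ^ 2"
  proof (rule Maclaurin)
    show "d 0 = (\<lambda>t. f (along p w h t))" by (simp add: d_def fun_eq_iff)
    show "\<forall>m t. m < 2 \<and> 0 \<le> t \<and> t \<le> 1 \<longrightarrow> DERIV (d m) t :> d (Suc m) t"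
      using along_deriv_dir1[OF f] along_deriv_dir2[OF f]
      by (auto simp: d_def[abs_def] less_2_cases_iff)
  qed auto
  then show ?thesis
    using assms(2) by (auto simp: d_def taylor_rem_def along_1 along_0 numeral_2_eq_2 field_simps)
qed

lemma taylor_rem_order3:
  assumes "Ck p 3 f" "w \<in> space (Rp p)"
  shows "\<exists>t. 0 < t \<and> t < 1 \<and> taylor_rem p f w h = dir3 p h f (along p w h t) / 6"
proof -
  have f: "Ck p (Suc (Suc (Suc 0))) f" using assms(1) by (simp add: numeral_3_eq_3)
  define d where "d m t = (if m = 0 then f (along p w h t) else
      if m = 1 then dir1 p h f (along p w h t) else
      if m = 2 then dir2 p h f (along p w h t) else dir3 p h f (along p w h t))" for m :: nat and t
  have "\<exists>t. 0 < t \<and> t < 1 \<and>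
      f (along p w h 1) = (\<Sum>m<3. (d m 0 / fact m) * 1 ^ m) + (d 3 t / fact 3) * 1 ^ 3"
  proof (rule Maclaurin)
    show "d 0 = (\<lambda>t. f (along p w h t))" by (simp add: d_def fun_eq_iff)
    show "\<forall>m t. m < 3 \<and> 0 \<le> t \<and> t \<le> 1 \<longrightarrow> DERIV (d m) t :> d (Suc m) t"
      using along_deriv_dir1[OF f] along_deriv_dir2[OF f] along_deriv_dir3[OF f]
      by (auto simp: d_def[abs_def] less_Suc_eq numeral_3_eq_3)
  qed auto
  then show ?thesis
    using assms(2)
    by (auto simp: d_def taylor_rem_def along_1 along_0 numeral_3_eq_3 fact_numeral field_simps)
qed

text \<open>A set that is open along each coordinate axis; this is all the openness that partial
  derivatives can see.\<close>

definition axis_open :: "nat \<Rightarrow> (nat \<Rightarrow> real) set \<Rightarrow> bool" where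
  "axis_open p V \<longleftrightarrow> (\<forall>x\<in>V. \<forall>j\<in>{1..p}. \<forall>\<^sub>F t in nhds (x j). x(j := t) \<in> V)"

lemma axis_open_ball:
  assumes "p \<ge> 1" shows "axis_open p {x\<in>space (Rp p). vnorm p x < r}"
  unfolding axis_open_def
proof (intro ballI)
  fix x j assume x: "x \<in> {x\<in>space (Rp p). vnorm p x < r}" and j: "j \<in> {1..p}"
  then have "\<bar>x j\<bar> < r" by (simp add: vnorm_less_iff[OF assms])
  then have "\<forall>\<^sub>F t in nhds (x j). \<bar>t\<bar> < r"
    by (intro order_tendstoD(2)[OF tendsto_rabs[OF filterlim_ident]])
  then show "\<forall>\<^sub>F t in nhds (x j). x(j := t) \<in> {x\<in>space (Rp p). vnorm p x < r}"
    by eventually_elim (use x j upd_in_Rp in \<open>auto simp: vnorm_less_iff[OF assms]\<close>)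
qed

lemma axis_open_coball:
  assumes "p \<ge> 1" shows "axis_open p {x\<in>space (Rp p). r < vnorm p x}"
  unfolding axis_open_def
proof (intro ballI)
  have iff: "r < vnorm p x \<longleftrightarrow> (\<exists>i\<in>{1..p}. r < \<bar>x i\<bar>)" for x
    using vnorm_le_iff[OF assms, of x r] by (auto simp: not_le[symmetric])
  fix x j assume x: "x \<in> {x\<in>space (Rp p). r < vnorm p x}" and j: "j \<in> {1..p}"
  then obtain i where i: "i \<in> {1..p}" "r < \<bar>x i\<bar>" by (auto simp: iff)
  have "\<forall>\<^sub>F t in nhds (x j). r < \<bar>(x(j := t)) i\<bar>"
  proof (cases "i = j")
    case True
    then show ?thesis
      using i(2) by (simp, intro order_tendstoD(1)[OF tendsto_rabs[OF filterlim_ident]])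
  qed (use i in auto)
  then show "\<forall>\<^sub>F t in nhds (x j). x(j := t) \<in> {x\<in>space (Rp p). r < vnorm p x}"
    by eventually_elim (use x j i(1) upd_in_Rp in \<open>auto simp: iff simp del: fun_upd_apply\<close>)
qed

lemma pdiff_eq_0_of_constant_on:
  assumes "axis_open p V" "\<And>x. x \<in> V \<Longrightarrow> f x = c" "x \<in> V" "j \<in> {1..p}"
  shows "pdiff j f x = 0"
proof -
  have "\<forall>\<^sub>F t in nhds (x j). f (x(j := t)) = c"
    by (rule eventually_mono[of "\<lambda>t. x(j := t) \<in> V"])
      (use assms in \<open>auto simp: axis_open_def\<close>)
  then have "deriv (\<lambda>t. f (x(j := t))) (x j) = deriv (\<lambda>t. c) (x j)"
    by (rule deriv_cong_ev) simp
  then show ?thesis by (simp add: pdiff_def)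
qed

lemma dir3_eq_0_of_constant_on:
  assumes V: "axis_open p V" "\<And>x. x \<in> V \<Longrightarrow> f x = c" "x \<in> V"
  shows "dir3 p h f x = 0"
proof -
  have 1: "pdiff l f y = 0" if "l \<in> {1..p}" "y \<in> V" for l y
    using pdiff_eq_0_of_constant_on[OF V(1), of f] V(2) that by blast
  have 2: "pdiff k (pdiff l f) y = 0" if "k \<in> {1..p}" "l \<in> {1..p}" "y \<in> V" for k l y
    using pdiff_eq_0_of_constant_on[OF V(1), of "pdiff l f" 0] 1 that by blast
  have 3: "pdiff j (pdiff k (pdiff l f)) y = 0"
    if "j \<in> {1..p}" "k \<in> {1..p}" "l \<in> {1..p}" "y \<in> V" for j k l y
    using pdiff_eq_0_of_constant_on[OF V(1), of "pdiff k (pdiff l f)" 0] 2 that by blast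
  show ?thesis unfolding dir3_def using V(3) by (simp add: 3)
qed


section \<open>Taylor remainders of the smoothing function\<close>

lemma logep_ge_1: "p \<ge> 1 \<Longrightarrow> 1 \<le> logep p"
  by (simp add: logep_def ln_mult)

text \<open>The body of the existential statement in \<^const>\<open>smoothing_constants\<close>, for one radius \<open>r\<close> and one
  width \<open>\<epsilon>\<close>.\<close>

definition smoother :: "nat \<Rightarrow> real \<Rightarrow> real \<Rightarrow> real \<Rightarrow> real \<Rightarrow> ((nat \<Rightarrow> real) \<Rightarrow> real)
    \<Rightarrow> (nat \<Rightarrow> (nat \<Rightarrow> real) \<Rightarrow> real) \<Rightarrow> (nat \<Rightarrow> nat \<Rightarrow> (nat \<Rightarrow> real) \<Rightarrow> real)
    \<Rightarrow> (nat \<Rightarrow> nat \<Rightarrow> nat \<Rightarrow> (nat \<Rightarrow> real) \<Rightarrow> real) \<Rightarrow> bool" where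
  "smoother p C0 CC r \<epsilon> \<phi> D1 D2 D3 \<longleftrightarrow>
         Ck p 3 \<phi> \<and>
         (\<forall>x\<in>space (Rp p). 0 \<le> \<phi> x \<and> \<phi> x \<le> 1) \<and>
         (\<forall>x\<in>space (Rp p).
            of_bool (vnorm p x \<le> r) \<le> \<phi> x \<and> \<phi> x \<le> of_bool (vnorm p x \<le> r + \<epsilon>)) \<and>
         (\<forall>j\<in>{1..p}. admissible_bound p CC \<epsilon> (D1 j)) \<and>
         (\<forall>j\<in>{1..p}. \<forall>k\<in>{1..p}. admissible_bound p CC \<epsilon> (D2 j k)) \<and>
         (\<forall>j\<in>{1..p}. \<forall>k\<in>{1..p}. \<forall>l\<in>{1..p}. admissible_bound p CC \<epsilon> (D3 j k l)) \<and>
         (\<forall>x\<in>space (Rp p).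
            (\<forall>j\<in>{1..p}. \<bar>pdiff j \<phi> x\<bar> \<le> D1 j x) \<and>
            (\<forall>j\<in>{1..p}. \<forall>k\<in>{1..p}. \<bar>pdiff j (pdiff k \<phi>) x\<bar> \<le> D2 j k x) \<and>
            (\<forall>j\<in>{1..p}. \<forall>k\<in>{1..p}. \<forall>l\<in>{1..p}.
               \<bar>pdiff j (pdiff k (pdiff l \<phi>)) x\<bar> \<le> D3 j k l x) \<and>
            (\<Sum>j\<in>{1..p}. D1 j x) \<le> C0 / \<epsilon> \<and>
            (\<Sum>j\<in>{1..p}. \<Sum>k\<in>{1..p}. D2 j k x) \<le> C0 * logep p / \<epsilon>^2 \<and>
            (\<Sum>j\<in>{1..p}. \<Sum>k\<in>{1..p}. \<Sum>l\<in>{1..p}. D3 j k l x) \<le> C0 * (logep p)^2 / \<epsilon>^3)"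

lemma smoother_exists:
  assumes "smoothing_constants C0 CC" "p \<ge> 1" "r \<ge> 0" "\<epsilon> > 0"
  obtains \<phi> D1 D2 D3 where "smoother p C0 CC r \<epsilon> \<phi> D1 D2 D3"
proof -
  have "\<forall>p\<ge>1. \<forall>r\<ge>0. \<forall>\<epsilon>>0. \<exists>\<phi> D1 D2 D3. smoother p C0 CC r \<epsilon> \<phi> D1 D2 D3"
    using assms(1) unfolding smoothing_constants_def smoother_def by (elim conjE)
  with assms(2-4) that show ?thesis by blast
qed

lemma sum_nonneg_element_le:
  fixes D :: "nat \<Rightarrow> real"
  assumes "\<And>j. j \<in> {1..p} \<Longrightarrow> 0 \<le> D j" "i \<in> {1..p}"
  shows "D i \<le> (\<Sum>j\<in>{1..p}. D j)"
  using assms by (intro member_le_sum) auto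

locale smoothing =
  fixes p :: nat and C0 CC r \<epsilon> :: real and \<phi> D1 D2 D3
  assumes p: "p \<ge> 1" and eps: "\<epsilon> > 0" and CC: "CC > 0"
    and smoother: "smoother p C0 CC r \<epsilon> \<phi> D1 D2 D3"
begin

lemma Ck3: "Ck p 3 \<phi>" and Ck2: "Ck p 2 \<phi>"
  using smoother unfolding smoother_def by (auto simp: numeral_3_eq_3 numeral_2_eq_2)

lemma phi_range: "x \<in> space (Rp p) \<Longrightarrow> 0 \<le> \<phi> x \<and> \<phi> x \<le> 1"
  using smoother unfolding smoother_def by blast

lemma phi_inside: "x \<in> space (Rp p) \<Longrightarrow> vnorm p x \<le> r \<Longrightarrow> \<phi> x = 1"
  using smoother unfolding smoother_def by (metis antisym of_bool_eq(2))

lemma phi_outside: "x \<in> space (Rp p) \<Longrightarrow> r + \<epsilon> < vnorm p x \<Longrightarrow> \<phi> x = 0"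
  using smoother unfolding smoother_def by (metis antisym of_bool_eq(1) not_less)

lemma adm:
  "j \<in> {1..p} \<Longrightarrow> admissible_bound p CC \<epsilon> (D1 j)"
  "j \<in> {1..p} \<Longrightarrow> k \<in> {1..p} \<Longrightarrow> admissible_bound p CC \<epsilon> (D2 j k)"
  "j \<in> {1..p} \<Longrightarrow> k \<in> {1..p} \<Longrightarrow> l \<in> {1..p} \<Longrightarrow> admissible_bound p CC \<epsilon> (D3 j k l)"
  using smoother unfolding smoother_def by blast+

lemma D_nonneg:
  "j \<in> {1..p} \<Longrightarrow> x \<in> space (Rp p) \<Longrightarrow> 0 \<le> D1 j x"
  "j \<in> {1..p} \<Longrightarrow> k \<in> {1..p} \<Longrightarrow> x \<in> space (Rp p) \<Longrightarrow> 0 \<le> D2 j k x"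
  "j \<in> {1..p} \<Longrightarrow> k \<in> {1..p} \<Longrightarrow> l \<in> {1..p} \<Longrightarrow> x \<in> space (Rp p) \<Longrightarrow> 0 \<le> D3 j k l x"
  using adm unfolding admissible_bound_def by blast+

lemma D3_measurable:
  "j \<in> {1..p} \<Longrightarrow> k \<in> {1..p} \<Longrightarrow> l \<in> {1..p} \<Longrightarrow> D3 j k l \<in> borel_measurable (Rp p)"
  using adm unfolding admissible_bound_def by blast

lemma pdiff_le:
  assumes "x \<in> space (Rp p)"
  shows "j \<in> {1..p} \<Longrightarrow> \<bar>pdiff j \<phi> x\<bar> \<le> D1 j x"
    "j \<in> {1..p} \<Longrightarrow> k \<in> {1..p} \<Longrightarrow> \<bar>pdiff j (pdiff k \<phi>) x\<bar> \<le> D2 j k x"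
    "j \<in> {1..p} \<Longrightarrow> k \<in> {1..p} \<Longrightarrow> l \<in> {1..p} \<Longrightarrow> \<bar>pdiff j (pdiff k (pdiff l \<phi>)) x\<bar> \<le> D3 j k l x"
  using smoother assms unfolding smoother_def by blast+

lemma D_sums:
  assumes "x \<in> space (Rp p)"
  shows "(\<Sum>j\<in>{1..p}. D1 j x) \<le> C0 / \<epsilon>"
    "(\<Sum>j\<in>{1..p}. \<Sum>k\<in>{1..p}. D2 j k x) \<le> C0 * logep p / \<epsilon>^2"
    "(\<Sum>j\<in>{1..p}. \<Sum>k\<in>{1..p}. \<Sum>l\<in>{1..p}. D3 j k l x) \<le> C0 * (logep p)^2 / \<epsilon>^3"
  using smoother assms unfolding smoother_def by blast+

lemma pdiff1_bounded:
  assumes x: "x \<in> space (Rp p)" and j: "j \<in> {1..p}"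
  shows "\<bar>pdiff j \<phi> x\<bar> \<le> C0 / \<epsilon>"
  using pdiff_le(1)[OF x j] D_sums(1)[OF x]
    sum_nonneg_element_le[of p "\<lambda>j. D1 j x" j] D_nonneg(1)[OF _ x] j by fastforce

lemma pdiff2_bounded:
  assumes x: "x \<in> space (Rp p)" and jk: "j \<in> {1..p}" "k \<in> {1..p}"
  shows "\<bar>pdiff j (pdiff k \<phi>) x\<bar> \<le> C0 * logep p / \<epsilon>^2"
proof -
  have "D2 j k x \<le> (\<Sum>k\<in>{1..p}. D2 j k x)"
    using jk x by (intro sum_nonneg_element_le D_nonneg)
  also have "\<dots> \<le> (\<Sum>j\<in>{1..p}. \<Sum>k\<in>{1..p}. D2 j k x)"
    using jk x by (intro sum_nonneg_element_le[where D="\<lambda>j. \<Sum>k\<in>{1..p}. D2 j k x"] sum_nonneg D_nonneg)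
  finally show ?thesis using pdiff_le(2)[OF x jk] D_sums(2)[OF x] by linarith
qed

lemma D3_bounded:
  assumes x: "x \<in> space (Rp p)" and jk: "j \<in> {1..p}" "k \<in> {1..p}" "l \<in> {1..p}"
  shows "D3 j k l x \<le> C0 * (logep p)^2 / \<epsilon>^3"
proof -
  have "D3 j k l x \<le> (\<Sum>l\<in>{1..p}. D3 j k l x)"
    using jk x by (intro sum_nonneg_element_le D_nonneg)
  also have "\<dots> \<le> (\<Sum>k\<in>{1..p}. \<Sum>l\<in>{1..p}. D3 j k l x)"
    using jk x by (intro sum_nonneg_element_le[where D="\<lambda>k. \<Sum>l\<in>{1..p}. D3 j k l x"] sum_nonneg D_nonneg)
  also have "\<dots> \<le> (\<Sum>j\<in>{1..p}. \<Sum>k\<in>{1..p}. \<Sum>l\<in>{1..p}. D3 j k l x)"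
    using jk x
    by (intro sum_nonneg_element_le[where D="\<lambda>j. \<Sum>k\<in>{1..p}. \<Sum>l\<in>{1..p}. D3 j k l x"] sum_nonneg D_nonneg)
  finally show ?thesis using D_sums(3)[OF x] by linarith
qed

lemma dir2_bound:
  assumes x: "x \<in> space (Rp p)"
  shows "\<bar>dir2 p h \<phi> x\<bar> \<le> C0 * logep p / \<epsilon>^2 * (vnorm p h)^2"
proof -
  have "\<bar>dir2 p h \<phi> x\<bar> \<le> (\<Sum>j\<in>{1..p}. \<Sum>k\<in>{1..p}. \<bar>h j * h k * pdiff j (pdiff k \<phi>) x\<bar>)"
    unfolding dir2_def by (intro order_trans[OF sum_abs] sum_mono sum_abs)
  also have "\<dots> \<le> (\<Sum>j\<in>{1..p}. \<Sum>k\<in>{1..p}. (vnorm p h)^2 * D2 j k x)"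
  proof (intro sum_mono)
    fix j k assume jk: "j \<in> {1..p}" "k \<in> {1..p}"
    have "\<bar>h j\<bar> * \<bar>h k\<bar> \<le> vnorm p h * vnorm p h"
      using jk p by (intro mult_mono abs_le_vnorm vnorm_nonneg) auto
    then have "(\<bar>h j\<bar> * \<bar>h k\<bar>) * \<bar>pdiff j (pdiff k \<phi>) x\<bar> \<le> (vnorm p h)^2 * D2 j k x"
      using pdiff_le(2)[OF x jk] by (intro mult_mono) (auto simp: power2_eq_square)
    then show "\<bar>h j * h k * pdiff j (pdiff k \<phi>) x\<bar> \<le> (vnorm p h)^2 * D2 j k x"
      by (simp add: abs_mult)
  qed
  also have "\<dots> = (vnorm p h)^2 * (\<Sum>j\<in>{1..p}. \<Sum>k\<in>{1..p}. D2 j k x)"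
    by (simp add: sum_distrib_left)
  also have "\<dots> \<le> (vnorm p h)^2 * (C0 * logep p / \<epsilon>^2)"
    by (intro mult_left_mono D_sums x) auto
  finally show ?thesis by (simp add: mult.commute)
qed

lemma taylor_rem_large:
  assumes w: "w \<in> space (Rp p)"
  shows "\<bar>taylor_rem p \<phi> w h\<bar> \<le> C0 * logep p / \<epsilon>^2 * (vnorm p h)^2"
proof -
  obtain t where "taylor_rem p \<phi> w h = (dir2 p h \<phi> (along p w h t) - dir2 p h \<phi> w) / 2"
    using taylor_rem_order2[OF Ck2 w] by blast
  moreover have "along p w h t \<in> space (Rp p)" by (simp add: along_def restrict_in_Rp)
  ultimately show ?thesis using dir2_bound[of "along p w h t" h] dir2_bound[OF w, of h] by (simp add: abs_if split: if_splits)
qed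

definition annulus :: "(nat \<Rightarrow> real) set" where
  "annulus = {w\<in>space (Rp p). r - \<epsilon> \<le> vnorm p w \<and> vnorm p w \<le> r + 2 * \<epsilon>}"

text \<open>The third derivatives vanish off the shell \<open>r \<le> \<parallel>x\<parallel> \<le> r + \<epsilon>\<close>, where \<open>\<phi>\<close> is locally constant.
  A step of length at most \<open>\<epsilon> / log (e p)\<close> enlarges the shell to the annulus and changes the
  bounds by at most the factor \<open>e\<^sup>\<CC>\<close>, so that the remainder is controlled by quantities that
  depend only on the starting point.\<close>

lemma taylor_rem_small:
  assumes w: "w \<in> space (Rp p)" and h: "vnorm p h \<le> \<epsilon> / logep p"
  shows "\<bar>taylor_rem p \<phi> w h\<bar> \<le> exp CC / 6 *
    (\<Sum>j\<in>{1..p}. \<Sum>k\<in>{1..p}. \<Sum>l\<in>{1..p}. \<bar>h j * h k * h l\<bar> * (D3 j k l w * indicator annulus w))"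
    (is "_ \<le> ?B")
proof -
  have lp: "logep p \<ge> 1" by (rule logep_ge_1[OF p])
  have h': "vnorm p h \<le> \<epsilon>"
  proof -
    have "\<epsilon> / logep p \<le> \<epsilon> / 1" using lp eps by (intro divide_left_mono) auto
    with h show ?thesis by simp
  qed
  obtain t where t: "0 < t" "t < 1" "taylor_rem p \<phi> w h = dir3 p h \<phi> (along p w h t) / 6"
    using taylor_rem_order3[OF Ck3 w] by blast
  define x where "x = along p w h t"
  have x: "x \<in> space (Rp p)" by (simp add: x_def along_def restrict_in_Rp)
  have th: "\<bar>t * h i\<bar> \<le> \<epsilon>" if "i \<in> {1..p}" for i
  proof -
    have "\<bar>t * h i\<bar> \<le> 1 * \<bar>h i\<bar>" unfolding abs_mult using t by (intro mult_right_mono) auto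
    with abs_le_vnorm[OF that, of h] h' show ?thesis by linarith
  qed
  have 0: "0 \<le> ?B"
    by (intro mult_nonneg_nonneg sum_nonneg) (auto simp: indicator_def D_nonneg w)
  show ?thesis
  proof (cases "vnorm p x < r \<or> r + \<epsilon> < vnorm p x")
    case True
    then have "dir3 p h \<phi> x = 0"
    proof
      assume "vnorm p x < r"
      then show ?thesis
        using x by (intro dir3_eq_0_of_constant_on[OF axis_open_ball[OF p, of r], of _ 1])
          (auto intro!: phi_inside)
    next
      assume "r + \<epsilon> < vnorm p x"
      then show ?thesis
        using x by (intro dir3_eq_0_of_constant_on[OF axis_open_coball[OF p, of "r + \<epsilon>"], of _ 0])
          (auto intro!: phi_outside)
    qed
    then show ?thesis using 0 t(3) by (simp add: x_def)
  next
    case False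
    have "vnorm p x \<le> vnorm p w + \<epsilon>"
    proof (rule vnorm_triangle_le[OF p])
      fix i assume i: "i \<in> {1..p}"
      show "\<bar>x i\<bar> \<le> \<bar>w i\<bar> + \<epsilon>" using th[OF i] i by (auto simp: x_def along_def)
    qed
    moreover have "vnorm p w \<le> vnorm p x + \<epsilon>"
    proof (rule vnorm_triangle_le[OF p])
      fix i assume i: "i \<in> {1..p}"
      show "\<bar>w i\<bar> \<le> \<bar>x i\<bar> + \<epsilon>" using th[OF i] i by (auto simp: x_def along_def)
    qed
    ultimately have ann: "indicator annulus w = (1::real)"
      using False w by (auto simp: annulus_def indicator_def)
    define u where "u = (\<lambda>j\<in>{1..p}. t * h j)"
    have xu: "x = vadd p w u" by (auto simp: x_def along_def vadd_def u_def restrict_def)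
    have "vnorm p u \<le> \<epsilon> / logep p"
    proof -
      have "vnorm p u = \<bar>t\<bar> * vnorm p h" unfolding u_def by (rule vnorm_scale[OF p])
      also have "\<dots> \<le> 1 * vnorm p h" using t by (intro mult_right_mono vnorm_nonneg p) auto
      finally show ?thesis using h by simp
    qed
    then have "logep p * vnorm p u / \<epsilon> \<le> 1" using lp eps by (simp add: field_simps)
    then have e: "CC * logep p * vnorm p u / \<epsilon> \<le> CC" using CC
      by (metis mult.assoc mult_left_le less_imp_le times_divide_eq_right)
    have D: "D3 j k l x \<le> exp CC * D3 j k l w" if "j \<in> {1..p}" "k \<in> {1..p}" "l \<in> {1..p}" for j k l
    proof -
      have "D3 j k l x \<le> exp (CC * logep p * vnorm p u / \<epsilon>) * D3 j k l w"
        using adm(3)[OF that] w unfolding xu admissible_bound_def log_stable_def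
        by (auto simp: u_def restrict_in_Rp)
      also have "\<dots> \<le> exp CC * D3 j k l w"
        using e by (intro mult_right_mono D_nonneg that w) auto
      finally show ?thesis .
    qed
    have "\<bar>dir3 p h \<phi> x\<bar> \<le> (\<Sum>j\<in>{1..p}. \<Sum>k\<in>{1..p}. \<Sum>l\<in>{1..p}.
        \<bar>h j * h k * h l * pdiff j (pdiff k (pdiff l \<phi>)) x\<bar>)"
      unfolding dir3_def by (intro order_trans[OF sum_abs] sum_mono sum_abs)
    also have "\<dots> \<le> (\<Sum>j\<in>{1..p}. \<Sum>k\<in>{1..p}. \<Sum>l\<in>{1..p}.
        exp CC * (\<bar>h j * h k * h l\<bar> * (D3 j k l w * indicator annulus w)))"
    proof (intro sum_mono)
      fix j k l assume jkl: "j \<in> {1..p}" "k \<in> {1..p}" "l \<in> {1..p}"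
      have "\<bar>pdiff j (pdiff k (pdiff l \<phi>)) x\<bar> \<le> exp CC * D3 j k l w"
        using pdiff_le(3)[OF x jkl] D[OF jkl] by linarith
      then have "\<bar>h j * h k * h l\<bar> * \<bar>pdiff j (pdiff k (pdiff l \<phi>)) x\<bar>
          \<le> \<bar>h j * h k * h l\<bar> * (exp CC * D3 j k l w)" by (intro mult_left_mono) auto
      then show "\<bar>h j * h k * h l * pdiff j (pdiff k (pdiff l \<phi>)) x\<bar>
          \<le> exp CC * (\<bar>h j * h k * h l\<bar> * (D3 j k l w * indicator annulus w))"
        by (simp add: abs_mult ann ac_simps)
    qed
    also have "\<dots> = 6 * ?B" by (simp add: sum_distrib_left)
    finally show ?thesis using t(3) by (simp add: x_def)
  qed
qed

end


section \<open>One exchange of laws\<close>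

lemma measurable_vadd:
  assumes "f \<in> N \<rightarrow>\<^sub>M Rp p" "\<And>j. j \<in> {1..p} \<Longrightarrow> (\<lambda>\<omega>. g \<omega> j) \<in> borel_measurable N"
  shows "(\<lambda>\<omega>. vadd p (f \<omega>) (g \<omega>)) \<in> N \<rightarrow>\<^sub>M Rp p"
  unfolding vadd_def
  by (intro measurable_restrict borel_measurable_add assms(2) measurable_Rp_component[OF assms(1)])

lemma abs_prod3_le_mean_cubes:
  fixes a b c :: real
  shows "\<bar>a * b * c\<bar> \<le> (\<bar>a\<bar>^3 + \<bar>b\<bar>^3 + \<bar>c\<bar>^3) / 3"
proof -
  define x y z where "x = \<bar>a\<bar>" "y = \<bar>b\<bar>" "z = \<bar>c\<bar>"
  have nn: "x \<ge> 0" "y \<ge> 0" "z \<ge> 0" by (simp_all add: x_y_z_def)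
  have "x^3 + y^3 + z^3 - 3 * (x * y * z) = (x + y + z) * ((x-y)^2 + (y-z)^2 + (z-x)^2) / 2"
    by (simp add: power2_eq_square power3_eq_cube algebra_simps)
  also have "\<dots> \<ge> 0" using nn by (intro divide_nonneg_nonneg mult_nonneg_nonneg add_nonneg_nonneg) auto
  finally show ?thesis by (simp add: x_y_z_def abs_mult)
qed

lemma integrable_mult_of_squares:
  fixes f g :: "'a \<Rightarrow> real"
  assumes "f \<in> borel_measurable N" "integrable N (\<lambda>x. (f x)^2)"
    and "g \<in> borel_measurable N" "integrable N (\<lambda>x. (g x)^2)"
  shows "integrable N (\<lambda>x. f x * g x)"
proof (rule Bochner_Integration.integrable_bound)
  show "integrable N (\<lambda>x. (f x)^2 + (g x)^2)" using assms by auto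
  show "(\<lambda>x. f x * g x) \<in> borel_measurable N" using assms by auto
  have "norm (f x * g x) \<le> norm ((f x)^2 + (g x)^2)" for x
  proof -
    have "\<bar>f x * g x\<bar> \<le> (f x)^2 + (g x)^2"
      using sum_squares_bound[of "\<bar>f x\<bar>" "\<bar>g x\<bar>"] abs_ge_zero[of "f x * g x"]
      unfolding abs_mult power2_abs by linarith
    then show ?thesis by simp
  qed
  then show "AE x in N. norm (f x * g x) \<le> norm ((f x)^2 + (g x)^2)" by simp
qed

lemma integral_sum2:
  fixes f :: "'i \<Rightarrow> 'j \<Rightarrow> 'a \<Rightarrow> real"
  assumes "\<And>j k. j \<in> A \<Longrightarrow> k \<in> B \<Longrightarrow> integrable N (f j k)"
  shows "(\<integral>x. (\<Sum>j\<in>A. \<Sum>k\<in>B. f j k x) \<partial>N) = (\<Sum>j\<in>A. \<Sum>k\<in>B. (\<integral>x. f j k x \<partial>N))"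
  using assms by (simp add: Bochner_Integration.integral_sum Bochner_Integration.integrable_sum)

lemma integral_sum3:
  fixes f :: "'i \<Rightarrow> 'j \<Rightarrow> 'k \<Rightarrow> 'a \<Rightarrow> real"
  assumes "\<And>j k l. j \<in> A \<Longrightarrow> k \<in> B \<Longrightarrow> l \<in> C \<Longrightarrow> integrable N (f j k l)"
  shows "(\<integral>x. (\<Sum>j\<in>A. \<Sum>k\<in>B. \<Sum>l\<in>C. f j k l x) \<partial>N)
    = (\<Sum>j\<in>A. \<Sum>k\<in>B. \<Sum>l\<in>C. (\<integral>x. f j k l x \<partial>N))"
  using assms by (simp add: Bochner_Integration.integral_sum Bochner_Integration.integrable_sum)

lemma ennreal_sum3:
  assumes "\<And>j k l. j \<in> A \<Longrightarrow> k \<in> B \<Longrightarrow> l \<in> C \<Longrightarrow> 0 \<le> f j k l"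
  shows "ennreal (\<Sum>j\<in>A. \<Sum>k\<in>B. \<Sum>l\<in>C. f j k l) = (\<Sum>j\<in>A. \<Sum>k\<in>B. \<Sum>l\<in>C. ennreal (f j k l))"
  using assms by (simp add: sum_nonneg)

lemma nn_integral_sum3:
  fixes f :: "'i \<Rightarrow> 'j \<Rightarrow> 'k \<Rightarrow> 'a \<Rightarrow> ennreal"
  assumes "\<And>j k l. j \<in> A \<Longrightarrow> k \<in> B \<Longrightarrow> l \<in> C \<Longrightarrow> f j k l \<in> borel_measurable N"
  shows "(\<integral>\<^sup>+x. (\<Sum>j\<in>A. \<Sum>k\<in>B. \<Sum>l\<in>C. f j k l x) \<partial>N)
    = (\<Sum>j\<in>A. \<Sum>k\<in>B. \<Sum>l\<in>C. (\<integral>\<^sup>+x. f j k l x \<partial>N))"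
  using assms by (simp add: nn_integral_sum)

context smoothing
begin

lemma phi_measurable: "\<phi> \<in> borel_measurable (Rp p)"
  by (rule Ck_borel_measurable[OF Ck3])

lemma pdiff1_measurable: "j \<in> {1..p} \<Longrightarrow> pdiff j \<phi> \<in> borel_measurable (Rp p)"
  using Ck3 by (intro Ck_borel_measurable[where m=2]) (simp add: numeral_3_eq_3 numeral_2_eq_2)

lemma pdiff2_measurable:
  "j \<in> {1..p} \<Longrightarrow> k \<in> {1..p} \<Longrightarrow> pdiff j (pdiff k \<phi>) \<in> borel_measurable (Rp p)"
  using Ck3 by (intro Ck_borel_measurable[where m=1]) (simp add: numeral_3_eq_3 One_nat_def)

lemma annulus_measurable: "annulus \<in> sets (Rp p)"
proof -
  note [measurable] = measurable_vnorm_Rp[OF p]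
  show ?thesis unfolding annulus_def by measurable
qed

text \<open>One Lindeberg step: \<open>W\<close> is the law of the other summands, and \<open>PX\<close>, \<open>PY\<close> are the laws exchanged.
  Since their first two moments agree, only the Taylor remainder, averaged over \<open>W\<close>, is integrated
  against \<open>PX - PY\<close>; its modulus is then integrated against the total variation.\<close>

lemma swap_bound:
  assumes PX: "prob_space PX" "sets PX = sets (Rp p)"
    and PY: "prob_space PY" "sets PY = sets (Rp p)"
    and PW: "prob_space PW" "sets PW = sets (Rp p)"
    and s: "s > 0"
    and X2: "\<And>j. j \<in> {1..p} \<Longrightarrow> integrable PX (\<lambda>x. (x j)^2)"
    and Y2: "\<And>j. j \<in> {1..p} \<Longrightarrow> integrable PY (\<lambda>x. (x j)^2)"
    and mom1: "\<And>j. j \<in> {1..p} \<Longrightarrow> (\<integral>x. x j \<partial>PX) = (\<integral>x. x j \<partial>PY)"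
    and mom2: "\<And>j k. j \<in> {1..p} \<Longrightarrow> k \<in> {1..p} \<Longrightarrow> (\<integral>x. x j * x k \<partial>PX) = (\<integral>x. x j * x k \<partial>PY)"
    and Z: "Z = tv_measure (Rp p) (\<lambda>A. measure PX A - measure PY A)"
    and m: "m \<ge> 0" "\<And>j. j \<in> {1..p} \<Longrightarrow> (\<integral>\<^sup>+x. ennreal (\<bar>x j\<bar>^3) \<partial>Z) \<le> ennreal m"
    and B: "B \<ge> 0" "(\<integral>\<^sup>+x. ennreal ((vnorm p x)^2) *
        indicator {x. vnorm p x \<ge> s * \<epsilon> / logep p} x \<partial>Z) \<le> ennreal B"
  shows "\<bar>(\<integral>x. (\<integral>w. \<phi> (vadd p w (\<lambda>j\<in>{1..p}. x j / s)) \<partial>PW) \<partial>PX)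
        - (\<integral>x. (\<integral>w. \<phi> (vadd p w (\<lambda>j\<in>{1..p}. x j / s)) \<partial>PW) \<partial>PY)\<bar>
    \<le> exp CC / (6 * s^3) * (C0 * (logep p)^2 / \<epsilon>^3) * measure PW annulus * m
      + C0 * logep p / (\<epsilon>^2 * s^2) * B"
proof -
  interpret PX: prob_space PX by fact
  interpret PY: prob_space PY by fact
  interpret PW: prob_space PW by fact
  have spX: "space PX = space (Rp p)" and spY: "space PY = space (Rp p)" and spW: "space PW = space (Rp p)"
    using PX PY PW by (auto dest: sets_eq_imp_space_eq)
  note cong = measurable_cong_sets[OF PX(2) refl] measurable_cong_sets[OF PY(2) refl]
    measurable_cong_sets[OF PW(2) refl]
  have fin: "finite_measure PX" "finite_measure PY" by unfold_locales
  have setsZ: "sets Z = sets (Rp p)"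
    unfolding Z by (rule sets_tv_measure_diff[OF fin(1) PX(2) fin(2) PY(2)])
  have spZ: "space Z = space (Rp p)" using setsZ by (rule sets_eq_imp_space_eq)
  note congZ = measurable_cong_sets[OF setsZ refl]
  have lp: "logep p \<ge> 1" by (rule logep_ge_1[OF p])
  have C0: "0 \<le> C0"
  proof -
    have "restrict (\<lambda>_. 0::real) {1..p} \<in> space (Rp p)" by (rule restrict_in_Rp)
    then have "0 \<le> C0 / \<epsilon>" using D_sums(1) D_nonneg(1) by (meson order_trans sum_nonneg)
    then show ?thesis using eps by (simp add: zero_le_divide_iff)
  qed
  define sx where "sx x = (\<lambda>j\<in>{1..p}. x j / s)" for x :: "nat \<Rightarrow> real"
  have sx_norm: "vnorm p (sx x) = vnorm p x / s" for x
    using vnorm_scale[OF p, of "1/s" x] s by (simp add: sx_def)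
  define H where "H x = (\<integral>w. \<phi> (vadd p w (sx x)) \<partial>PW)" for x
  define R where "R x = (\<integral>w. taylor_rem p \<phi> w (sx x) \<partial>PW)" for x
  define a where "a j = (\<integral>w. pdiff j \<phi> w \<partial>PW)" for j
  define b where "b j k = (\<integral>w. pdiff j (pdiff k \<phi>) w \<partial>PW)" for j k
  define c where "c = (\<integral>w. \<phi> w \<partial>PW)"
  have H_int: "integrable PW (\<lambda>w. \<phi> (vadd p w (sx x)))" for x
  proof (rule PW.integrable_const_bound[where B=1])
    have "(\<lambda>w. vadd p w (sx x)) \<in> Rp p \<rightarrow>\<^sub>M Rp p" by (rule measurable_vadd) auto
    then show "(\<lambda>w. \<phi> (vadd p w (sx x))) \<in> borel_measurable PW"
      using measurable_compose[OF _ phi_measurable] cong by blast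
  qed (use phi_range[OF vadd_in_Rp] in auto)
  have a_int: "integrable PW (pdiff j \<phi>)" if j: "j \<in> {1..p}" for j
    by (rule PW.integrable_const_bound[where B="C0 / \<epsilon>"])
      (use pdiff1_bounded[OF _ j] pdiff1_measurable[OF j] in \<open>auto simp: spW cong\<close>)
  have b_int: "integrable PW (pdiff j (pdiff k \<phi>))" if j: "j \<in> {1..p}" "k \<in> {1..p}" for j k
    by (rule PW.integrable_const_bound[where B="C0 * logep p / \<epsilon>^2"])
      (use pdiff2_bounded[OF _ j] pdiff2_measurable[OF j] in \<open>auto simp: spW cong\<close>)
  have c_int: "integrable PW \<phi>"
    by (rule PW.integrable_const_bound[where B=1])
      (use phi_range phi_measurable in \<open>auto simp: spW cong\<close>)
  have rem_int: "integrable PW (\<lambda>w. taylor_rem p \<phi> w (sx x))" for x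
    unfolding taylor_rem_def dir1_def dir2_def
    by (intro Bochner_Integration.integrable_diff H_int c_int integrable_divide
        Bochner_Integration.integrable_sum Bochner_Integration.integrable_mult_right impI a_int b_int)
  have R_eq: "R x = H x - c - (\<Sum>j\<in>{1..p}. sx x j * a j)
      - (\<Sum>j\<in>{1..p}. \<Sum>k\<in>{1..p}. sx x j * sx x k * b j k) / 2" for x
  proof -
    have 1: "integrable PW (\<lambda>w. dir1 p (sx x) \<phi> w)"
      unfolding dir1_def
      by (intro Bochner_Integration.integrable_sum Bochner_Integration.integrable_mult_right impI a_int)
    have 2: "integrable PW (\<lambda>w. dir2 p (sx x) \<phi> w)"
      unfolding dir2_def
      by (intro Bochner_Integration.integrable_sum Bochner_Integration.integrable_mult_right impI b_int)
    have "(\<integral>w. dir1 p (sx x) \<phi> w \<partial>PW) = (\<Sum>j\<in>{1..p}. sx x j * a j)"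
      unfolding dir1_def a_def
      by (subst Bochner_Integration.integral_sum) (auto intro: a_int)
    moreover have "(\<integral>w. dir2 p (sx x) \<phi> w \<partial>PW) = (\<Sum>j\<in>{1..p}. \<Sum>k\<in>{1..p}. sx x j * sx x k * b j k)"
      unfolding dir2_def b_def
      by (subst integral_sum2) (auto intro: b_int)
    ultimately show ?thesis
      unfolding R_def taylor_rem_def H_def c_def using 1 2 H_int c_int by simp
  qed
  have sxj: "sx x j = x j / s" if "j \<in> {1..p}" for x j using that by (simp add: sx_def)
  have R_eq': "R x = H x - c - (\<Sum>j\<in>{1..p}. a j / s * x j)
      - (\<Sum>j\<in>{1..p}. \<Sum>k\<in>{1..p}. b j k / (2 * s^2) * (x j * x k))" for x
    unfolding R_eq sum_divide_distrib
    by (intro arg_cong2[where f="(-)"] refl sum.cong) (auto simp: sxj power2_eq_square ac_simps)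
  have H_meas: "H \<in> borel_measurable (Rp p)"
  proof -
    have "(\<lambda>z. vadd p (snd z) (sx (fst z))) \<in> Rp p \<Otimes>\<^sub>M PW \<rightarrow>\<^sub>M Rp p"
    proof (rule measurable_vadd)
      show "snd \<in> Rp p \<Otimes>\<^sub>M PW \<rightarrow>\<^sub>M Rp p" using PW(2) by (metis measurable_snd measurable_cong_sets)
      fix j assume j: "j \<in> {1..p}"
      have "(\<lambda>z. fst z j) \<in> borel_measurable (Rp p \<Otimes>\<^sub>M PW)"
        using j by (rule measurable_Rp_component[OF measurable_fst])
      then show "(\<lambda>z. sx (fst z) j) \<in> borel_measurable (Rp p \<Otimes>\<^sub>M PW)"
        unfolding sxj[OF j] by (intro borel_measurable_divide) auto
    qed
    from measurable_compose[OF this phi_measurable]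
    have "(\<lambda>(x, w). \<phi> (vadd p w (sx x))) \<in> borel_measurable (Rp p \<Otimes>\<^sub>M PW)"
      by (simp add: case_prod_beta)
    then show ?thesis unfolding H_def[abs_def] by (rule PW.borel_measurable_lebesgue_integral)
  qed
  have H01: "\<bar>H x\<bar> \<le> 1" for x
  proof -
    have "\<bar>H x\<bar> \<le> (\<integral>w. \<bar>\<phi> (vadd p w (sx x))\<bar> \<partial>PW)" unfolding H_def by (rule integral_abs_bound)
    also have "\<dots> \<le> (\<integral>w. 1 \<partial>PW)"
      using phi_range[OF vadd_in_Rp] H_int by (intro integral_mono) auto
    finally show ?thesis by (simp add: PW.prob_space)
  qed
  have main: "integrable P R \<and> (\<integral>x. R x \<partial>P) = (\<integral>x. H x \<partial>P) - c
      - (\<Sum>j\<in>{1..p}. a j / s * (\<integral>x. x j \<partial>P))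
      - (\<Sum>j\<in>{1..p}. \<Sum>k\<in>{1..p}. b j k / (2 * s^2) * (\<integral>x. x j * x k \<partial>P))"
    if P: "prob_space P" "sets P = sets (Rp p)"
      and P2: "\<And>j. j \<in> {1..p} \<Longrightarrow> integrable P (\<lambda>x. (x j)^2)" for P
  proof -
    interpret P: prob_space P by fact
    have mj: "(\<lambda>x. x j) \<in> borel_measurable P" if "j \<in> {1..p}" for j
      using that measurable_Rp_component[of "\<lambda>x. x" P p j] P(2)
      by (simp add: measurable_cong_sets[OF P(2) refl])
    have "H \<in> borel_measurable P"
      using H_meas by (subst measurable_cong_sets[OF P(2) refl])
    then have HP: "integrable P H"
      using H01 by (intro P.integrable_const_bound[where B=1]) simp_all
    have P1: "integrable P (\<lambda>x. x j)" if "j \<in> {1..p}" for j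
      by (rule P.square_integrable_imp_integrable[OF mj[OF that] P2[OF that]])
    have P11: "integrable P (\<lambda>x. x j * x k)" if jk: "j \<in> {1..p}" "k \<in> {1..p}" for j k
      using mj P2 jk by (intro integrable_mult_of_squares)
    have i1: "integrable P (\<lambda>x. \<Sum>j\<in>{1..p}. a j / s * x j)"
      by (intro Bochner_Integration.integrable_sum Bochner_Integration.integrable_mult_right impI P1)
    have i2: "integrable P (\<lambda>x. \<Sum>j\<in>{1..p}. \<Sum>k\<in>{1..p}. b j k / (2 * s^2) * (x j * x k))"
      by (intro Bochner_Integration.integrable_sum Bochner_Integration.integrable_mult_right impI P11)
    have e1: "(\<integral>x. (\<Sum>j\<in>{1..p}. a j / s * x j) \<partial>P) = (\<Sum>j\<in>{1..p}. a j / s * (\<integral>x. x j \<partial>P))"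
      by (subst Bochner_Integration.integral_sum) (auto intro!: Bochner_Integration.integrable_mult_right P1)
    have e2: "(\<integral>x. (\<Sum>j\<in>{1..p}. \<Sum>k\<in>{1..p}. b j k / (2 * s^2) * (x j * x k)) \<partial>P)
        = (\<Sum>j\<in>{1..p}. \<Sum>k\<in>{1..p}. b j k / (2 * s^2) * (\<integral>x. x j * x k \<partial>P))"
      by (subst integral_sum2) (auto intro!: Bochner_Integration.integrable_mult_right P11)
    have "integrable P R" unfolding R_eq'[abs_def]
      using HP i1 i2 by (intro Bochner_Integration.integrable_diff) auto
    moreover have "(\<integral>x. R x \<partial>P) = (\<integral>x. H x \<partial>P) - c
      - (\<Sum>j\<in>{1..p}. a j / s * (\<integral>x. x j \<partial>P))
      - (\<Sum>j\<in>{1..p}. \<Sum>k\<in>{1..p}. b j k / (2 * s^2) * (\<integral>x. x j * x k \<partial>P))"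
      unfolding R_eq' using HP i1 i2 e1 e2 by (simp add: P.prob_space)
    ultimately show ?thesis by blast
  qed
  have RX: "integrable PX R" and RY: "integrable PY R"
    using main[OF PX X2] main[OF PY Y2] by auto
  have "(\<integral>x. H x \<partial>PX) - (\<integral>x. H x \<partial>PY) = (\<integral>x. R x \<partial>PX) - (\<integral>x. R x \<partial>PY)"
    using main[OF PX X2] main[OF PY Y2] by (simp add: mom1 mom2)
  then have bound: "ennreal \<bar>(\<integral>x. H x \<partial>PX) - (\<integral>x. H x \<partial>PY)\<bar> \<le> (\<integral>\<^sup>+x. ennreal \<bar>R x\<bar> \<partial>Z)"
    using integral_diff_le_tv_measure[OF fin(1) PX(2) fin(2) PY(2) RX RY] unfolding Z by simp

  define d where "d j k l = (\<integral>w. D3 j k l w * indicator annulus w \<partial>PW)" for j k l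
  have d_int: "integrable PW (\<lambda>w. D3 j k l w * indicator annulus w)"
    if jkl: "j \<in> {1..p}" "k \<in> {1..p}" "l \<in> {1..p}" for j k l
  proof (rule PW.integrable_const_bound[where B="C0 * (logep p)^2 / \<epsilon>^3"])
    show "AE w in PW. norm (D3 j k l w * indicator annulus w) \<le> C0 * (logep p)^2 / \<epsilon>^3"
      using D3_bounded[OF _ jkl] D_nonneg(3)[OF jkl] C0 eps
      by (intro AE_I2) (auto simp: spW indicator_def abs_of_nonneg)
    show "(\<lambda>w. D3 j k l w * indicator annulus w) \<in> borel_measurable PW"
      unfolding cong using D3_measurable[OF jkl] annulus_measurable by auto
  qed
  have d_nonneg: "0 \<le> d j k l" if "j \<in> {1..p}" "k \<in> {1..p}" "l \<in> {1..p}" for j k l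
    unfolding d_def by (rule integral_nonneg_AE) (auto simp: D_nonneg(3)[OF that] spW intro!: AE_I2)
  have d_sum: "(\<Sum>j\<in>{1..p}. \<Sum>k\<in>{1..p}. \<Sum>l\<in>{1..p}. d j k l)
      \<le> C0 * (logep p)^2 / \<epsilon>^3 * measure PW annulus"
  proof -
    have "(\<Sum>j\<in>{1..p}. \<Sum>k\<in>{1..p}. \<Sum>l\<in>{1..p}. d j k l)
        = (\<integral>w. (\<Sum>j\<in>{1..p}. \<Sum>k\<in>{1..p}. \<Sum>l\<in>{1..p}. D3 j k l w * indicator annulus w) \<partial>PW)"
      unfolding d_def
      by (subst integral_sum3) (auto intro: d_int)
    also have "\<dots> \<le> (\<integral>w. C0 * (logep p)^2 / \<epsilon>^3 * indicator annulus w \<partial>PW)"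
    proof (rule integral_mono)
      show "integrable PW (\<lambda>w. \<Sum>j\<in>{1..p}. \<Sum>k\<in>{1..p}. \<Sum>l\<in>{1..p}. D3 j k l w * indicator annulus w)"
        by (intro Bochner_Integration.integrable_sum d_int)
      show "integrable PW (\<lambda>w. C0 * (logep p)^2 / \<epsilon>^3 * indicator annulus w)"
        using annulus_measurable PW(2) by (simp add: PW.emeasure_eq_measure)
      fix w assume "w \<in> space PW"
      then show "(\<Sum>j\<in>{1..p}. \<Sum>k\<in>{1..p}. \<Sum>l\<in>{1..p}. D3 j k l w * indicator annulus w)
          \<le> C0 * (logep p)^2 / \<epsilon>^3 * indicator annulus w"
        unfolding sum_distrib_right[symmetric] by (intro mult_right_mono D_sums) (auto simp: spW)
    qed
    also have "\<dots> = C0 * (logep p)^2 / \<epsilon>^3 * measure PW annulus"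
      using annulus_measurable PW(2) sets.sets_into_space[OF annulus_measurable]
      by (simp add: spW Int_absorb2)
    finally show ?thesis .
  qed
  \<comment> \<open>The two regimes: beyond the threshold the second-order bound, below it the third-order one.  Mixed
    third moments are reduced to pure ones by the inequality of arithmetic and geometric means.\<close>
  define \<kappa> where "\<kappa> = exp CC / (6 * s^3)"
  have \<kappa>: "0 \<le> \<kappa>" using s by (simp add: \<kappa>_def)
  define K where "K = C0 * logep p / (\<epsilon>^2 * s^2)"
  have K: "0 \<le> K" using C0 lp by (simp add: K_def)
  let ?big = "{x. vnorm p x \<ge> s * \<epsilon> / logep p}"
  have R_le: "ennreal \<bar>R x\<bar> \<le>
      (\<Sum>j\<in>{1..p}. \<Sum>k\<in>{1..p}. \<Sum>l\<in>{1..p}. ennreal (\<kappa> * d j k l / 3) *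
          (ennreal (\<bar>x j\<bar>^3) + ennreal (\<bar>x k\<bar>^3) + ennreal (\<bar>x l\<bar>^3)))
      + ennreal K * (ennreal ((vnorm p x)^2) * indicator ?big x)" (is "_ \<le> ?S x + ?L x") for x
  proof (cases "x \<in> ?big")
    case True
    have "\<bar>R x\<bar> \<le> (\<integral>w. \<bar>taylor_rem p \<phi> w (sx x)\<bar> \<partial>PW)" unfolding R_def by (rule integral_abs_bound)
    also have "\<dots> \<le> (\<integral>w. C0 * logep p / \<epsilon>^2 * (vnorm p (sx x))^2 \<partial>PW)"
      using taylor_rem_large rem_int by (intro integral_mono integrable_abs) (auto simp: spW)
    also have "\<dots> = K * (vnorm p x)^2"
      by (simp add: PW.prob_space K_def sx_norm power_divide)
    finally have "ennreal \<bar>R x\<bar> \<le> ?L x" using True K by (simp add: ennreal_mult[symmetric] ennreal_leI)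
    then show ?thesis by (rule order_trans) simp
  next
    case False
    then have nx: "vnorm p (sx x) \<le> \<epsilon> / logep p"
      using s lp by (simp add: sx_norm field_simps)
    have "\<bar>R x\<bar> \<le> (\<integral>w. \<bar>taylor_rem p \<phi> w (sx x)\<bar> \<partial>PW)" unfolding R_def by (rule integral_abs_bound)
    also have "\<dots> \<le> (\<integral>w. exp CC / 6 * (\<Sum>j\<in>{1..p}. \<Sum>k\<in>{1..p}. \<Sum>l\<in>{1..p}.
        \<bar>sx x j * sx x k * sx x l\<bar> * (D3 j k l w * indicator annulus w)) \<partial>PW)"
      using taylor_rem_small[OF _ nx] rem_int
      by (intro integral_mono integrable_abs Bochner_Integration.integrable_sum
          Bochner_Integration.integrable_mult_right impI d_int) (auto simp: spW)
    also have "\<dots> = exp CC / 6 * (\<Sum>j\<in>{1..p}. \<Sum>k\<in>{1..p}. \<Sum>l\<in>{1..p}.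
        \<bar>sx x j * sx x k * sx x l\<bar> * d j k l)"
    proof -
      let ?g = "\<lambda>j k l w. \<bar>sx x j * sx x k * sx x l\<bar> * (D3 j k l w * indicator annulus w)"
      have g: "integrable PW (?g j k l)" if "j \<in> {1..p}" "k \<in> {1..p}" "l \<in> {1..p}" for j k l
        by (intro Bochner_Integration.integrable_mult_right impI d_int that)
      have "(\<integral>w. (\<Sum>j\<in>{1..p}. \<Sum>k\<in>{1..p}. \<Sum>l\<in>{1..p}. ?g j k l w) \<partial>PW)
          = (\<Sum>j\<in>{1..p}. \<Sum>k\<in>{1..p}. \<Sum>l\<in>{1..p}. (\<integral>w. ?g j k l w \<partial>PW))"
        using g by (rule integral_sum3)
      then show ?thesis by (simp add: d_def)
    qed
    also have "\<dots> = \<kappa> * (\<Sum>j\<in>{1..p}. \<Sum>k\<in>{1..p}. \<Sum>l\<in>{1..p}. \<bar>x j * x k * x l\<bar> * d j k l)"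
      unfolding \<kappa>_def sum_distrib_left using s
      by (intro sum.cong refl) (simp add: sxj abs_mult power3_eq_cube)
    also have "\<dots> \<le> \<kappa> * (\<Sum>j\<in>{1..p}. \<Sum>k\<in>{1..p}. \<Sum>l\<in>{1..p}.
        (\<bar>x j\<bar>^3 + \<bar>x k\<bar>^3 + \<bar>x l\<bar>^3) / 3 * d j k l)"
      by (intro mult_left_mono sum_mono mult_right_mono abs_prod3_le_mean_cubes d_nonneg \<kappa>)
    also have "\<dots> = (\<Sum>j\<in>{1..p}. \<Sum>k\<in>{1..p}. \<Sum>l\<in>{1..p}. \<kappa> * d j k l / 3 *
          (\<bar>x j\<bar>^3 + \<bar>x k\<bar>^3 + \<bar>x l\<bar>^3))"
      unfolding sum_distrib_left by (intro sum.cong refl) simp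
    finally have "ennreal \<bar>R x\<bar> \<le> ennreal (\<Sum>j\<in>{1..p}. \<Sum>k\<in>{1..p}. \<Sum>l\<in>{1..p}. \<kappa> * d j k l / 3 *
          (\<bar>x j\<bar>^3 + \<bar>x k\<bar>^3 + \<bar>x l\<bar>^3))" by (rule ennreal_leI)
    also have "\<dots> = ?S x"
      by (subst ennreal_sum3) (auto simp: d_nonneg \<kappa> ennreal_mult[symmetric] ennreal_plus[symmetric]
          simp del: ennreal_plus intro!: sum.cong)
    finally show ?thesis by (rule order_trans) simp
  qed
  have cube_meas: "(\<lambda>x. ennreal (\<bar>x j\<bar>^3)) \<in> borel_measurable Z" if "j \<in> {1..p}" for j
    unfolding congZ using that by measurable
  have big_meas: "(\<lambda>x. ennreal ((vnorm p x)^2) * indicator ?big x) \<in> borel_measurable Z"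
  proof -
    note [measurable] = measurable_vnorm_Rp[OF p]
    have "(\<lambda>x. ennreal ((vnorm p x)^2) * indicator {x\<in>space (Rp p). vnorm p x \<ge> s * \<epsilon> / logep p} x)
        \<in> borel_measurable (Rp p)" by measurable
    also have "?this \<longleftrightarrow> (\<lambda>x. ennreal ((vnorm p x)^2) * indicator ?big x) \<in> borel_measurable (Rp p)"
      by (intro measurable_cong) (auto simp: indicator_def)
    finally show ?thesis unfolding congZ .
  qed
  have "(\<integral>\<^sup>+x. ennreal \<bar>R x\<bar> \<partial>Z) \<le> (\<integral>\<^sup>+x. ?S x + ?L x \<partial>Z)"
    by (intro nn_integral_mono R_le)
  also have "\<dots> = (\<Sum>j\<in>{1..p}. \<Sum>k\<in>{1..p}. \<Sum>l\<in>{1..p}. ennreal (\<kappa> * d j k l / 3) *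
          ((\<integral>\<^sup>+x. ennreal (\<bar>x j\<bar>^3) \<partial>Z) + (\<integral>\<^sup>+x. ennreal (\<bar>x k\<bar>^3) \<partial>Z) + (\<integral>\<^sup>+x. ennreal (\<bar>x l\<bar>^3) \<partial>Z)))
      + ennreal K * (\<integral>\<^sup>+x. ennreal ((vnorm p x)^2) * indicator ?big x \<partial>Z)"
  proof -
    let ?q = "\<lambda>j x. ennreal (\<bar>x j\<bar>^3)"
    have S: "(\<integral>\<^sup>+x. ?S x \<partial>Z) = (\<Sum>j\<in>{1..p}. \<Sum>k\<in>{1..p}. \<Sum>l\<in>{1..p}.
        (\<integral>\<^sup>+x. ennreal (\<kappa> * d j k l / 3) * (?q j x + ?q k x + ?q l x) \<partial>Z))"
      by (intro nn_integral_sum3 borel_measurable_times_ennreal borel_measurable_const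
          borel_measurable_add cube_meas)
    also have "\<dots> = (\<Sum>j\<in>{1..p}. \<Sum>k\<in>{1..p}. \<Sum>l\<in>{1..p}. ennreal (\<kappa> * d j k l / 3) *
          ((\<integral>\<^sup>+x. ?q j x \<partial>Z) + (\<integral>\<^sup>+x. ?q k x \<partial>Z) + (\<integral>\<^sup>+x. ?q l x \<partial>Z)))"
    proof (intro sum.cong refl)
      fix j k l assume jkl: "j \<in> {1..p}" "k \<in> {1..p}" "l \<in> {1..p}"
      note q = cube_meas[OF jkl(1)] cube_meas[OF jkl(2)] cube_meas[OF jkl(3)]
      have "(\<integral>\<^sup>+x. ennreal (\<kappa> * d j k l / 3) * (?q j x + ?q k x + ?q l x) \<partial>Z)
          = ennreal (\<kappa> * d j k l / 3) * (\<integral>\<^sup>+x. ?q j x + ?q k x + ?q l x \<partial>Z)"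
        by (intro nn_integral_cmult borel_measurable_add q)
      also have "(\<integral>\<^sup>+x. ?q j x + ?q k x + ?q l x \<partial>Z) = (\<integral>\<^sup>+x. ?q j x + ?q k x \<partial>Z) + (\<integral>\<^sup>+x. ?q l x \<partial>Z)"
        by (intro nn_integral_add borel_measurable_add q)
      also have "(\<integral>\<^sup>+x. ?q j x + ?q k x \<partial>Z) = (\<integral>\<^sup>+x. ?q j x \<partial>Z) + (\<integral>\<^sup>+x. ?q k x \<partial>Z)"
        by (intro nn_integral_add q)
      finally show "(\<integral>\<^sup>+x. ennreal (\<kappa> * d j k l / 3) * (?q j x + ?q k x + ?q l x) \<partial>Z)
        = ennreal (\<kappa> * d j k l / 3) * ((\<integral>\<^sup>+x. ?q j x \<partial>Z) + (\<integral>\<^sup>+x. ?q k x \<partial>Z) + (\<integral>\<^sup>+x. ?q l x \<partial>Z))" .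
    qed
    moreover have "(\<integral>\<^sup>+x. ?S x + ?L x \<partial>Z) = (\<integral>\<^sup>+x. ?S x \<partial>Z) + (\<integral>\<^sup>+x. ?L x \<partial>Z)"
      by (intro nn_integral_add borel_measurable_times_ennreal[OF borel_measurable_const big_meas]
          borel_measurable_sum borel_measurable_times_ennreal borel_measurable_const
          borel_measurable_add cube_meas big_meas)
    moreover have "(\<integral>\<^sup>+x. ?L x \<partial>Z) = ennreal K * (\<integral>\<^sup>+x. ennreal ((vnorm p x)^2) * indicator ?big x \<partial>Z)"
      by (rule nn_integral_cmult[OF big_meas])
    ultimately show ?thesis by simp
  qed
  also have "\<dots> \<le> (\<Sum>j\<in>{1..p}. \<Sum>k\<in>{1..p}. \<Sum>l\<in>{1..p}. ennreal (\<kappa> * d j k l / 3) *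
          (ennreal m + ennreal m + ennreal m)) + ennreal K * ennreal B"
    by (intro add_mono sum_mono mult_left_mono m B) auto
  also have "\<dots> = ennreal ((\<Sum>j\<in>{1..p}. \<Sum>k\<in>{1..p}. \<Sum>l\<in>{1..p}. \<kappa> * d j k l / 3 * (m + m + m)) + K * B)"
  proof -
    have "ennreal (\<Sum>j\<in>{1..p}. \<Sum>k\<in>{1..p}. \<Sum>l\<in>{1..p}. \<kappa> * d j k l / 3 * (m + m + m))
        = (\<Sum>j\<in>{1..p}. \<Sum>k\<in>{1..p}. \<Sum>l\<in>{1..p}. ennreal (\<kappa> * d j k l / 3) *
            (ennreal m + ennreal m + ennreal m))"
      using m(1) by (subst ennreal_sum3) (auto simp: d_nonneg \<kappa> ennreal_mult[symmetric] ennreal_plus[symmetric]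
          simp del: ennreal_plus intro!: sum.cong)
    moreover have "0 \<le> (\<Sum>j\<in>{1..p}. \<Sum>k\<in>{1..p}. \<Sum>l\<in>{1..p}. \<kappa> * d j k l / 3 * (m + m + m))"
      using m(1) \<kappa> by (intro sum_nonneg mult_nonneg_nonneg divide_nonneg_nonneg d_nonneg) auto
    ultimately show ?thesis
      using B(1) K by (subst ennreal_plus) (simp_all only: mult_nonneg_nonneg ennreal_mult)
  qed
  also have "(\<Sum>j\<in>{1..p}. \<Sum>k\<in>{1..p}. \<Sum>l\<in>{1..p}. \<kappa> * d j k l / 3 * (m + m + m))
      = \<kappa> * m * (\<Sum>j\<in>{1..p}. \<Sum>k\<in>{1..p}. \<Sum>l\<in>{1..p}. d j k l)"
    unfolding sum_distrib_left by (intro sum.cong refl) simp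
  finally have "ennreal \<bar>(\<integral>x. H x \<partial>PX) - (\<integral>x. H x \<partial>PY)\<bar>
      \<le> ennreal (\<kappa> * m * (\<Sum>j\<in>{1..p}. \<Sum>k\<in>{1..p}. \<Sum>l\<in>{1..p}. d j k l) + K * B)"
    using bound by (rule order_trans[rotated])
  moreover have nn: "0 \<le> \<kappa> * m * (\<Sum>j\<in>{1..p}. \<Sum>k\<in>{1..p}. \<Sum>l\<in>{1..p}. d j k l) + K * B"
    using m(1) B(1) K \<kappa> by (intro add_nonneg_nonneg mult_nonneg_nonneg sum_nonneg d_nonneg) auto
  ultimately have "\<bar>(\<integral>x. H x \<partial>PX) - (\<integral>x. H x \<partial>PY)\<bar>
      \<le> \<kappa> * m * (\<Sum>j\<in>{1..p}. \<Sum>k\<in>{1..p}. \<Sum>l\<in>{1..p}. d j k l) + K * B"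
    by (simp add: ennreal_le_iff)
  also have "\<dots> \<le> \<kappa> * m * (C0 * (logep p)^2 / \<epsilon>^3 * measure PW annulus) + K * B"
    using m(1) \<kappa> by (intro add_right_mono mult_left_mono d_sum) auto
  also have "\<dots> = exp CC / (6 * s^3) * (C0 * (logep p)^2 / \<epsilon>^3) * measure PW annulus * m
      + C0 * logep p / (\<epsilon>^2 * s^2) * B"
    by (simp add: \<kappa>_def K_def)
  finally show ?thesis unfolding H_def sx_def .
qed

end


section \<open>Centered Gaussian laws and anti-concentration\<close>

context prob_space
begin

lemma centered_normal_distributed:
  assumes A: "A \<in> borel_measurable M" "distr M borel A = centered_normal v" and v: "v > 0"
  shows "distributed M lborel A (normal_density 0 (sqrt v))"
proof -
  have "distr M lborel A = distr M borel A" by (rule distr_cong) auto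
  with A v show ?thesis by (auto simp: distributed_def centered_normal_def)
qed

lemma distributed_centered_normal:
  assumes "distributed M lborel A (normal_density 0 (sqrt v))" and v: "v > 0"
  shows "distr M borel A = centered_normal v"
proof -
  have "distr M lborel A = distr M borel A" by (rule distr_cong) auto
  with assms show ?thesis by (auto simp: distributed_def centered_normal_def)
qed

lemma centered_normal_0_AE:
  assumes A: "A \<in> borel_measurable M" "distr M borel A = centered_normal 0"
  shows "AE \<omega> in M. A \<omega> = 0"
proof -
  have "AE x in return borel (0::real). x = 0" by (simp add: AE_return)
  moreover have "distr M borel A = return borel 0" using A(2) by (simp add: centered_normal_def)
  ultimately have "AE x in distr M borel A. x = 0" by (simp only:)
  then show ?thesis using A(1) by (simp add: AE_distr_iff)
qed

lemma centered_normal_moments: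
  assumes A: "A \<in> borel_measurable M" "distr M borel A = centered_normal v" and v: "v \<ge> 0"
  shows "integrable M (\<lambda>\<omega>. (A \<omega>)^2)" "expectation A = 0" "expectation (\<lambda>\<omega>. (A \<omega>)^2) = v"
proof -
  have "integrable M (\<lambda>\<omega>. (A \<omega>)^2) \<and> expectation A = 0 \<and> expectation (\<lambda>\<omega>. (A \<omega>)^2) = v"
  proof (cases "v = 0")
    case True
    have 0: "AE \<omega> in M. A \<omega> = 0" using centered_normal_0_AE A True by simp
    have "integrable M (\<lambda>\<omega>. (A \<omega>)^2) \<longleftrightarrow> integrable M (\<lambda>\<omega>. 0 :: real)"
      using 0 A(1) by (intro integrable_cong_AE) auto
    moreover have "expectation A = expectation (\<lambda>\<omega>. 0 :: real)"
      using 0 A(1) by (intro integral_cong_AE) auto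
    moreover have "expectation (\<lambda>\<omega>. (A \<omega>)^2) = expectation (\<lambda>\<omega>. 0 :: real)"
      using 0 A(1) by (intro integral_cong_AE) auto
    ultimately show ?thesis using True by simp
  next
    case False
    with v have v: "v > 0" by simp
    have D: "distributed M lborel A (normal_density 0 (sqrt v))"
      by (rule centered_normal_distributed[OF A v])
    have "integrable lborel (\<lambda>x. normal_density 0 (sqrt v) x * x^2)"
      using integrable_normal_moment[of "sqrt v" 0 2] v by simp
    then have "integrable M (\<lambda>\<omega>. (A \<omega>)^2)"
      using distributed_integrable[OF D, of "\<lambda>x. x^2"] by simp
    moreover have "expectation A = 0" by (rule normal_distributed_expectation[OF _ D]) (use v in simp)
    moreover have "variance A = (sqrt v)^2" by (rule normal_distributed_variance[OF _ D]) (use v in simp)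
    ultimately show ?thesis using v by simp
  qed
  then show "integrable M (\<lambda>\<omega>. (A \<omega>)^2)" "expectation A = 0" "expectation (\<lambda>\<omega>. (A \<omega>)^2) = v"
    by auto
qed

text \<open>The degenerate law is a point mass and has no density, so it is treated apart from the convolution
  of normal densities.\<close>

lemma centered_normal_add:
  assumes ind: "indep_var borel A borel B"
    and A: "distr M borel A = centered_normal v" "v \<ge> 0"
    and B: "distr M borel B = centered_normal w" "w \<ge> 0"
  shows "distr M borel (\<lambda>\<omega>. A \<omega> + B \<omega>) = centered_normal (v + w)"
proof -
  have m: "A \<in> borel_measurable M" "B \<in> borel_measurable M"
    using indep_var_rv1[OF ind] indep_var_rv2[OF ind] by auto
  consider "v = 0" | "w = 0" | "v > 0" "w > 0" using A B by linarith
  then show ?thesis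
  proof cases
    case 1
    then have "AE \<omega> in M. A \<omega> = 0" using centered_normal_0_AE m A by simp
    then have "distr M borel (\<lambda>\<omega>. A \<omega> + B \<omega>) = distr M borel B"
      using m by (intro distr_cong_AE) auto
    with B 1 show ?thesis by simp
  next
    case 2
    then have "AE \<omega> in M. B \<omega> = 0" using centered_normal_0_AE m B by simp
    then have "distr M borel (\<lambda>\<omega>. A \<omega> + B \<omega>) = distr M borel A"
      using m by (intro distr_cong_AE) auto
    with A 2 show ?thesis by simp
  next
    case 3
    have "distributed M lborel (\<lambda>\<omega>. A \<omega> + B \<omega>) (normal_density (0 + 0) (sqrt ((sqrt v)^2 + (sqrt w)^2)))"
      using 3 A B m by (intro add_indep_normal ind centered_normal_distributed) auto
    with 3 show ?thesis by (intro distributed_centered_normal) auto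
  qed
qed

lemma centered_normal_sum:
  fixes A :: "'i \<Rightarrow> 'a \<Rightarrow> real"
  assumes "finite I" "indep_vars (\<lambda>_. borel) A I"
    and "\<And>i. i \<in> I \<Longrightarrow> distr M borel (A i) = centered_normal (v i) \<and> v i \<ge> 0"
  shows "distr M borel (\<lambda>\<omega>. \<Sum>i\<in>I. A i \<omega>) = centered_normal (\<Sum>i\<in>I. v i)"
  using assms
proof (induction I rule: finite_induct)
  case empty
  then show ?case by (simp add: centered_normal_def distr_const)
next
  case (insert i I)
  have "indep_vars (\<lambda>_. borel) A I" using insert.prems(1) by (rule indep_vars_subset) auto
  then have IH: "distr M borel (\<lambda>\<omega>. \<Sum>i\<in>I. A i \<omega>) = centered_normal (\<Sum>i\<in>I. v i)"
    using insert by auto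
  have "indep_var borel (A i) borel (\<lambda>\<omega>. \<Sum>i\<in>I. A i \<omega>)"
    using insert by (intro indep_vars_sum) auto
  from centered_normal_add[OF this _ _ IH, of "v i"] insert show ?case
    by (simp add: sum_nonneg)
qed

text \<open>The covariances are recovered from the laws of the linear forms \<open>Y\<^sub>j\<close> and \<open>Y\<^sub>j + Y\<^sub>k\<close> by polarization.
  Positive semidefiniteness comes from \<open>X\<close>; without it \<^const>\<open>centered_normal\<close> would be applied to
  negative variances.\<close>

lemma gaussian_vector_moments:
  assumes X: "\<And>j. j \<in> {1..p} \<Longrightarrow> (\<lambda>\<omega>. X \<omega> j) \<in> borel_measurable M"
      "\<And>j. j \<in> {1..p} \<Longrightarrow> integrable M (\<lambda>\<omega>. (X \<omega> j)^2)"
    and Y: "gaussian_vector p M Y (\<lambda>j k. \<integral>\<omega>. X \<omega> j * X \<omega> k \<partial>M)"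
  shows "\<exists>v\<ge>0. distr M borel (\<lambda>\<omega>. \<Sum>j\<in>{1..p}. a j * Y \<omega> j) = centered_normal v"
    "j \<in> {1..p} \<Longrightarrow> integrable M (\<lambda>\<omega>. (Y \<omega> j)^2)"
    "j \<in> {1..p} \<Longrightarrow> (\<integral>\<omega>. Y \<omega> j \<partial>M) = 0"
    "j \<in> {1..p} \<Longrightarrow> k \<in> {1..p} \<Longrightarrow> (\<integral>\<omega>. Y \<omega> j * Y \<omega> k \<partial>M) = (\<integral>\<omega>. X \<omega> j * X \<omega> k \<partial>M)"
proof -
  have Ym: "(\<lambda>\<omega>. Y \<omega> j) \<in> borel_measurable M" if "j \<in> {1..p}" for j
    using Y that by (auto simp: gaussian_vector_def intro: measurable_Rp_component)
  define V where "V a = (\<integral>\<omega>. (\<Sum>j\<in>{1..p}. a j * X \<omega> j)^2 \<partial>M)" for a :: "nat \<Rightarrow> real"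
  have XX: "integrable M (\<lambda>\<omega>. X \<omega> j * X \<omega> k)" if "j \<in> {1..p}" "k \<in> {1..p}" for j k
    using X that by (intro integrable_mult_of_squares)
  have V0: "V a \<ge> 0" for a unfolding V_def by (intro integral_nonneg_AE) auto
  have Va: "V a = (\<Sum>j\<in>{1..p}. \<Sum>k\<in>{1..p}. a j * a k * (\<integral>\<omega>. X \<omega> j * X \<omega> k \<partial>M))" for a
  proof -
    have "V a = (\<integral>\<omega>. (\<Sum>j\<in>{1..p}. \<Sum>k\<in>{1..p}. (a j * a k) * (X \<omega> j * X \<omega> k)) \<partial>M)"
      unfolding V_def power2_eq_square sum_product
      by (intro Bochner_Integration.integral_cong refl sum.cong) (simp add: ac_simps)
    also have "\<dots> = (\<Sum>j\<in>{1..p}. \<Sum>k\<in>{1..p}. (\<integral>\<omega>. (a j * a k) * (X \<omega> j * X \<omega> k) \<partial>M))"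
      by (intro integral_sum2 Bochner_Integration.integrable_mult_right impI XX)
    finally show ?thesis by simp
  qed
  have D: "distr M borel (\<lambda>\<omega>. \<Sum>j\<in>{1..p}. a j * Y \<omega> j) = centered_normal (V a)" for a
    using Y unfolding Va gaussian_vector_def by blast
  show "\<exists>v\<ge>0. distr M borel (\<lambda>\<omega>. \<Sum>j\<in>{1..p}. a j * Y \<omega> j) = centered_normal v"
    using D V0 by blast
  have single: "(\<Sum>i\<in>{1..p}. (if i = j then 1 else 0) * f i) = f j" if "j \<in> {1..p}" for j and f :: "nat \<Rightarrow> real"
    using that by (simp add: if_distrib[where f="\<lambda>x. x * _"] cong: if_cong)
  have D1: "distr M borel (\<lambda>\<omega>. Y \<omega> j) = centered_normal (\<integral>\<omega>. (X \<omega> j)^2 \<partial>M)" if "j \<in> {1..p}" for j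
    using D[of "\<lambda>i. if i = j then 1 else 0"] that unfolding V_def by (simp only: single)
  have pair: "(\<Sum>i\<in>{1..p}. ((if i = j then 1 else 0) + (if i = k then 1 else 0)) * f i) = f j + f k"
    if "j \<in> {1..p}" "k \<in> {1..p}" for j k and f :: "nat \<Rightarrow> real"
    using that by (simp only: distrib_right sum.distrib single)
  have D2: "distr M borel (\<lambda>\<omega>. Y \<omega> j + Y \<omega> k) = centered_normal (\<integral>\<omega>. (X \<omega> j + X \<omega> k)^2 \<partial>M)"
    if "j \<in> {1..p}" "k \<in> {1..p}" for j k
    using D[of "\<lambda>i. (if i = j then 1 else 0) + (if i = k then 1 else 0)"] that
    unfolding V_def by (simp only: pair)
  have nn: "0 \<le> (\<integral>\<omega>. (f \<omega>)^2 \<partial>M)" for f :: "_ \<Rightarrow> real"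
    by (rule integral_nonneg_AE) auto
  note m1 = centered_normal_moments[OF Ym D1 nn]
  show Y2: "j \<in> {1..p} \<Longrightarrow> integrable M (\<lambda>\<omega>. (Y \<omega> j)^2)" for j using m1(1) by blast
  show "j \<in> {1..p} \<Longrightarrow> (\<integral>\<omega>. Y \<omega> j \<partial>M) = 0" using m1(2) by blast
  assume jk: "j \<in> {1..p}" "k \<in> {1..p}"
  have YY: "integrable M (\<lambda>\<omega>. Y \<omega> j * Y \<omega> k)" if "j \<in> {1..p}" "k \<in> {1..p}" for j k
    using Ym Y2 that by (intro integrable_mult_of_squares)
  have "(\<integral>\<omega>. (Y \<omega> j + Y \<omega> k)^2 \<partial>M) = (\<integral>\<omega>. (X \<omega> j + X \<omega> k)^2 \<partial>M)"
    using centered_normal_moments(3)[OF borel_measurable_add[OF Ym Ym] D2 nn] jk by blast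
  moreover have "(\<integral>\<omega>. (Y \<omega> j + Y \<omega> k)^2 \<partial>M)
      = (\<integral>\<omega>. (Y \<omega> j)^2 \<partial>M) + (\<integral>\<omega>. (Y \<omega> k)^2 \<partial>M) + 2 * (\<integral>\<omega>. Y \<omega> j * Y \<omega> k \<partial>M)"
    unfolding power2_sum using Y2[OF jk(1)] Y2[OF jk(2)] YY[OF jk] by (simp add: mult.assoc)
  moreover have "(\<integral>\<omega>. (X \<omega> j + X \<omega> k)^2 \<partial>M)
      = (\<integral>\<omega>. (X \<omega> j)^2 \<partial>M) + (\<integral>\<omega>. (X \<omega> k)^2 \<partial>M) + 2 * (\<integral>\<omega>. X \<omega> j * X \<omega> k \<partial>M)"
    unfolding power2_sum using X(2)[OF jk(1)] X(2)[OF jk(2)] XX[OF jk] by (simp add: mult.assoc)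
  ultimately show "(\<integral>\<omega>. Y \<omega> j * Y \<omega> k \<partial>M) = (\<integral>\<omega>. X \<omega> j * X \<omega> k \<partial>M)"
    using m1(3)[OF jk(1) jk(1)] m1(3)[OF jk(2) jk(2)] by simp
qed

text \<open>A Gaussian vector is a Gaussian process on the finite, hence compact, subset \<open>{1, \<dots>, p}\<close> of the
  line, on which every path is continuous.\<close>

lemma anti_concentration:
  assumes AC: "AC_constant \<Theta>" and p: "p \<ge> 1"
    and V: "V \<in> M \<rightarrow>\<^sub>M Rp p"
      "\<And>a. \<exists>v\<ge>0. distr M borel (\<lambda>\<omega>. \<Sum>j\<in>{1..p}. a j * V \<omega> j) = centered_normal v"
    and med: "is_median M (\<lambda>\<omega>. vnorm p (V \<omega>)) \<mu>"
    and \<sigma>max: "\<sigma>max = sqrt (Max ((\<lambda>j. variance (\<lambda>\<omega>. V \<omega> j)) ` {1..p}))"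
    and \<sigma>min: "\<sigma>min = sqrt (Min ((\<lambda>j. variance (\<lambda>\<omega>. V \<omega> j)) ` {1..p}))" "\<sigma>min > 0"
    and r: "r \<ge> 0" and e: "e \<ge> 0"
  shows "measure M {\<omega>\<in>space M. r - e \<le> vnorm p (V \<omega>) \<and> vnorm p (V \<omega>) \<le> r + e}
    \<le> Phi_AC \<Theta> \<mu> \<sigma>max \<sigma>min * e"
proof -
  define S where "S = real ` {1..p}"
  have S: "finite S" "S \<noteq> {}" using p by (auto simp: S_def)
  define T where "T = submetric euclidean_metric S"
  have mT: "mspace T = S" by (simp add: T_def)
  have topT: "mtopology_of T = top_of_set S" by (simp add: T_def mtopology_of_submetric)
  \<comment> \<open>The law of \<open>V\<close>, carried over to the space of paths indexed by \<open>S\<close>.\<close>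
  define emb where "emb \<omega> = (\<lambda>t\<in>S. V \<omega> (nat \<lfloor>t\<rfloor>))" for \<omega>
  let ?PS = "Pi\<^sub>M S (\<lambda>_. borel :: real measure)"
  have Vm: "(\<lambda>\<omega>. V \<omega> j) \<in> borel_measurable M" if "j \<in> {1..p}" for j
    by (rule measurable_Rp_component[OF V(1) that])
  have emb: "emb \<in> M \<rightarrow>\<^sub>M ?PS"
    unfolding emb_def by (rule measurable_restrict) (auto simp: S_def intro!: Vm)
  define N where "N = distr M ?PS emb"
  interpret N: prob_space N unfolding N_def by (rule prob_space_distr[OF emb])
  define Y where "Y t f = f t" for t :: real and f :: "real \<Rightarrow> real"
  have Ym: "Y t \<in> borel_measurable ?PS" if "t \<in> S" for t
    unfolding Y_def[abs_def] using that by simp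
  have Sup_Max: "(SUP t\<in>S. \<bar>Y t f\<bar>) = Max ((\<lambda>t. \<bar>Y t f\<bar>) ` S)" for f
    using S by (intro cSup_eq_Max) auto
  have Sup_m: "(\<lambda>f. SUP t\<in>S. \<bar>Y t f\<bar>) \<in> borel_measurable ?PS"
    unfolding Sup_Max using S Ym by (intro borel_measurable_Max) auto
  have Sup_emb: "(SUP t\<in>S. \<bar>Y t (emb \<omega>)\<bar>) = vnorm p (V \<omega>)" for \<omega>
    unfolding Sup_Max vnorm_def by (rule arg_cong[where f=Max]) (force simp: Y_def emb_def S_def)
  have meas: "measure N {f\<in>space N. Q (SUP t\<in>S. \<bar>Y t f\<bar>)} = measure M {\<omega>\<in>space M. Q (vnorm p (V \<omega>))}"
    if "Measurable.pred borel Q" for Q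
  proof -
    have "{f\<in>space ?PS. Q (SUP t\<in>S. \<bar>Y t f\<bar>)} \<in> sets ?PS"
      using measurable_compose[OF Sup_m that] by (simp add: pred_def)
    then have "measure N {f\<in>space ?PS. Q (SUP t\<in>S. \<bar>Y t f\<bar>)}
        = measure M (emb -` {f\<in>space ?PS. Q (SUP t\<in>S. \<bar>Y t f\<bar>)} \<inter> space M)"
      unfolding N_def by (rule measure_distr[OF emb])
    also have "emb -` {f\<in>space ?PS. Q (SUP t\<in>S. \<bar>Y t f\<bar>)} \<inter> space M
        = {\<omega>\<in>space M. Q (vnorm p (V \<omega>))}"
      using measurable_space[OF emb] by (auto simp: Sup_emb)
    finally show ?thesis by (simp add: N_def)
  qed
  have gp: "centered_gaussian_process N S Y"
    unfolding centered_gaussian_process_def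
  proof (intro conjI ballI allI impI)
    show "Y t \<in> borel_measurable N" if "t \<in> S" for t using Ym[OF that] by (simp add: N_def)
    fix F and a :: "real \<Rightarrow> real" assume F: "finite F \<and> F \<subseteq> S"
    have "(\<lambda>f. \<Sum>t\<in>F. a t * Y t f) \<in> borel_measurable ?PS"
      using F by (intro borel_measurable_sum borel_measurable_times borel_measurable_const Ym) auto
    then have "distr N borel (\<lambda>f. \<Sum>t\<in>F. a t * Y t f) = distr M borel (\<lambda>\<omega>. \<Sum>t\<in>F. a t * Y t (emb \<omega>))"
      unfolding N_def using emb by (subst distr_distr) (auto simp: o_def)
    also have "(\<lambda>\<omega>. \<Sum>t\<in>F. a t * Y t (emb \<omega>))
        = (\<lambda>\<omega>. \<Sum>j\<in>{1..p}. (if real j \<in> F then a (real j) else 0) * V \<omega> j)"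
    proof
      fix \<omega>
      have "(\<Sum>j\<in>{1..p}. (if real j \<in> F then a (real j) else 0) * V \<omega> j)
          = (\<Sum>t\<in>S. (if t \<in> F then a t else 0) * V \<omega> (nat \<lfloor>t\<rfloor>))"
        unfolding S_def by (subst sum.reindex) (auto simp: inj_on_def)
      also have "\<dots> = (\<Sum>t\<in>F. (if t \<in> F then a t else 0) * V \<omega> (nat \<lfloor>t\<rfloor>))"
        using F S by (intro sum.mono_neutral_right) auto
      also have "\<dots> = (\<Sum>t\<in>F. a t * Y t (emb \<omega>))"
        using F by (intro sum.cong) (auto simp: Y_def emb_def)
      finally show "(\<Sum>t\<in>F. a t * Y t (emb \<omega>))
        = (\<Sum>j\<in>{1..p}. (if real j \<in> F then a (real j) else 0) * V \<omega> j)" by simp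
    qed
    finally show "\<exists>v\<ge>0. distr N borel (\<lambda>\<omega>. \<Sum>t\<in>F. a t * Y t \<omega>) = centered_normal v"
      using V(2) by metis
  qed
  have var: "prob_space.variance N (Y t) = variance (\<lambda>\<omega>. V \<omega> (nat \<lfloor>t\<rfloor>))" if t: "t \<in> S" for t
  proof -
    have e: "N.expectation (Y t) = expectation (\<lambda>\<omega>. V \<omega> (nat \<lfloor>t\<rfloor>))"
      unfolding N_def using t Ym[OF t] by (subst integral_distr[OF emb]) (auto simp: Y_def emb_def)
    have "(\<lambda>f. (Y t f - N.expectation (Y t))^2) \<in> borel_measurable ?PS"
      using Ym[OF t] by auto
    then have "N.variance (Y t) = expectation (\<lambda>\<omega>. (Y t (emb \<omega>) - N.expectation (Y t))^2)"
      unfolding N_def by (subst integral_distr[OF emb]) auto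
    then show ?thesis using t unfolding e by (simp add: Y_def emb_def)
  qed
  have im: "(\<lambda>t. prob_space.variance N (Y t)) ` S = (\<lambda>j. variance (\<lambda>\<omega>. V \<omega> j)) ` {1..p}"
  proof -
    have "(\<lambda>t. prob_space.variance N (Y t)) ` S = (\<lambda>t. variance (\<lambda>\<omega>. V \<omega> (nat \<lfloor>t\<rfloor>))) ` S"
      by (intro image_cong refl var)
    then show ?thesis by (simp add: S_def image_image)
  qed
  have SUPv: "(SUP t\<in>S. prob_space.variance N (Y t)) = Max ((\<lambda>j. variance (\<lambda>\<omega>. V \<omega> j)) ` {1..p})"
    unfolding im using p by (intro cSup_eq_Max) auto
  have INFv: "(INF t\<in>S. prob_space.variance N (Y t)) = Min ((\<lambda>j. variance (\<lambda>\<omega>. V \<omega> j)) ` {1..p})"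
    unfolding im using p by (intro cInf_eq_Min) auto
  have med': "is_median N (\<lambda>\<omega>. SUP t\<in>mspace T. \<bar>Y t \<omega>\<bar>) \<mu>"
    using med meas[of "\<lambda>x. x \<le> \<mu>"] meas[of "\<lambda>x. \<mu> \<le> x"] unfolding is_median_def mT by simp
  have "(SUP r\<in>{0..}. measure N {\<omega>\<in>space N.
                r - e \<le> (SUP t\<in>mspace T. \<bar>Y t \<omega>\<bar>) \<and> (SUP t\<in>mspace T. \<bar>Y t \<omega>\<bar>) \<le> r + e})
           \<le> Phi_AC \<Theta> \<mu> \<sigma>max \<sigma>min * e"
  proof -
    have "mspace T \<noteq> {} \<and> compact_space (mtopology_of T) \<and>
        prob_space N \<and> centered_gaussian_process N (mspace T) Y \<and>
        (\<forall>\<omega>\<in>space N. continuous_map (mtopology_of T) euclideanreal (\<lambda>t. Y t \<omega>)) \<and>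
        is_median N (\<lambda>\<omega>. SUP t\<in>mspace T. \<bar>Y t \<omega>\<bar>) \<mu> \<and>
        \<sigma>max = sqrt (SUP t\<in>mspace T. prob_space.variance N (Y t)) \<and>
        \<sigma>min = sqrt (INF t\<in>mspace T. prob_space.variance N (Y t)) \<and>
        \<sigma>min > 0"
    proof (intro conjI ballI)
      show "mspace T \<noteq> {}" using S by (simp add: mT)
      show "compact_space (mtopology_of T)"
        unfolding topT using S by (simp add: compact_space_subtopology finite_imp_compact)
      show "prob_space N" by (rule N.prob_space_axioms)
      show "centered_gaussian_process N (mspace T) Y" unfolding mT by (rule gp)
      show "continuous_map (mtopology_of T) euclideanreal (\<lambda>t. Y t \<omega>)" for \<omega>
        unfolding topT continuous_map_iff_continuous using S by (intro continuous_on_finite) 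
      show "\<sigma>max = sqrt (SUP t\<in>mspace T. prob_space.variance N (Y t))" unfolding mT SUPv by (rule \<sigma>max)
      show "\<sigma>min = sqrt (INF t\<in>mspace T. prob_space.variance N (Y t))" unfolding mT INFv by (rule \<sigma>min)
    qed (fact med' \<sigma>min)+
    with AC e show ?thesis unfolding AC_constant_def by blast
  qed
  moreover have "measure N {\<omega>\<in>space N.
                r - e \<le> (SUP t\<in>mspace T. \<bar>Y t \<omega>\<bar>) \<and> (SUP t\<in>mspace T. \<bar>Y t \<omega>\<bar>) \<le> r + e}
       \<le> (SUP r\<in>{0..}. measure N {\<omega>\<in>space N.
                r - e \<le> (SUP t\<in>mspace T. \<bar>Y t \<omega>\<bar>) \<and> (SUP t\<in>mspace T. \<bar>Y t \<omega>\<bar>) \<le> r + e})"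
    using r by (intro cSUP_upper bdd_aboveI[where M=1]) auto
  ultimately show ?thesis using meas[of "\<lambda>x. r - e \<le> x \<and> x \<le> r + e"] unfolding mT by simp
qed

end


section \<open>The interpolating sums\<close>

lemma (in prob_space) expectation_of_independent_pair:
  assumes ind: "indep_var S V T W" and f: "f \<in> borel_measurable (S \<Otimes>\<^sub>M T)"
    and b: "\<And>x w. x \<in> space S \<Longrightarrow> w \<in> space T \<Longrightarrow> \<bar>f (x, w)\<bar> \<le> (1::real)"
  shows "expectation (\<lambda>\<omega>. f (V \<omega>, W \<omega>)) = (\<integral>x. (\<integral>w. f (x, w) \<partial>distr M T W) \<partial>distr M S V)"
proof -
  have V: "V \<in> M \<rightarrow>\<^sub>M S" and W: "W \<in> M \<rightarrow>\<^sub>M T"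
    and eq: "distr M S V \<Otimes>\<^sub>M distr M T W = distr M (S \<Otimes>\<^sub>M T) (\<lambda>x. (V x, W x))"
    using ind unfolding indep_var_distribution_eq by auto
  interpret V: prob_space "distr M S V" by (rule prob_space_distr[OF V])
  interpret W: prob_space "distr M T W" by (rule prob_space_distr[OF W])
  interpret VW: pair_prob_space "distr M S V" "distr M T W" ..
  have "expectation (\<lambda>\<omega>. f (V \<omega>, W \<omega>)) = (\<integral>z. f z \<partial>(distr M S V \<Otimes>\<^sub>M distr M T W))"
    unfolding eq using V W f by (subst integral_distr) auto
  also have "\<dots> = (\<integral>x. (\<integral>w. f (x, w) \<partial>distr M T W) \<partial>distr M S V)"
  proof (rule VW.integral_fst'[symmetric], rule VW.P.integrable_const_bound[where B=1])
    show "AE z in distr M S V \<Otimes>\<^sub>M distr M T W. norm (f z) \<le> 1"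
      using b by (intro AE_I2) (auto simp: space_pair_measure)
    show "f \<in> borel_measurable (distr M S V \<Otimes>\<^sub>M distr M T W)"
      using f by (simp cong: measurable_cong_sets sets_pair_measure_cong)
  qed
  finally show ?thesis .
qed

lemma median_nonneg:
  assumes "is_median N Z m" "\<And>\<omega>. (0::real) \<le> Z \<omega>"
  shows "0 \<le> m"
proof (rule ccontr)
  assume "\<not> 0 \<le> m"
  then have "{\<omega>\<in>space N. Z \<omega> \<le> m} = {}"
    using assms(2) by (auto simp: not_le intro: less_le_trans)
  then have "measure N {\<omega>\<in>space N. Z \<omega> \<le> m} = 0" by (simp only: measure_empty)
  moreover have "measure N {\<omega>\<in>space N. Z \<omega> \<le> m} \<ge> 1/2" using assms(1) by (simp add: is_median_def)
  ultimately show False by linarith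
qed

locale lindeberg = prob_space M for M :: "'w measure" +
  fixes n p :: nat and X Y :: "nat \<Rightarrow> 'w \<Rightarrow> nat \<Rightarrow> real"
  assumes n: "n \<ge> 1" and p: "p \<ge> 1"
    and indep: "indep_vars (\<lambda>_. Rp p) (case_sum X Y) ({1..n} <+> {1..n})"
    and X2: "\<And>i j. i \<in> {1..n} \<Longrightarrow> j \<in> {1..p} \<Longrightarrow> integrable M (\<lambda>\<omega>. (X i \<omega> j)^2)"
    and X1: "\<And>i j. i \<in> {1..n} \<Longrightarrow> j \<in> {1..p} \<Longrightarrow> (\<integral>\<omega>. X i \<omega> j \<partial>M) = 0"
    and gauss: "\<And>i. i \<in> {1..n} \<Longrightarrow> gaussian_vector p M (Y i) (\<lambda>j k. \<integral>\<omega>. X i \<omega> j * X i \<omega> k \<partial>M)"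
begin

lemma X_measurable: "i \<in> {1..n} \<Longrightarrow> X i \<in> M \<rightarrow>\<^sub>M Rp p"
  and Y_measurable: "i \<in> {1..n} \<Longrightarrow> Y i \<in> M \<rightarrow>\<^sub>M Rp p"
proof -
  assume i: "i \<in> {1..n}"
  have "case_sum X Y z \<in> M \<rightarrow>\<^sub>M Rp p" if "z \<in> {1..n} <+> {1..n}" for z
    using indep that unfolding indep_vars_def by blast
  from this[OF InlI[OF i]] this[OF InrI[OF i]]
  show "X i \<in> M \<rightarrow>\<^sub>M Rp p" "Y i \<in> M \<rightarrow>\<^sub>M Rp p" by simp_all
qed

lemma X_component: "i \<in> {1..n} \<Longrightarrow> j \<in> {1..p} \<Longrightarrow> (\<lambda>\<omega>. X i \<omega> j) \<in> borel_measurable M"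
  and Y_component: "i \<in> {1..n} \<Longrightarrow> j \<in> {1..p} \<Longrightarrow> (\<lambda>\<omega>. Y i \<omega> j) \<in> borel_measurable M"
  by (blast intro: measurable_Rp_component X_measurable Y_measurable)+

lemma U_measurable:
  assumes "k \<le> n" shows "U p n X Y k \<in> M \<rightarrow>\<^sub>M Rp p"
  unfolding U_def[abs_def]
  using assms
  by (intro measurable_restrict borel_measurable_divide borel_measurable_add borel_measurable_sum
      X_component Y_component borel_measurable_const) auto

lemma norm_U_measurable: "k \<le> n \<Longrightarrow> (\<lambda>\<omega>. vnorm p (U p n X Y k \<omega>)) \<in> borel_measurable M"
  by (rule measurable_compose[OF U_measurable measurable_vnorm_Rp[OF p]])

text \<open>The part common to \<open>U\<^sub>i\<close> and \<open>U\<^sub>i\<^sub>-\<^sub>1\<close>.\<close>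

definition W :: "nat \<Rightarrow> 'w \<Rightarrow> nat \<Rightarrow> real" where
  "W i \<omega> = (\<lambda>j\<in>{1..p}. ((\<Sum>l\<in>{1..<i}. X l \<omega> j) + (\<Sum>l\<in>{i+1..n}. Y l \<omega> j)) / sqrt (real n))"

lemma U_eq_W_X:
  assumes "i \<in> {1..n}"
  shows "U p n X Y i \<omega> = vadd p (W i \<omega>) (\<lambda>j\<in>{1..p}. X i \<omega> j / sqrt (real n))"
proof -
  have "{1..i} = insert i {1..<i}" using assms by auto
  then show ?thesis
    by (auto simp: U_def vadd_def W_def restrict_def add_divide_distrib)
qed

lemma U_eq_W_Y:
  assumes "i \<in> {1..n}"
  shows "U p n X Y (i - 1) \<omega> = vadd p (W i \<omega>) (\<lambda>j\<in>{1..p}. Y i \<omega> j / sqrt (real n))"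
proof -
  have "{i - 1 + 1..n} = insert i {i+1..n}" "{1..i - 1} = {1..<i}" using assms by auto
  then show ?thesis
    by (auto simp: U_def vadd_def W_def restrict_def add_divide_distrib)
qed

lemma W_independent:
  assumes i: "i \<in> {1..n}"
  shows "indep_var (Rp p) (X i) (Rp p) (W i)" "indep_var (Rp p) (Y i) (Rp p) (W i)"
proof -
  define A where "A = Inl ` {1..<i} \<union> (Inr ` {i+1..n} :: (nat + nat) set)"
  define G where "G f = (\<lambda>j\<in>{1..p}. ((\<Sum>l\<in>{1..<i}. f (Inl l) j) + (\<Sum>l\<in>{i+1..n}. f (Inr l) j))
      / sqrt (real n))" for f :: "nat + nat \<Rightarrow> nat \<Rightarrow> real"
  have c: "(\<lambda>f. f z j) \<in> borel_measurable (Pi\<^sub>M A (\<lambda>_. Rp p))" if "z \<in> A" "j \<in> {1..p}" for z j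
  proof (rule measurable_Rp_component[OF _ that(2)])
    show "(\<lambda>f. f z) \<in> Pi\<^sub>M A (\<lambda>_. Rp p) \<rightarrow>\<^sub>M Rp p"
      using that(1) by (rule measurable_component_singleton)
  qed
  have G: "G \<in> Pi\<^sub>M A (\<lambda>_. Rp p) \<rightarrow>\<^sub>M Rp p"
    unfolding G_def[abs_def]
    by (intro measurable_restrict borel_measurable_divide borel_measurable_add borel_measurable_sum
        c borel_measurable_const) (auto simp: A_def)
  have GW: "G \<circ> (\<lambda>\<omega>. \<lambda>z\<in>A. case_sum X Y z \<omega>) = W i"
    unfolding G_def[abs_def] W_def[abs_def] o_def
    by (intro ext restrict_ext arg_cong2[where f="(/)"] arg_cong2[where f="(+)"] sum.cong refl)
      (auto simp: A_def)
  have ind: "indep_var (Rp p) (case_sum X Y z) (Rp p) (W i)"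
    if z: "z \<in> {1..n} <+> {1..n}" "z \<notin> A" for z
  proof -
    have "indep_var (Pi\<^sub>M {z} (\<lambda>_. Rp p)) (\<lambda>\<omega>. \<lambda>z\<in>{z}. case_sum X Y z \<omega>)
        (Pi\<^sub>M A (\<lambda>_. Rp p)) (\<lambda>\<omega>. \<lambda>z\<in>A. case_sum X Y z \<omega>)"
      using z i by (intro indep_var_restrict[OF indep]) (auto simp: A_def)
    moreover have "(\<lambda>f. f z) \<in> Pi\<^sub>M {z} (\<lambda>_. Rp p) \<rightarrow>\<^sub>M Rp p" by simp
    ultimately have "indep_var (Rp p) ((\<lambda>f. f z) \<circ> (\<lambda>\<omega>. \<lambda>z\<in>{z}. case_sum X Y z \<omega>)) (Rp p) (W i)"
      unfolding GW[symmetric] using G by (rule indep_var_compose)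
    then show ?thesis by (simp add: o_def)
  qed
  have notin: "Inl i \<notin> A" "Inr i \<notin> A" by (auto simp: A_def)
  show "indep_var (Rp p) (X i) (Rp p) (W i)" using ind[OF InlI[OF i] notin(1)] by simp
  show "indep_var (Rp p) (Y i) (Rp p) (W i)" using ind[OF InrI[OF i] notin(2)] by simp
qed

lemma Y_indep_vars:
  assumes "\<And>i. i \<in> {1..n} \<Longrightarrow> h i \<in> borel_measurable (Rp p)"
  shows "indep_vars (\<lambda>_. borel) (\<lambda>i \<omega>. h i (Y i \<omega>) :: real) {1..n}"
proof -
  have "indep_vars (\<lambda>i. Pi\<^sub>M {Inr i} (\<lambda>_. Rp p)) (\<lambda>i \<omega>. \<lambda>z\<in>{Inr i}. case_sum X Y z \<omega>) {1..n}"
    by (rule indep_vars_restrict[OF indep]) (auto simp: disjoint_family_on_def)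
  moreover have "(\<lambda>f. h i (f (Inr i))) \<in> borel_measurable (Pi\<^sub>M {Inr i} (\<lambda>_. Rp p))"
    if "i \<in> {1..n}" for i
    by (rule measurable_compose[OF _ assms[OF that]]) simp
  ultimately have "indep_vars (\<lambda>_. borel)
      (\<lambda>i \<omega>. h i ((\<lambda>z\<in>{Inr i}. case_sum X Y z \<omega>) (Inr i))) {1..n}"
    by (rule indep_vars_compose2)
  then show ?thesis by simp
qed

lemma Y_moments:
  assumes i: "i \<in> {1..n}"
  shows "\<exists>v\<ge>0. distr M borel (\<lambda>\<omega>. \<Sum>j\<in>{1..p}. a j * Y i \<omega> j) = centered_normal v"
    "j \<in> {1..p} \<Longrightarrow> integrable M (\<lambda>\<omega>. (Y i \<omega> j)^2)"
    "j \<in> {1..p} \<Longrightarrow> (\<integral>\<omega>. Y i \<omega> j \<partial>M) = 0"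
    "j \<in> {1..p} \<Longrightarrow> k \<in> {1..p} \<Longrightarrow>
      (\<integral>\<omega>. Y i \<omega> j * Y i \<omega> k \<partial>M) = (\<integral>\<omega>. X i \<omega> j * X i \<omega> k \<partial>M)"
  by (rule gaussian_vector_moments[OF X_component[OF i] X2[OF i] gauss[OF i]]; assumption)+

lemma U0_gaussian:
  "\<exists>v\<ge>0. distr M borel (\<lambda>\<omega>. \<Sum>j\<in>{1..p}. a j * U p n X Y 0 \<omega> j) = centered_normal v"
proof -
  let ?b = "\<lambda>j. a j / sqrt (real n)"
  have "\<forall>i\<in>{1..n}. \<exists>v\<ge>0. distr M borel (\<lambda>\<omega>. \<Sum>j\<in>{1..p}. ?b j * Y i \<omega> j) = centered_normal v"
    using Y_moments(1)[where a="?b"] by blast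
  then obtain v where v: "\<And>i. i \<in> {1..n} \<Longrightarrow>
      distr M borel (\<lambda>\<omega>. \<Sum>j\<in>{1..p}. ?b j * Y i \<omega> j) = centered_normal (v i) \<and> v i \<ge> 0"
    by metis
  have "(\<lambda>x. \<Sum>j\<in>{1..p}. ?b j * x j) \<in> borel_measurable (Rp p)"
    by (intro borel_measurable_sum borel_measurable_times borel_measurable_const) auto
  then have "indep_vars (\<lambda>_. borel) (\<lambda>i \<omega>. \<Sum>j\<in>{1..p}. ?b j * Y i \<omega> j) {1..n}"
    by (intro Y_indep_vars)
  from centered_normal_sum[OF _ this v]
  have "distr M borel (\<lambda>\<omega>. \<Sum>i\<in>{1..n}. \<Sum>j\<in>{1..p}. ?b j * Y i \<omega> j)
      = centered_normal (\<Sum>i\<in>{1..n}. v i)" by simp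
  also have "(\<lambda>\<omega>. \<Sum>i\<in>{1..n}. \<Sum>j\<in>{1..p}. ?b j * Y i \<omega> j)
      = (\<lambda>\<omega>. \<Sum>j\<in>{1..p}. a j * U p n X Y 0 \<omega> j)"
  proof
    fix \<omega>
    have "(\<Sum>i\<in>{1..n}. \<Sum>j\<in>{1..p}. ?b j * Y i \<omega> j) = (\<Sum>j\<in>{1..p}. \<Sum>i\<in>{1..n}. ?b j * Y i \<omega> j)"
      by (rule sum.swap)
    also have "\<dots> = (\<Sum>j\<in>{1..p}. a j * U p n X Y 0 \<omega> j)"
      by (intro sum.cong refl) (simp add: U_def sum_distrib_left sum_divide_distrib)
    finally show "(\<Sum>i\<in>{1..n}. \<Sum>j\<in>{1..p}. ?b j * Y i \<omega> j)
      = (\<Sum>j\<in>{1..p}. a j * U p n X Y 0 \<omega> j)" .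
  qed
  finally show ?thesis using v by (intro exI[of _ "\<Sum>i\<in>{1..n}. v i"]) (auto intro: sum_nonneg)
qed

definition F :: "nat \<Rightarrow> real \<Rightarrow> real" where
  "F k s = prob {\<omega>\<in>space M. vnorm p (U p n X Y k \<omega>) \<le> s}"

lemma F_set: "k \<le> n \<Longrightarrow> {\<omega>\<in>space M. vnorm p (U p n X Y k \<omega>) \<le> s} \<in> events"
  using norm_U_measurable by measurable

lemma F_neg: "s < 0 \<Longrightarrow> F k s = 0"
proof -
  assume "s < 0"
  then have "{\<omega>\<in>space M. vnorm p (U p n X Y k \<omega>) \<le> s} = {}"
    using vnorm_nonneg[OF p] by (auto simp: not_le intro: less_le_trans)
  then show ?thesis by (simp only: F_def measure_empty)
qed

lemma F_increment_le:
  assumes k: "k \<le> n" and "a \<le> b" "c \<le> a" "b \<le> d"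
  shows "F k b - F k a \<le> prob {\<omega>\<in>space M. c \<le> vnorm p (U p n X Y k \<omega>) \<and> vnorm p (U p n X Y k \<omega>) \<le> d}"
proof -
  have "F k b - F k a = prob ({\<omega>\<in>space M. vnorm p (U p n X Y k \<omega>) \<le> b}
        - {\<omega>\<in>space M. vnorm p (U p n X Y k \<omega>) \<le> a})"
    unfolding F_def using assms by (intro finite_measure_Diff[symmetric] F_set) auto
  also have "\<dots> \<le> prob {\<omega>\<in>space M. c \<le> vnorm p (U p n X Y k \<omega>) \<and> vnorm p (U p n X Y k \<omega>) \<le> d}"
    using norm_U_measurable[OF k] assms by (intro finite_measure_mono) auto
  finally show ?thesis .
qed

lemma F_diff_le_delta0:
  assumes "k \<le> n" shows "\<bar>F k s - F 0 s\<bar> \<le> delta0 p n M X Y"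
proof -
  let ?D = "\<lambda>r. Max ((\<lambda>k. \<bar>F k r - F 0 r\<bar>) ` {1..n})"
  have D: "delta0 p n M X Y = (SUP r\<in>{0..}. ?D r)" by (simp add: delta0_def F_def)
  have le1: "\<bar>F k r - F 0 r\<bar> \<le> 1" for k r
    using prob_le_1[of "{\<omega>\<in>space M. vnorm p (U p n X Y k \<omega>) \<le> r}"]
      prob_le_1[of "{\<omega>\<in>space M. vnorm p (U p n X Y 0 \<omega>) \<le> r}"]
      measure_nonneg[of M "{\<omega>\<in>space M. vnorm p (U p n X Y k \<omega>) \<le> r}"]
      measure_nonneg[of M "{\<omega>\<in>space M. vnorm p (U p n X Y 0 \<omega>) \<le> r}"]
    unfolding F_def by linarith
  have bdd: "bdd_above (?D ` {0..})" using n le1 by (intro bdd_aboveI[where M=1]) auto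
  have up: "\<bar>F k r - F 0 r\<bar> \<le> delta0 p n M X Y" if "k \<in> {1..n}" "r \<ge> 0" for k r
  proof -
    have "\<bar>F k r - F 0 r\<bar> \<le> ?D r" using that by (intro Max_ge) auto
    also have "\<dots> \<le> delta0 p n M X Y" unfolding D using that bdd by (intro cSUP_upper) auto
    finally show ?thesis .
  qed
  have "0 \<le> delta0 p n M X Y" using up[of 1 0] n by (auto intro: order_trans[OF abs_ge_zero])
  then show ?thesis using assms up[of k s] F_neg[of s k] F_neg[of s 0]
    by (cases "k = 0"; cases "s < 0") auto
qed

lemma delta0_le:
  assumes "\<And>k r. k \<in> {1..n} \<Longrightarrow> r \<ge> 0 \<Longrightarrow> \<bar>F k r - F 0 r\<bar> \<le> B"
  shows "delta0 p n M X Y \<le> B"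
  unfolding delta0_def using assms n by (intro cSUP_least) (auto simp: F_def)

text \<open>The annulus probability of \<open>W\<^sub>i\<close> is compared with the one of \<open>U\<^sub>i\<^sub>-\<^sub>1\<close>.  When \<open>\<parallel>Y\<^sub>i\<parallel>\<close> is below \<open>t\<close> with
  probability at least one half, putting back \<open>Y\<^sub>i\<close>, which is independent of \<open>W\<^sub>i\<close>, loses only a factor
  two; otherwise the median of \<open>\<parallel>Y\<^sub>i\<parallel>\<close> exceeds \<open>t\<close> and the trivial bound \<open>1\<close> is at most \<open>\<mu>\<^sub>i / t\<close>.\<close>

lemma prob_annulus_le:
  assumes i: "i \<in> {1..n}" and med: "is_median M (\<lambda>\<omega>. vnorm p (Y i \<omega>)) m"
    and e: "\<epsilon> > 0" and t: "0 < t" "t \<le> sqrt (real n) * \<epsilon>"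
    and AC: "prob {\<omega>\<in>space M. r - 3 * \<epsilon> \<le> vnorm p (U p n X Y 0 \<omega>) \<and> vnorm p (U p n X Y 0 \<omega>) \<le> r + 3 * \<epsilon>} \<le> c"
  shows "prob {\<omega>\<in>space M. r - \<epsilon> \<le> vnorm p (W i \<omega>) \<and> vnorm p (W i \<omega>) \<le> r + 2 * \<epsilon>}
    \<le> 4 * delta0 p n M X Y + 2 * c + m / t"
proof -
  define A where "A = {w\<in>space (Rp p). r - \<epsilon> \<le> vnorm p w \<and> vnorm p w \<le> r + 2 * \<epsilon>}"
  define B where "B = {y\<in>space (Rp p). vnorm p y \<le> t}"
  note [measurable] = measurable_vnorm_Rp[OF p]
  have A: "A \<in> sets (Rp p)" and B: "B \<in> sets (Rp p)" unfolding A_def B_def by measurable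
  have Wm: "W i \<in> M \<rightarrow>\<^sub>M Rp p" and Ym: "Y i \<in> M \<rightarrow>\<^sub>M Rp p"
    using indep_var_rv2[OF W_independent(1)[OF i]] Y_measurable[OF i] .
  have WA: "{\<omega>\<in>space M. r - \<epsilon> \<le> vnorm p (W i \<omega>) \<and> vnorm p (W i \<omega>) \<le> r + 2 * \<epsilon>} = W i -` A \<inter> space M"
    using measurable_space[OF Wm] by (auto simp: A_def)
  have YB: "{\<omega>\<in>space M. vnorm p (Y i \<omega>) \<le> t} = Y i -` B \<inter> space M"
    using measurable_space[OF Ym] by (auto simp: B_def)
  define PW where "PW = prob (W i -` A \<inter> space M)"
  define PY where "PY = prob (Y i -` B \<inter> space M)"
  have PW: "0 \<le> PW" "PW \<le> 1" by (auto simp: PW_def)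
  have s: "sqrt (real n) > 0" using n by simp
  have c0: "0 \<le> c" using AC by (rule order_trans[OF measure_nonneg])
  have d0: "0 \<le> delta0 p n M X Y" using F_diff_le_delta0[of 0 0] by simp
  have mhalf: "prob {\<omega>\<in>space M. vnorm p (Y i \<omega>) \<le> m} \<ge> 1/2"
    using med by (simp add: is_median_def)
  have m0: "0 \<le> m" using med vnorm_nonneg[OF p] by (rule median_nonneg)
  have "PY * PW = prob ((\<lambda>\<omega>. (Y i \<omega>, W i \<omega>)) -` (B \<times> A) \<inter> space M)"
    unfolding PY_def PW_def by (rule indep_varD[OF W_independent(2)[OF i] B A, symmetric])
  also have "\<dots> \<le> prob ({\<omega>\<in>space M. vnorm p (U p n X Y (i-1) \<omega>) \<le> r + 3 * \<epsilon>}
      - {\<omega>\<in>space M. vnorm p (U p n X Y (i-1) \<omega>) \<le> r - 3 * \<epsilon>})"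
  proof (rule finite_measure_mono)
    show "{\<omega>\<in>space M. vnorm p (U p n X Y (i-1) \<omega>) \<le> r + 3 * \<epsilon>}
        - {\<omega>\<in>space M. vnorm p (U p n X Y (i-1) \<omega>) \<le> r - 3 * \<epsilon>} \<in> events"
      using i by (intro sets.Diff F_set) auto
    show "(\<lambda>\<omega>. (Y i \<omega>, W i \<omega>)) -` (B \<times> A) \<inter> space M
        \<subseteq> {\<omega>\<in>space M. vnorm p (U p n X Y (i-1) \<omega>) \<le> r + 3 * \<epsilon>}
          - {\<omega>\<in>space M. vnorm p (U p n X Y (i-1) \<omega>) \<le> r - 3 * \<epsilon>}"
    proof
      fix \<omega> assume "\<omega> \<in> (\<lambda>\<omega>. (Y i \<omega>, W i \<omega>)) -` (B \<times> A) \<inter> space M"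
      then have \<omega>: "\<omega> \<in> space M" "vnorm p (Y i \<omega>) \<le> t"
        "r - \<epsilon> \<le> vnorm p (W i \<omega>)" "vnorm p (W i \<omega>) \<le> r + 2 * \<epsilon>" by (auto simp: A_def B_def)
      have Yj: "\<bar>Y i \<omega> j / sqrt (real n)\<bar> \<le> \<epsilon>" if "j \<in> {1..p}" for j
      proof -
        have "\<bar>Y i \<omega> j\<bar> \<le> sqrt (real n) * \<epsilon>" using abs_le_vnorm[OF that, of "Y i \<omega>"] \<omega>(2) t by linarith
        then show ?thesis using s by (simp add: abs_divide field_simps)
      qed
      have "vnorm p (U p n X Y (i-1) \<omega>) \<le> vnorm p (W i \<omega>) + \<epsilon>"
      proof (rule vnorm_triangle_le[OF p])
        fix j assume j: "j \<in> {1..p}"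
        then have "U p n X Y (i-1) \<omega> j = W i \<omega> j + Y i \<omega> j / sqrt (real n)"
          unfolding U_eq_W_Y[OF i] by (simp add: vadd_def)
        with Yj[OF j] show "\<bar>U p n X Y (i-1) \<omega> j\<bar> \<le> \<bar>W i \<omega> j\<bar> + \<epsilon>" by linarith
      qed
      moreover have "vnorm p (W i \<omega>) \<le> vnorm p (U p n X Y (i-1) \<omega>) + \<epsilon>"
      proof (rule vnorm_triangle_le[OF p])
        fix j assume j: "j \<in> {1..p}"
        then have "U p n X Y (i-1) \<omega> j = W i \<omega> j + Y i \<omega> j / sqrt (real n)"
          unfolding U_eq_W_Y[OF i] by (simp add: vadd_def)
        with Yj[OF j] show "\<bar>W i \<omega> j\<bar> \<le> \<bar>U p n X Y (i-1) \<omega> j\<bar> + \<epsilon>" by linarith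
      qed
      ultimately show "\<omega> \<in> {\<omega>\<in>space M. vnorm p (U p n X Y (i-1) \<omega>) \<le> r + 3 * \<epsilon>}
          - {\<omega>\<in>space M. vnorm p (U p n X Y (i-1) \<omega>) \<le> r - 3 * \<epsilon>}"
        using \<omega> e by auto
    qed
  qed
  also have "\<dots> = F (i-1) (r + 3 * \<epsilon>) - F (i-1) (r - 3 * \<epsilon>)"
    unfolding F_def using i e by (intro finite_measure_Diff F_set) auto
  also have "\<dots> \<le> 2 * delta0 p n M X Y + (F 0 (r + 3 * \<epsilon>) - F 0 (r - 3 * \<epsilon>))"
  proof -
    have "i - 1 \<le> n" using i by auto
    from F_diff_le_delta0[OF this, of "r + 3 * \<epsilon>"] F_diff_le_delta0[OF this, of "r - 3 * \<epsilon>"]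
    show ?thesis by linarith
  qed
  also have "F 0 (r + 3 * \<epsilon>) - F 0 (r - 3 * \<epsilon>)
      \<le> prob {\<omega>\<in>space M. r - 3 * \<epsilon> \<le> vnorm p (U p n X Y 0 \<omega>) \<and> vnorm p (U p n X Y 0 \<omega>) \<le> r + 3 * \<epsilon>}"
    using e by (intro F_increment_le) auto
  also have "\<dots> \<le> c" by (rule AC)
  finally have key: "PY * PW \<le> 2 * delta0 p n M X Y + c" by simp
  show ?thesis
  proof (cases "PY \<ge> 1/2")
    case True
    then have "1/2 * PW \<le> PY * PW" using PW by (intro mult_right_mono) auto
    also note key
    finally have "PW \<le> 4 * delta0 p n M X Y + 2 * c" by simp
    moreover have "0 \<le> m / t" using m0 t by simp
    ultimately show ?thesis unfolding WA PW_def[symmetric] by linarith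
  next
    case False
    have "t < m"
    proof (rule ccontr)
      assume "\<not> t < m"
      then have "prob {\<omega>\<in>space M. vnorm p (Y i \<omega>) \<le> m} \<le> prob {\<omega>\<in>space M. vnorm p (Y i \<omega>) \<le> t}"
        unfolding YB using measurable_sets[OF Ym B] measurable_space[OF Ym]
        by (intro finite_measure_mono) (auto simp: B_def)
      then show False using mhalf False unfolding YB PY_def by linarith
    qed
    then have "1 \<le> m / t" using t by simp
    with PW c0 d0 show ?thesis unfolding WA PW_def[symmetric] by linarith
  qed
qed

end


section \<open>Smoothing error of an exchange, and the choice of the smoothing width\<close>

context lindeberg
begin

lemma abs_zeta_eq:
  "abs_zeta p M (X i) (Y i) = tv_measure (Rp p)
     (\<lambda>A. measure (distr M (Rp p) (X i)) A - measure (distr M (Rp p) (Y i)) A)"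
proof -
  have "zeta p M (X i) (Y i)
      = (\<lambda>A. measure (distr M (Rp p) (X i)) A - measure (distr M (Rp p) (Y i)) A)"
    by (rule ext) (rule zeta_def)
  then show ?thesis by simp
qed

lemma swap_step:
  assumes S: "smoothing p C0 CC r \<epsilon> \<phi> D1 D2 D3" and i: "i \<in> {1..n}"
    and m: "m \<ge> 0" "max_third p M (X i) (Y i) \<le> ennreal m"
    and B: "B \<ge> 0" "(\<integral>\<^sup>+x. ennreal ((vnorm p x)^2) *
        indicator {x. vnorm p x \<ge> sqrt (real n) * \<epsilon> / logep p} x \<partial>abs_zeta p M (X i) (Y i)) \<le> ennreal B"
  shows "\<bar>expectation (\<lambda>\<omega>. \<phi> (U p n X Y i \<omega>)) - expectation (\<lambda>\<omega>. \<phi> (U p n X Y (i - 1) \<omega>))\<bar>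
    \<le> exp CC / (6 * sqrt (real n) ^ 3) * (C0 * (logep p)^2 / \<epsilon>^3)
        * prob {\<omega>\<in>space M. r - \<epsilon> \<le> vnorm p (W i \<omega>) \<and> vnorm p (W i \<omega>) \<le> r + 2 * \<epsilon>} * m
      + C0 * logep p / (\<epsilon>^2 * sqrt (real n) ^ 2) * B"
proof -
  interpret S: smoothing p C0 CC r \<epsilon> \<phi> D1 D2 D3 by (rule S)
  have Xm: "X i \<in> M \<rightarrow>\<^sub>M Rp p" and Ym: "Y i \<in> M \<rightarrow>\<^sub>M Rp p" and Wm: "W i \<in> M \<rightarrow>\<^sub>M Rp p"
    using X_measurable[OF i] Y_measurable[OF i] indep_var_rv2[OF W_independent(1)[OF i]] .
  have s: "sqrt (real n) > 0" using n by simp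
  let ?PX = "distr M (Rp p) (X i)" and ?PY = "distr M (Rp p) (Y i)" and ?PW = "distr M (Rp p) (W i)"
  define f where "f z = \<phi> (vadd p (snd z) (\<lambda>j\<in>{1..p}. fst z j / sqrt (real n)))" for z
  have f: "f \<in> borel_measurable (Rp p \<Otimes>\<^sub>M Rp p)"
    unfolding f_def[abs_def]
  proof (rule measurable_compose[OF measurable_vadd S.phi_measurable])
    show "snd \<in> Rp p \<Otimes>\<^sub>M Rp p \<rightarrow>\<^sub>M Rp p" by (rule measurable_snd)
    fix j assume j: "j \<in> {1..p}"
    have "(\<lambda>z. fst z j) \<in> borel_measurable (Rp p \<Otimes>\<^sub>M Rp p)"
      using j by (rule measurable_Rp_component[OF measurable_fst])
    then show "(\<lambda>z. (\<lambda>j\<in>{1..p}. fst z j / sqrt (real n)) j) \<in> borel_measurable (Rp p \<Otimes>\<^sub>M Rp p)"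
      using j by (simp add: borel_measurable_divide)
  qed
  have f1: "\<bar>f (x, w)\<bar> \<le> 1" for x w
    using S.phi_range[OF vadd_in_Rp[of p w "\<lambda>j\<in>{1..p}. x j / sqrt (real n)"]]
    by (simp add: f_def abs_of_nonneg)
  have EX: "expectation (\<lambda>\<omega>. \<phi> (U p n X Y i \<omega>))
      = (\<integral>x. (\<integral>w. \<phi> (vadd p w (\<lambda>j\<in>{1..p}. x j / sqrt (real n))) \<partial>?PW) \<partial>?PX)"
    using expectation_of_independent_pair[OF W_independent(1)[OF i] f f1]
    by (simp add: f_def U_eq_W_X[OF i])
  have EY: "expectation (\<lambda>\<omega>. \<phi> (U p n X Y (i - 1) \<omega>))
      = (\<integral>x. (\<integral>w. \<phi> (vadd p w (\<lambda>j\<in>{1..p}. x j / sqrt (real n))) \<partial>?PW) \<partial>?PY)"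
    using expectation_of_independent_pair[OF W_independent(2)[OF i] f f1]
    by (simp only: f_def U_eq_W_Y[OF i] fst_conv snd_conv)
  have c: "(\<lambda>x. x j) \<in> borel_measurable (Rp p)" if "j \<in> {1..p}" for j using that by simp
  have PWa: "measure ?PW S.annulus
      = prob {\<omega>\<in>space M. r - \<epsilon> \<le> vnorm p (W i \<omega>) \<and> vnorm p (W i \<omega>) \<le> r + 2 * \<epsilon>}"
    unfolding measure_distr[OF Wm S.annulus_measurable]
    using measurable_space[OF Wm] by (auto simp: S.annulus_def intro!: arg_cong[where f=prob])
  have "\<bar>(\<integral>x. (\<integral>w. \<phi> (vadd p w (\<lambda>j\<in>{1..p}. x j / sqrt (real n))) \<partial>?PW) \<partial>?PX)
        - (\<integral>x. (\<integral>w. \<phi> (vadd p w (\<lambda>j\<in>{1..p}. x j / sqrt (real n))) \<partial>?PW) \<partial>?PY)\<bar>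
    \<le> exp CC / (6 * sqrt (real n)^3) * (C0 * (logep p)^2 / \<epsilon>^3) * measure ?PW S.annulus * m
      + C0 * logep p / (\<epsilon>^2 * sqrt (real n)^2) * B"
  proof (rule S.swap_bound[OF _ _ _ _ _ _ s _ _ _ _ abs_zeta_eq m(1) _ B])
    show "prob_space ?PX" "prob_space ?PY" "prob_space ?PW"
      by (intro prob_space_distr Xm Ym Wm)+
    fix j assume j: "j \<in> {1..p}"
    show "integrable ?PX (\<lambda>x. (x j)^2)" "integrable ?PY (\<lambda>x. (x j)^2)"
      using j c[OF j] X2[OF i j] Y_moments(2)[OF i j]
      by (simp_all add: integrable_distr_eq Xm Ym)
    show "(\<integral>x. x j \<partial>?PX) = (\<integral>x. x j \<partial>?PY)"
      using j c[OF j] X1[OF i j] Y_moments(3)[OF i j] by (simp add: integral_distr Xm Ym)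
    show "(\<integral>\<^sup>+x. ennreal (\<bar>x j\<bar>^3) \<partial>abs_zeta p M (X i) (Y i)) \<le> ennreal m"
      using j by (intro order_trans[OF _ m(2)]) (auto simp: max_third_def)
    fix k assume k: "k \<in> {1..p}"
    have "(\<lambda>x. x j * x k) \<in> borel_measurable (Rp p)" using c[OF j] c[OF k] by simp
    then show "(\<integral>x. x j * x k \<partial>?PX) = (\<integral>x. x j * x k \<partial>?PY)"
      using Y_moments(4)[OF i j k] by (simp add: integral_distr Xm Ym)
  qed simp_all
  then show ?thesis unfolding EX EY PWa .
qed

lemma F_sandwich:
  assumes S: "smoothing p C0 CC s \<epsilon> \<phi> D1 D2 D3" and k: "k \<le> n"
  shows "F k s \<le> expectation (\<lambda>\<omega>. \<phi> (U p n X Y k \<omega>))"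
    and "expectation (\<lambda>\<omega>. \<phi> (U p n X Y k \<omega>)) \<le> F k (s + \<epsilon>)"
proof -
  interpret S: smoothing p C0 CC s \<epsilon> \<phi> D1 D2 D3 by (rule S)
  have U: "U p n X Y k \<omega> \<in> space (Rp p)" for \<omega> by (simp add: U_def restrict_in_Rp)
  have int: "integrable M (\<lambda>\<omega>. \<phi> (U p n X Y k \<omega>))"
    using measurable_compose[OF U_measurable[OF k] S.phi_measurable] S.phi_range[OF U]
    by (intro integrable_const_bound[where B=1]) (auto simp: abs_of_nonneg)
  have F_eq: "F k c = expectation (indicator {\<omega>\<in>space M. vnorm p (U p n X Y k \<omega>) \<le> c})" for c
    using F_set[OF k, of c] by (simp add: F_def)
  have ind: "integrable M (indicator {\<omega>\<in>space M. vnorm p (U p n X Y k \<omega>) \<le> c} :: _ \<Rightarrow> real)" for c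
    using F_set[OF k, of c] by (simp add: emeasure_eq_measure)
  show "F k s \<le> expectation (\<lambda>\<omega>. \<phi> (U p n X Y k \<omega>))"
    unfolding F_eq
    by (rule integral_mono[OF ind int]) (auto simp: indicator_def S.phi_inside[OF U] S.phi_range[OF U])
  show "expectation (\<lambda>\<omega>. \<phi> (U p n X Y k \<omega>)) \<le> F k (s + \<epsilon>)"
    unfolding F_eq
    by (rule integral_mono[OF int ind]) (auto simp: indicator_def S.phi_outside[OF U] S.phi_range[OF U])
qed

text \<open>Second moments dominate the tail integrals in \<^const>\<open>Mn\<close>, so that they can be treated as real numbers.\<close>

lemma tail_finite:
  assumes i: "i \<in> {1..n}"
  shows "(\<integral>\<^sup>+x. ennreal ((vnorm p x)^2) * indicator A x \<partial>abs_zeta p M (X i) (Y i)) < \<infinity>"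
proof -
  have Xm: "X i \<in> M \<rightarrow>\<^sub>M Rp p" and Ym: "Y i \<in> M \<rightarrow>\<^sub>M Rp p"
    using X_measurable[OF i] Y_measurable[OF i] .
  let ?PX = "distr M (Rp p) (X i)" and ?PY = "distr M (Rp p) (Y i)"
  interpret PX: prob_space ?PX by (rule prob_space_distr[OF Xm])
  interpret PY: prob_space ?PY by (rule prob_space_distr[OF Ym])
  define q where "q x = (\<Sum>j\<in>{1..p}. ennreal ((x j)^2))" for x :: "nat \<Rightarrow> real"
  have c: "(\<lambda>x. x j) \<in> borel_measurable (Rp p)" if "j \<in> {1..p}" for j using that by simp
  have q: "q \<in> borel_measurable (Rp p)" unfolding q_def[abs_def]
    by (intro borel_measurable_sum measurable_compose[OF _ measurable_ennreal] borel_measurable_power c)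
  have "ennreal ((vnorm p x)^2) \<le> q x" for x
  proof -
    obtain j where j: "j \<in> {1..p}" "vnorm p x = \<bar>x j\<bar>"
      using Max_in[of "(\<lambda>j. \<bar>x j\<bar>) ` {1..p}"] p unfolding vnorm_def by fastforce
    then show ?thesis unfolding q_def
      using member_le_sum[of j "{1..p}" "\<lambda>j. ennreal ((x j)^2)"] by simp
  qed
  then have "(\<integral>\<^sup>+x. ennreal ((vnorm p x)^2) * indicator A x \<partial>abs_zeta p M (X i) (Y i))
      \<le> (\<integral>\<^sup>+x. q x \<partial>abs_zeta p M (X i) (Y i))"
    by (intro nn_integral_mono) (auto simp: indicator_def)
  also have "\<dots> \<le> (\<integral>\<^sup>+x. q x \<partial>?PX) + (\<integral>\<^sup>+x. q x \<partial>?PY)"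
    unfolding abs_zeta_eq using PX.finite_measure_axioms PY.finite_measure_axioms q
    by (intro nn_integral_tv_measure_le) auto
  also have "\<dots> = (\<Sum>j\<in>{1..p}. \<integral>\<^sup>+\<omega>. ennreal ((X i \<omega> j)^2) \<partial>M) + (\<Sum>j\<in>{1..p}. \<integral>\<^sup>+\<omega>. ennreal ((Y i \<omega> j)^2) \<partial>M)"
  proof -
    have "(\<integral>\<^sup>+x. q x \<partial>distr M (Rp p) V) = (\<Sum>j\<in>{1..p}. \<integral>\<^sup>+\<omega>. ennreal ((V \<omega> j)^2) \<partial>M)"
      if V: "V \<in> M \<rightarrow>\<^sub>M Rp p" for V
    proof -
      have "(\<integral>\<^sup>+x. q x \<partial>distr M (Rp p) V) = (\<integral>\<^sup>+\<omega>. q (V \<omega>) \<partial>M)"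
        by (rule nn_integral_distr[OF V]) (simp add: q)
      also have "\<dots> = (\<Sum>j\<in>{1..p}. \<integral>\<^sup>+\<omega>. ennreal ((V \<omega> j)^2) \<partial>M)"
        unfolding q_def
        by (intro nn_integral_sum measurable_compose[OF _ measurable_ennreal] borel_measurable_power
            measurable_Rp_component[OF V])
      finally show ?thesis .
    qed
    then show ?thesis using Xm Ym by simp
  qed
  also have "\<dots> = (\<Sum>j\<in>{1..p}. ennreal (\<integral>\<omega>. (X i \<omega> j)^2 \<partial>M)) + (\<Sum>j\<in>{1..p}. ennreal (\<integral>\<omega>. (Y i \<omega> j)^2 \<partial>M))"
    using X2[OF i] Y_moments(2)[OF i]
    by (intro arg_cong2[where f="(+)"] sum.cong refl nn_integral_eq_integral) auto
  also have "\<dots> < \<infinity>" by simp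
  finally show ?thesis .
qed

end

text \<open>With \<open>\<epsilon>\<close> as chosen, the coefficient of the recursion is \<open>e\<^sup>-\<^sup>\<CC> / 12\<close>; the cube in \<open>\<epsilon>\<close> is what makes
  \<open>L\<close> and \<open>n\<close> cancel.\<close>

lemma recursion_coefficients:
  fixes l N L C0 CC \<epsilon> Lb :: real
  assumes l: "l > 0" and N: "N > 0" and L: "L > 0" and C0: "C0 > 0"
    and \<epsilon>: "\<epsilon> = (2 * exp (2 * CC) * C0 * l^2 * L) powr (1/3) / N powr (1/6)"
  defines "A \<equiv> exp CC / (6 * sqrt N ^ 3) * (C0 * l^2 / \<epsilon>^3)"
  shows "A * (N * L) = exp (- CC) / 12"
    and "A * (N * Lb) / (sqrt N * \<epsilon> / l)
      = l powr (1/3) * Lb / (N powr (1/3) * L powr (4/3) * (2 * exp (5 * CC) * C0) powr (1/3)) / 12"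
    and "\<epsilon> > 0"
proof -
  define u v w q g where "u = N powr (1/6)" "v = l powr (1/3)" "w = L powr (1/3)"
    "q = (2 * C0) powr (1/3)" "g = exp (CC / 3)"
  note defs = this
  have pos: "u > 0" "v > 0" "w > 0" "q > 0" "g > 0" using assms(1-4) by (simp_all add: defs)
  have cube: "(x powr (1/3))^3 = x" if "x > 0" for x :: real
    using powr_realpow[of "x powr (1/3)" 3] that by (simp add: powr_powr)
  have 1: "v^3 = l" "w^3 = L" "q^3 = 2 * C0" using assms(1-4) by (simp_all add: defs cube)
  have powr_nat: "x powr (real k * a) = (x powr a)^k" if "x > 0" for x a :: real and k :: nat
  proof -
    have "(x powr a)^k = (x powr a) powr real k" using that by (subst powr_realpow) auto
    then show ?thesis by (simp add: powr_powr mult.commute)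
  qed
  have u6: "u^6 = N" and u2: "N powr (1/3) = u^2"
    using powr_nat[OF N, of 6 "1/6"] powr_nat[OF N, of 2 "1/6"] N by (simp_all add: defs)
  have u3: "sqrt N = u^3"
  proof -
    have "sqrt ((u^3)^2) = u^3" using pos by (intro real_sqrt_unique) auto
    moreover have "(u^3)^2 = N" using u6 by (simp add: power_mult[symmetric])
    ultimately show ?thesis by simp
  qed
  have w4: "L powr (4/3) = w^4" using powr_nat[OF L, of 4 "1/3"] by (simp add: defs)
  have ge: "exp CC = g^3" "exp (2 * CC) = g^6" "exp (5 * CC) = g^15"
    by (simp_all add: defs exp_of_nat_mult[symmetric])
  have root: "x powr (1/3) = y" if "y^3 = x" "y > 0" for x y :: real
  proof -
    have "x = y powr 3" using that by simp
    then have "x powr (1/3) = y powr (3 * (1/3))" by (simp only: powr_powr)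
    then show ?thesis using that(2) by simp
  qed
  have r1: "(2 * exp (2 * CC) * C0 * l^2 * L) powr (1/3) = g^2 * q * v^2 * w"
  proof (rule root)
    have "(g^2 * q * v^2 * w)^3 = g^6 * q^3 * (v^3)^2 * w^3"
      by (simp add: power_mult_distrib power_mult[symmetric])
    then show "(g^2 * q * v^2 * w)^3 = 2 * exp (2 * CC) * C0 * l^2 * L" by (simp add: 1 ge)
  qed (use pos in simp)
  have r2: "(2 * exp (5 * CC) * C0) powr (1/3) = g^5 * q"
  proof (rule root)
    show "(g^5 * q)^3 = 2 * exp (5 * CC) * C0"
      by (simp add: power_mult_distrib power_mult[symmetric] 1 ge)
  qed (use pos in simp)
  have e: "\<epsilon> = g^2 * q * v^2 * w / u" unfolding \<epsilon> r1 by (simp add: defs)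
  show "\<epsilon> > 0" using pos by (simp add: e)
  have c0: "C0 = q^3 / 2" using 1 by simp
  have A: "A = 1 / (12 * g^3 * u^6 * w^3)"
  proof -
    have "A = g^3 / (6 * (u^3 * u^3 * u^3)) * (q^3 / 2 * v^6 / (g^3 * g^3 * q^3 * v^6 * w^3 / u^3))"
      unfolding A_def e u3 ge c0 1(1)[symmetric]
      by (simp add: power_mult_distrib power_divide power_mult[symmetric] power_add[symmetric])
    also have "\<dots> = 1 / (12 * g^3 * (u^3 * u^3) * w^3)"
    proof -
      have "G / (6 * (T * T * T)) * (Q / 2 * H / (G * G * Q * H * K / T)) = 1 / (12 * G * (T * T) * K)"
        if "G > 0" "T > 0" "Q > 0" "H > 0" "K > 0" for G T Q H K :: real
        using that by (simp add: field_simps)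
      from this[of "g^3" "u^3" "q^3" "v^6" "w^3"] show ?thesis using pos by (simp only: zero_less_power)
    qed
    finally show ?thesis by (simp add: power_add[symmetric])
  qed
  show "A * (N * L) = exp (- CC) / 12"
    unfolding A exp_minus ge u6[symmetric] 1(2)[symmetric] using pos by (simp add: inverse_eq_divide)
  have "A * (N * Lb) / (sqrt N * \<epsilon> / l) = v * Lb / (u^2 * w^4 * (g^5 * q)) / 12"
  proof -
    have alg: "1 / (12 * G * U * K) * (U * Lb) / ((u * R) * (H * q * S * w / u) / (v * S))
        = v * Lb / (R * (K * w) * (G * H * q)) / 12"
      if "G > 0" "U > 0" "K > 0" "R > 0" "H > 0" "S > 0" for G U K R H S :: real
      using that pos by (simp add: field_simps)
    have pw: "u^3 = u * u^2" "v^3 = v * v^2" "w^4 = w^3 * w" "g^5 = g^3 * g^2"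
      using power_add[of w 3 1] power_add[of g 3 2]
      by (simp_all add: power3_eq_cube power2_eq_square)
    show ?thesis
      unfolding A u3 unfolding u6[symmetric] e 1(1)[symmetric] pw by (rule alg) (use pos in simp_all)
  qed
  then show "A * (N * Lb) / (sqrt N * \<epsilon> / l)
      = l powr (1/3) * Lb / (N powr (1/3) * L powr (4/3) * (2 * exp (5 * CC) * C0) powr (1/3)) / 12"
    by (simp only: r2 u2 w4) (simp add: defs)
qed


section \<open>The bound for the interpolating sums\<close>

theorem theorem3p1:
  fixes M :: "'w measure" and n p :: nat
    and X Y :: "nat \<Rightarrow> 'w \<Rightarrow> nat \<Rightarrow> real"
    and \<Theta>0 C0 CC \<mu> \<sigma>max \<sigma>min L \<epsilon> :: real and \<mu>i :: "nat \<Rightarrow> real"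
  assumes "prob_space M" and "n \<ge> 1" and "p \<ge> 1"
    \<comment> \<open>universal constants\<close>
    and "AC_constant \<Theta>0" and "smoothing_constants C0 CC"
    \<comment> \<open>\<open>X\<^sub>1, \<dots>, X\<^sub>n\<close>, \<open>Y\<^sub>1, \<dots>, Y\<^sub>n\<close> are mutually independent\<close>
    and "prob_space.indep_vars M (\<lambda>_. Rp p) (case_sum X Y) ({1..n} <+> {1..n})"
    and "\<And>i j. i \<in> {1..n} \<Longrightarrow> j \<in> {1..p} \<Longrightarrow> integrable M (\<lambda>\<omega>. (X i \<omega> j)^2)"
    and "\<And>i j. i \<in> {1..n} \<Longrightarrow> j \<in> {1..p} \<Longrightarrow> (\<integral>\<omega>. X i \<omega> j \<partial>M) = 0"
    and "\<And>i. i \<in> {1..n} \<Longrightarrow> gaussian_vector p M (Y i) (\<lambda>j k. \<integral>\<omega>. X i \<omega> j * X i \<omega> k \<partial>M)"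
    and "\<And>i. i \<in> {1..n} \<Longrightarrow> is_median M (\<lambda>\<omega>. vnorm p (Y i \<omega>)) (\<mu>i i)"
    and "0 < Ln p n M X Y" and "Ln p n M X Y < \<infinity>"
    and "is_median M (\<lambda>\<omega>. vnorm p (U p n X Y 0 \<omega>)) \<mu>"
    and "\<sigma>max = sqrt (Max ((\<lambda>j. prob_space.variance M (\<lambda>\<omega>. U p n X Y 0 \<omega> j)) ` {1..p}))"
    and "\<sigma>min = sqrt (Min ((\<lambda>j. prob_space.variance M (\<lambda>\<omega>. U p n X Y 0 \<omega> j)) ` {1..p}))"
    and "\<sigma>min > 0"
    and "L = enn2real (Ln p n M X Y)"
    and "\<epsilon> = eps_n p n C0 CC L"
  shows "delta0 p n M X Y \<le>
           4 * Phi_AC \<Theta>0 \<mu> \<sigma>max \<sigma>min * \<epsilon>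
           + 2 * C0 * logep p * enn2real (Mn p n M X Y \<epsilon>) / \<epsilon>^2
           + logep p powr (1/3) * enn2real (Lbar p n M X Y \<mu>i)
             / (real n powr (1/3) * L powr (4/3) * (2 * exp (5 * CC) * C0) powr (1/3))"
proof -
  interpret lindeberg M n p X Y
    using assms(1-3,6-9) by (intro lindeberg.intro lindeberg_axioms.intro) 
  let ?\<delta> = "delta0 p n M X Y" and ?N = "real n"
  define \<Phi> where "\<Phi> = Phi_AC \<Theta>0 \<mu> \<sigma>max \<sigma>min"
  define l where "l = logep p"
  have l: "l \<ge> 1" unfolding l_def by (rule logep_ge_1[OF p])
  have N: "?N > 0" using n by simp
  have C0: "C0 > 0" and CC: "CC > 0" using assms(5) by (auto simp: smoothing_constants_def)

  \<comment> \<open>The pseudo-moments are finite sums of real numbers.\<close>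
  have avg: "(\<Sum>i\<in>{1..n}. ennreal (g i)) / of_nat n = ennreal ((\<Sum>i\<in>{1..n}. g i) / ?N)"
    if "\<And>i. i \<in> {1..n} \<Longrightarrow> 0 \<le> g i" for g :: "nat \<Rightarrow> real"
  proof -
    have "(\<Sum>i\<in>{1..n}. ennreal (g i)) = ennreal (\<Sum>i\<in>{1..n}. g i)"
      using that by (rule sum_ennreal)
    then show ?thesis
      using that N by (simp only: ennreal_of_nat_eq_real_of_nat) (intro divide_ennreal sum_nonneg)
  qed
  define m where "m i = enn2real (max_third p M (X i) (Y i))" for i
  have m0: "0 \<le> m i" for i by (simp add: m_def)
  have m: "max_third p M (X i) (Y i) = ennreal (m i)" if i: "i \<in> {1..n}" for i
  proof -
    have "(\<Sum>i\<in>{1..n}. max_third p M (X i) (Y i)) \<noteq> \<top>"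
    proof
      assume "(\<Sum>i\<in>{1..n}. max_third p M (X i) (Y i)) = \<top>"
      then have "Ln p n M X Y = \<top>"
        by (simp only: Ln_def ennreal_top_divide) (simp add: ennreal_of_nat_eq_real_of_nat)
      with assms(12) show False by simp
    qed
    then have "max_third p M (X i) (Y i) \<noteq> \<top>" using i by auto
    then show ?thesis by (simp add: m_def ennreal_enn2real_if)
  qed
  define B where "B i = enn2real (\<integral>\<^sup>+x. ennreal ((vnorm p x)^2) *
        indicator {x. vnorm p x \<ge> sqrt (real n) * \<epsilon> / logep p} x \<partial>abs_zeta p M (X i) (Y i))" for i
  have B0: "0 \<le> B i" for i by (simp add: B_def)
  have B: "(\<integral>\<^sup>+x. ennreal ((vnorm p x)^2) *
        indicator {x. vnorm p x \<ge> sqrt (real n) * \<epsilon> / logep p} x \<partial>abs_zeta p M (X i) (Y i)) = ennreal (B i)"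
    if "i \<in> {1..n}" for i
    using tail_finite[OF that] by (simp add: B_def less_top)
  define a where "a i = \<mu>i i + sigma_i p M (Y i)" for i
  have sig: "0 \<le> sigma_i p M (Y i)" for i
  proof -
    have "0 \<le> variance (\<lambda>\<omega>. Y i \<omega> 1)" by (rule variance_positive)
    also have "\<dots> \<le> Max ((\<lambda>j. variance (\<lambda>\<omega>. Y i \<omega> j)) ` {1..p})" using p by (intro Max_ge) auto
    finally show ?thesis by (simp add: sigma_i_def)
  qed
  have mu: "0 \<le> \<mu>i i" if "i \<in> {1..n}" for i
    using assms(10)[OF that] vnorm_nonneg[OF p] by (rule median_nonneg)
  have a0: "0 \<le> a i" if "i \<in> {1..n}" for i using mu[OF that] sig by (simp add: a_def)
  have Ln_eq: "Ln p n M X Y = ennreal ((\<Sum>i\<in>{1..n}. m i) / ?N)"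
  proof -
    have "Ln p n M X Y = (\<Sum>i\<in>{1..n}. ennreal (m i)) / of_nat n"
      unfolding Ln_def by (intro arg_cong2[where f="(/)"] sum.cong refl m)
    also have "\<dots> = ennreal ((\<Sum>i\<in>{1..n}. m i) / ?N)" by (rule avg) (rule m0)
    finally show ?thesis .
  qed
  define Lb where "Lb = enn2real (Lbar p n M X Y \<mu>i)"
  define Mb where "Mb = enn2real (Mn p n M X Y \<epsilon>)"
  have L_eq: "(\<Sum>i\<in>{1..n}. m i) = ?N * L"
  proof -
    have "L = (\<Sum>i\<in>{1..n}. m i) / ?N"
      unfolding assms(17) Ln_eq using N
      by (intro enn2real_ennreal divide_nonneg_nonneg sum_nonneg m0) auto
    then show ?thesis using N by simp
  qed
  have Lb_eq: "(\<Sum>i\<in>{1..n}. a i * m i) = ?N * Lb"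
  proof -
    have "Lbar p n M X Y \<mu>i = (\<Sum>i\<in>{1..n}. ennreal (a i * m i)) / of_nat n"
      unfolding Lbar_def
      by (intro arg_cong2[where f="(/)"] sum.cong refl) (simp add: a_def[symmetric] m a0 m0 ennreal_mult)
    also have "\<dots> = ennreal ((\<Sum>i\<in>{1..n}. a i * m i) / ?N)"
      by (rule avg) (simp add: a0 m0)
    finally have "Lb = (\<Sum>i\<in>{1..n}. a i * m i) / ?N"
      unfolding Lb_def using N
      by (simp only:) (intro enn2real_ennreal divide_nonneg_nonneg sum_nonneg mult_nonneg_nonneg a0 m0, auto)
    then show ?thesis using N by simp
  qed
  have Mb_eq: "(\<Sum>i\<in>{1..n}. B i) = ?N * Mb"
  proof -
    have "Mn p n M X Y \<epsilon> = (\<Sum>i\<in>{1..n}. ennreal (B i)) / of_nat n"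
      unfolding Mn_def by (intro arg_cong2[where f="(/)"] sum.cong refl B)
    also have "\<dots> = ennreal ((\<Sum>i\<in>{1..n}. B i) / ?N)" by (rule avg) (simp add: B0)
    finally have "Mb = (\<Sum>i\<in>{1..n}. B i) / ?N" unfolding Mb_def using N
      by (simp only:) (intro enn2real_ennreal divide_nonneg_nonneg sum_nonneg B0, auto)
    then show ?thesis using N by simp
  qed
  have L: "L > 0"
    using assms(11,12) unfolding assms(17) by (simp add: enn2real_positive_iff)

  define A where "A = exp CC / (6 * sqrt ?N ^ 3) * (C0 * l^2 / \<epsilon>^3)"
  define K where "K = C0 * l / (\<epsilon>^2 * sqrt ?N ^ 2)"
  define t where "t = sqrt ?N * \<epsilon> / l"
  define T where "T = l powr (1/3) * Lb / (?N powr (1/3) * L powr (4/3) * (2 * exp (5 * CC) * C0) powr (1/3))"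
  have eps_eq: "\<epsilon> = (2 * exp (2 * CC) * C0 * l^2 * L) powr (1/3) / ?N powr (1/6)"
    unfolding assms(18) eps_n_def l_def ..
  have l0: "l > 0" using l by simp
  note coeff = recursion_coefficients[OF l0 N L C0 eps_eq, folded A_def]
  have e: "\<epsilon> > 0" by (rule coeff(3))
  have A0: "0 \<le> A" using C0 e by (simp add: A_def)
  have K0: "0 \<le> K" using C0 l0 by (simp add: K_def)
  have t0: "0 < t" using N e l0 by (simp add: t_def)
  have t_le: "t \<le> sqrt ?N * \<epsilon>"
  proof -
    have "sqrt ?N * \<epsilon> / l \<le> sqrt ?N * \<epsilon> / 1" using l e N by (intro divide_left_mono) auto
    then show ?thesis by (simp add: t_def)
  qed
  have AC: "prob {\<omega>\<in>space M. r - c \<le> vnorm p (U p n X Y 0 \<omega>) \<and> vnorm p (U p n X Y 0 \<omega>) \<le> r + c} \<le> \<Phi> * c"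
    if "r \<ge> 0" "c \<ge> 0" for r c
    unfolding \<Phi>_def
    by (rule anti_concentration[OF assms(4) p U_measurable U0_gaussian assms(13-16) that]) simp
  have \<Phi>e: "0 \<le> \<Phi> * \<epsilon>" using AC[of 0 \<epsilon>] e by (auto intro: order_trans[OF measure_nonneg])
  have d0: "0 \<le> ?\<delta>" using F_diff_le_delta0[of 0 0] by simp

  \<comment> \<open>Smoothing error, uniformly in the radius.\<close>
  define Q where "Q = A * (4 * ?\<delta> + 6 * (\<Phi> * \<epsilon>)) * (?N * L) + A * (?N * Lb) / t + K * (?N * Mb)"
  have smooth: "\<bar>expectation (\<lambda>\<omega>. \<phi> (U p n X Y k \<omega>)) - expectation (\<lambda>\<omega>. \<phi> (U p n X Y 0 \<omega>))\<bar> \<le> Q"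
    if S: "smoothing p C0 CC r \<epsilon> \<phi> D1 D2 D3" and r: "r \<ge> 0" and k: "k \<le> n" for r \<phi> D1 D2 D3 k
  proof -
    let ?E = "\<lambda>k. expectation (\<lambda>\<omega>. \<phi> (U p n X Y k \<omega>))"
    \<comment> \<open>The bound for one exchange, with the annulus probability already replaced.\<close>
    define b where "b i = A * ((4 * ?\<delta> + 6 * (\<Phi> * \<epsilon>)) + a i / t) * m i + K * B i" for i
    have step: "\<bar>?E i - ?E (i - 1)\<bar> \<le> b i" if i: "i \<in> {1..n}" for i
    proof -
      let ?P = "prob {\<omega>\<in>space M. r - \<epsilon> \<le> vnorm p (W i \<omega>) \<and> vnorm p (W i \<omega>) \<le> r + 2 * \<epsilon>}"
      have "?P \<le> 4 * ?\<delta> + 2 * (\<Phi> * (3 * \<epsilon>)) + \<mu>i i / t"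
        using e r by (intro prob_annulus_le[OF i assms(10)[OF i] e t0 t_le] AC) auto
      also have "\<dots> \<le> (4 * ?\<delta> + 6 * (\<Phi> * \<epsilon>)) + a i / t"
        using sig[of i] t0 by (simp add: a_def divide_right_mono)
      finally have P: "?P \<le> (4 * ?\<delta> + 6 * (\<Phi> * \<epsilon>)) + a i / t" .
      have "\<bar>?E i - ?E (i - 1)\<bar> \<le> A * ?P * m i + K * B i"
        unfolding A_def K_def l_def
        by (rule swap_step[OF S i m0 eq_refl[OF m[OF i]] B0 eq_refl[OF B[OF i]]])
      also have "\<dots> \<le> b i" unfolding b_def
        by (intro add_right_mono mult_right_mono mult_left_mono P A0 m0)
      finally show ?thesis .
    qed
    have b0: "0 \<le> b i" if "i \<in> {1..n}" for i using step[OF that] by linarith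
    have "\<bar>?E k - ?E 0\<bar> \<le> (\<Sum>i\<in>{1..k}. b i)"
      using k
    proof (induction k)
      case (Suc k)
      then have "\<bar>?E (Suc k) - ?E k\<bar> \<le> b (Suc k)" using step[of "Suc k"] by auto
      moreover have "\<bar>?E k - ?E 0\<bar> \<le> (\<Sum>i\<in>{1..k}. b i)" using Suc by simp
      moreover have "(\<Sum>i\<in>{1..Suc k}. b i) = (\<Sum>i\<in>{1..k}. b i) + b (Suc k)" by simp
      ultimately show ?case by linarith
    qed simp
    also have "\<dots> \<le> (\<Sum>i\<in>{1..n}. b i)" using k b0 by (intro sum_mono2) auto
    also have "\<dots> = A * (4 * ?\<delta> + 6 * (\<Phi> * \<epsilon>)) * (\<Sum>i\<in>{1..n}. m i)
        + A / t * (\<Sum>i\<in>{1..n}. a i * m i) + K * (\<Sum>i\<in>{1..n}. B i)"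
      unfolding b_def sum_distrib_left sum.distrib[symmetric]
      by (intro sum.cong refl) (simp add: algebra_simps)
    also have "\<dots> = Q" unfolding L_eq Lb_eq Mb_eq Q_def by simp
    finally show ?thesis .
  qed
  have Q0: "0 \<le> Q"
  proof -
    have "0 \<le> 4 * ?\<delta> + 6 * (\<Phi> * \<epsilon>)" using d0 \<Phi>e by linarith
    moreover have "0 \<le> Lb" "0 \<le> Mb" by (simp_all add: Lb_def Mb_def)
    ultimately show ?thesis unfolding Q_def using A0 K0 L N t0 by simp
  qed

  have ac_F: "F 0 (r + \<epsilon>) - F 0 r \<le> \<Phi> * \<epsilon>" "F 0 r - F 0 (r - \<epsilon>) \<le> \<Phi> * \<epsilon>" if r: "r \<ge> 0" for r
    using e by (auto intro!: order_trans[OF F_increment_le AC[OF r]])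
  have "?\<delta> \<le> \<Phi> * \<epsilon> + Q"
  proof (rule delta0_le)
    fix k and r :: real assume "k \<in> {1..n}" and r: "r \<ge> 0"
    then have k: "k \<le> n" by simp
    have *: "F k s \<le> F 0 (s + \<epsilon>) + Q \<and> F 0 s \<le> F k (s + \<epsilon>) + Q" if s: "s \<ge> 0" for s
    proof -
      obtain \<phi> D1 D2 D3 where "smoother p C0 CC s \<epsilon> \<phi> D1 D2 D3"
        using smoother_exists[OF assms(5) p s e] by blast
      then have S: "smoothing p C0 CC s \<epsilon> \<phi> D1 D2 D3"
        using p e CC by (intro smoothing.intro)
      from F_sandwich[OF S k] F_sandwich[OF S le0] smooth[OF S s k] show ?thesis by linarith
    qed
    have "F k r - F 0 r \<le> \<Phi> * \<epsilon> + Q" using *[OF r] ac_F(1)[OF r] by linarith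
    moreover have "F 0 r - F k r \<le> \<Phi> * \<epsilon> + Q"
    proof (cases "r \<ge> \<epsilon>")
      case True
      then show ?thesis using *[of "r - \<epsilon>"] ac_F(2)[OF r] by simp
    next
      \<comment> \<open>No smoothing function sits at a negative radius, but then \<open>F 0 r\<close> itself is small.\<close>
      case False
      then have "F 0 r \<le> \<Phi> * \<epsilon>" using ac_F(2)[OF r] F_neg[of "r - \<epsilon>" 0] by simp
      moreover have "0 \<le> F k r" by (simp add: F_def)
      ultimately show ?thesis using Q0 by linarith
    qed
    ultimately show "\<bar>F k r - F 0 r\<bar> \<le> \<Phi> * \<epsilon> + Q" by linarith
  qed
  moreover have "Q \<le> (4 * ?\<delta> + 6 * (\<Phi> * \<epsilon>)) / 12 + T / 12 + C0 * l * Mb / \<epsilon>^2"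
  proof -
    have "A * (4 * ?\<delta> + 6 * (\<Phi> * \<epsilon>)) * (?N * L) = (4 * ?\<delta> + 6 * (\<Phi> * \<epsilon>)) * (A * (?N * L))"
      by simp
    also have "\<dots> \<le> (4 * ?\<delta> + 6 * (\<Phi> * \<epsilon>)) * (1 / 12)"
      unfolding coeff(1) using d0 \<Phi>e CC by (intro mult_left_mono) auto
    finally have "A * (4 * ?\<delta> + 6 * (\<Phi> * \<epsilon>)) * (?N * L) \<le> (4 * ?\<delta> + 6 * (\<Phi> * \<epsilon>)) / 12" by simp
    moreover have "A * (?N * Lb) / t = T / 12" unfolding t_def T_def by (rule coeff(2))
    moreover have "K * (?N * Mb) = C0 * l * Mb / \<epsilon>^2" using N by (simp add: K_def)
    ultimately show ?thesis unfolding Q_def by linarith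
  qed
  moreover have "0 \<le> T" unfolding T_def Lb_def using l0 C0 by simp
  moreover have "0 \<le> C0 * l * Mb / \<epsilon>^2" unfolding Mb_def using l0 C0 by simp
  ultimately have "?\<delta> \<le> 4 * (\<Phi> * \<epsilon>) + 2 * (C0 * l * Mb / \<epsilon>^2) + T"
    using \<Phi>e by argo
  then show ?thesis by (simp add: \<Phi>_def l_def Mb_def T_def Lb_def mult.assoc)
qed

end
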